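(* For every integer $n\ge1$, the capacity-achieving input distribution $P_{X^\ast}$ of the binomial channel with $n$ trials satisfies \[ |\mathrm{supp}(P_{X^\ast})|\ge \max\left\{2,\ e^{C(n)},\ \frac18\sqrt{n\,\log^{+}\!\left(\frac{\log\!\left(\frac{n\pi}{2e}\right)}{37850}\right)}\right\}, \] where $\log^+(x)=\max\{0,\log x\}$. In particular $|\mathrm{supp}(P_{X^\ast})|=\Omega(\sqrt{n\log\log n})$ as $n\to\infty$.
   Context: All logarithms are natural. For an integer $n\ge1$, the binomial channel has input $X\in[0,1]$, output $Y\in\{0,\dots,n\}$ and transition law $P_{Y|X}(y|x)=\binom{n}{y}x^y(1-x)^{n-y}$. Its capacity is $C(n)=\max_{P_X} I(X;Y)$ over probability distributions $P_X$ on $[0,1]$; the maximizer $P_{X^\ast}$ (capacity-achieving input distribution) is unique and discrete with finitely many mass points. $\mathrm{supp}(P)$ denotes the support of a distribution $P$, i.e. the set of $x$ such that every open set containing $x$ has positive probability. *)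

theory Defs
  imports "HOL-Probability.Probability"
begin

definition binom_W :: "nat \<Rightarrow> real \<Rightarrow> nat \<Rightarrow> real" where
  "binom_W n x y = real (n choose y) * x ^ y * (1 - x) ^ (n - y)"

definition input_dists :: "real measure set" where
  "input_dists = {M. sets M = sets borel \<and> prob_space M \<and> emeasure M {0..1} = 1}"

definition out_prob :: "nat \<Rightarrow> real measure \<Rightarrow> nat \<Rightarrow> real" where
  "out_prob n M y = (\<integral>x. binom_W n x y \<partial>M)"

definition mutual_info :: "nat \<Rightarrow> real measure \<Rightarrow> real" where
  "mutual_info n M = (\<Sum>y\<le>n. \<integral>x. (if binom_W n x y = 0 then 0
        else binom_W n x y * ln (binom_W n x y / out_prob n M y)) \<partial>M)"

definition capacity :: "nat \<Rightarrow> real" where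
  "capacity n = (SUP M\<in>input_dists. mutual_info n M)"

definition cap_achieving :: "nat \<Rightarrow> real measure \<Rightarrow> bool" where
  "cap_achieving n M \<longleftrightarrow> M \<in> input_dists \<and> mutual_info n M = capacity n"

definition msupp :: "real measure \<Rightarrow> real set" where
  "msupp M = {x. \<forall>U. open U \<longrightarrow> x \<in> U \<longrightarrow> emeasure M U > 0}"

text \<open>log^+ x = max 0 (log x), with value 0 for x \<le> 1 (including x \<le> 0).\<close>
definition logplus :: "real \<Rightarrow> real" where
  "logplus x = (if x \<le> 1 then 0 else ln x)"

end

theory Submission
  imports Defs
begin

text \<open>
  Let \<open>K\<close> be the number of mass points. Mutual information is at most the entropy of the input, so
  \<open>C(n) \<le> ln K\<close>, and the two-point input on \<open>{0, 1}\<close> gives \<open>C(n) \<ge> ln 2\<close>.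

  For the third bound, the arcsine prior \<open>x = sin\<^sup>2 (\<theta> / 2)\<close>, \<open>\<theta>\<close> uniform, has the explicit output law
  \<open>J(y) = c\<^sub>y c\<^sub>n\<^sub>-\<^sub>y\<close> with \<open>c\<^sub>y = (2y choose y) / 4\<^sup>y\<close>, and the divergence of the channel at \<open>x\<close> from \<open>J\<close> is
  constant up to a negative power of \<open>n\<close>, away from the endpoints. With a small correction of \<open>J\<close> at the edges this
  forces the output law of an optimal input to be within a negative power of \<open>n\<close> of \<open>J\<close> in total
  variation. On the other hand, put \<open>d = 8 K\<close> and subtract from \<open>1\<close> twice the normalized Fejer kernels
  of degree \<open>d\<close> centred near the angles \<open>\<plusminus>\<theta>\<close> of the mass points. This trigonometric polynomial is nonpositive
  at all mass points but has mean at least \<open>1/2\<close>, and its coefficients in the Bernstein basis of degree \<open>n\<close>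
  are \<open>O(exp (2 d\<^sup>2 / n))\<close>. Those coefficients are a function of \<open>y\<close> whose expectation is nonpositive under
  the optimal output law and at least \<open>1/2\<close> under \<open>J\<close>, so \<open>exp (128 K\<^sup>2 / n)\<close> is at least a power of \<open>n\<close>.
  This is more than the claimed bound when \<open>ln (n pi / (2 e)) > 37850\<close>; otherwise the third term is \<open>0\<close>.
\<close>

section \<open>Moments of the binomial law\<close>

text \<open>Optimality enters only through the value \<open>capacity n\<close>. It is at least the
  mutual information of the arcsine (Jeffreys) prior, hence at least \<open>capacity_main n\<close>
  up to order n^(-1/2). If all inputs also have divergence at most
  \<open>capacity_main n + 6 / r\<close> from one law \<open>q\<close>, the compensation identity
  leaves only this gap for the divergence of the optimal output from \<open>q\<close>. The law
  \<open>J\<close> cannot itself be \<open>q\<close>: at x = 0 its divergence is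
  \<open>- ln (central_ratio n)\<close>, above \<open>capacity_main n\<close> by
  \<open>stirling_log n + 1 / 2\<close>. Mixing in weight 1 / r near the edges removes this excess
  at a cost of order 1 / r; later r = n^(1/16). Passing from \<open>J\<close> to the optimal output
  loses the supremum of the test function times the total variation, so the Bernstein coefficients
  must be controlled on the scale d^2 / n. They are Cauchy integrals over circles chosen by the mode
  of the binomial law, and Parseval on the grid makes the bound independent of the number of
  kernels. The final contradiction is n^(1/32) against a multiple of (ln n)^2; the constant 37850
  ensures that (ln n) / 32 exceeds 1000, where the exponential has already won.\<close>

definition binom_E :: "nat \<Rightarrow> real \<Rightarrow> (nat \<Rightarrow> real) \<Rightarrow> real" where
  "binom_E n x f = (\<Sum>y\<le>n. binom_W n x y * f y)"

lemma binom_W_nonneg: "0 \<le> x \<Longrightarrow> x \<le> 1 \<Longrightarrow> 0 \<le> binom_W n x y"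
  by (simp add: binom_W_def)

lemma sum_binom_W: "(\<Sum>y\<le>n. binom_W n x y) = 1"
  using binomial_ring[of x "1 - x" n] by (simp add: binom_W_def)

lemma binom_W_le_1:
  assumes "0 \<le> x" "x \<le> 1" shows "binom_W n x y \<le> 1"
proof (cases "y \<le> n")
  case True
  have "binom_W n x y \<le> (\<Sum>y\<le>n. binom_W n x y)"
    using True assms by (intro member_le_sum) (auto simp: binom_W_nonneg)
  then show ?thesis by (simp add: sum_binom_W)
qed (simp add: binom_W_def binomial_eq_0)

lemma binom_W_pos: "0 < x \<Longrightarrow> x < 1 \<Longrightarrow> y \<le> n \<Longrightarrow> 0 < binom_W n x y"
  by (simp add: binom_W_def)

lemma binom_W_reflect: "y \<le> n \<Longrightarrow> binom_W n (1 - x) (n - y) = binom_W n x y"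
  by (simp add: binom_W_def binomial_symmetric[symmetric] mult_ac)

lemma binom_E_reflect: "binom_E n (1 - x) f = binom_E n x (\<lambda>y. f (n - y))"
proof -
  have "binom_E n (1 - x) f = (\<Sum>y\<le>n. binom_W n (1 - x) (n - y) * f (n - y))"
    unfolding binom_E_def
    by (rule sum.reindex_bij_witness[of _ "\<lambda>y. n - y" "\<lambda>y. n - y"]) auto
  also have "\<dots> = binom_E n x (\<lambda>y. f (n - y))"
    unfolding binom_E_def by (intro sum.cong refl) (simp add: binom_W_reflect)
  finally show ?thesis .
qed

lemma binom_E_add: "binom_E n x (\<lambda>y. f y + g y) = binom_E n x f + binom_E n x g"
  by (simp add: binom_E_def algebra_simps sum.distrib)

lemma binom_E_diff: "binom_E n x (\<lambda>y. f y - g y) = binom_E n x f - binom_E n x g"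
  by (simp add: binom_E_def algebra_simps sum_subtractf)

lemma binom_E_cmult: "binom_E n x (\<lambda>y. c * f y) = c * binom_E n x f"
  by (simp add: binom_E_def sum_distrib_left mult_ac)

lemma binom_E_const: "binom_E n x (\<lambda>y. c) = c"
  using sum_binom_W[of n x] by (simp add: binom_E_def flip: sum_distrib_right)

lemma binom_E_mono:
  assumes "0 \<le> x" "x \<le> 1" "\<And>y. y \<le> n \<Longrightarrow> f y \<le> g y"
  shows "binom_E n x f \<le> binom_E n x g"
  unfolding binom_E_def using assms
  by (intro sum_mono mult_left_mono) (auto simp: binom_W_nonneg)

lemma binom_W_Suc_Suc:
  "y \<le> n \<Longrightarrow> binom_W (Suc n) x (Suc y) = x * binom_W n x y + (1 - x) * binom_W n x (Suc y)"
proof (cases "y = n")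
  case False
  assume "y \<le> n"
  with False have "n - y = Suc (n - Suc y)" by simp
  then show ?thesis by (simp add: binom_W_def algebra_simps)
qed (simp add: binom_W_def binomial_eq_0)

text \<open>Conditioning on the last trial, which leaves the count unchanged with probability 1 - x
  and raises it by one with probability x. The moment recursion rests on it.\<close>

lemma binom_E_Suc:
  "binom_E (Suc n) x f = (1 - x) * binom_E n x f + x * binom_E n x (\<lambda>y. f (Suc y))"
proof -
  have "binom_E (Suc n) x f
      = binom_W (Suc n) x 0 * f 0 + (\<Sum>y\<le>n. binom_W (Suc n) x (Suc y) * f (Suc y))"
    unfolding binom_E_def by (subst sum.atMost_Suc_shift) simp
  also have "(\<Sum>y\<le>n. binom_W (Suc n) x (Suc y) * f (Suc y))
      = (\<Sum>y\<le>n. (x * binom_W n x y + (1 - x) * binom_W n x (Suc y)) * f (Suc y))"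
    by (intro sum.cong refl) (simp add: binom_W_Suc_Suc)
  also have "\<dots> = x * binom_E n x (\<lambda>y. f (Suc y)) + (1 - x) * (\<Sum>y\<le>n. binom_W n x (Suc y) * f (Suc y))"
    by (simp add: binom_E_def sum.distrib sum_distrib_left algebra_simps sum_subtractf)
  also have "(\<Sum>y\<le>n. binom_W n x (Suc y) * f (Suc y))
      = (\<Sum>y\<le>Suc n. binom_W n x y * f y) - binom_W n x 0 * f 0"
    by (subst sum.atMost_Suc_shift) simp
  also have "(\<Sum>y\<le>Suc n. binom_W n x y * f y) = binom_E n x f"
    by (simp add: binom_E_def binom_W_def)
  finally show ?thesis by (simp add: binom_W_def algebra_simps)
qed

lemma binom_central_moments:
  fixes x :: real
  defines "m \<equiv> \<lambda>n k. binom_E n x (\<lambda>y. (real y - real n * x) ^ k)"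
  shows "m n 1 = 0" "m n 2 = real n * x * (1 - x)"
    "m n 3 = real n * x * (1 - x) * (1 - 2 * x)"
    "m n 4 = 3 * (real n * x * (1 - x))\<^sup>2 + real n * x * (1 - x) * (1 - 6 * x * (1 - x))"
proof -
  have sh1: "binom_E n x (\<lambda>y. (real y - real n * x + a) ^ 1) = m n 1 + a" for n a
    by (simp add: m_def binom_E_add binom_E_const)
  have sh2: "binom_E n x (\<lambda>y. (real y - real n * x + a) ^ 2) = m n 2 + 2 * a * m n 1 + a\<^sup>2" for n a
  proof -
    have "(\<lambda>y. (real y - real n * x + a) ^ 2)
       = (\<lambda>y. (real y - real n * x) ^ 2 + (2 * a * (real y - real n * x) ^ 1 + a\<^sup>2))"
      by (rule ext) (simp add: power2_eq_square algebra_simps)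
    then show ?thesis by (simp only: m_def binom_E_add binom_E_cmult binom_E_const, simp?)
  qed
  have sh3: "binom_E n x (\<lambda>y. (real y - real n * x + a) ^ 3)
      = m n 3 + 3 * a * m n 2 + 3 * a\<^sup>2 * m n 1 + a^3" for n a
  proof -
    have "(\<lambda>y. (real y - real n * x + a) ^ 3)
       = (\<lambda>y. (real y - real n * x) ^ 3 + ((3 * a) * (real y - real n * x) ^ 2
            + ((3 * a\<^sup>2) * (real y - real n * x) ^ 1 + a^3)))"
      by (rule ext) (simp add: power2_eq_square power3_eq_cube algebra_simps)
    then show ?thesis by (simp only: m_def binom_E_add binom_E_cmult binom_E_const, simp?)
  qed
  have sh4: "binom_E n x (\<lambda>y. (real y - real n * x + a) ^ 4)
      = m n 4 + 4 * a * m n 3 + 6 * a\<^sup>2 * m n 2 + 4 * a^3 * m n 1 + a^4" for n a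
  proof -
    have "(\<lambda>y. (real y - real n * x + a) ^ 4)
       = (\<lambda>y. (real y - real n * x) ^ 4 + ((4 * a) * (real y - real n * x) ^ 3
            + ((6 * a\<^sup>2) * (real y - real n * x) ^ 2
            + ((4 * a^3) * (real y - real n * x) ^ 1 + a^4))))"
      by (rule ext) (simp add: power2_eq_square power3_eq_cube power4_eq_xxxx algebra_simps)
    then show ?thesis by (simp only: m_def binom_E_add binom_E_cmult binom_E_const, simp?)
  qed
  \<comment> \<open>The mean moves from n x to (n + 1) x, so a failure shifts the centred count by -
    x and a success by 1 - x; \<open>sh1\<close> to \<open>sh4\<close> expand the shifted
    powers.\<close>
  have step: "m (Suc n) k = (1 - x) * binom_E n x (\<lambda>y. (real y - real n * x + (- x)) ^ k)
      + x * binom_E n x (\<lambda>y. (real y - real n * x + (1 - x)) ^ k)" for n k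
    unfolding m_def binom_E_Suc by (simp add: algebra_simps)
  have m1: "m n 1 = 0" for n
  proof (induction n)
    case 0 then show ?case by (simp add: m_def binom_E_def)
  next
    case (Suc n) then show ?case unfolding step sh1 by (simp add: algebra_simps)
  qed
  have m2: "m n 2 = real n * x * (1 - x)" for n
  proof (induction n)
    case 0 then show ?case by (simp add: m_def binom_E_def)
  next
    case (Suc n) then show ?case unfolding step sh2 m1
      by (simp add: algebra_simps power2_eq_square)
  qed
  have m3: "m n 3 = real n * x * (1 - x) * (1 - 2 * x)" for n
  proof (induction n)
    case 0 then show ?case by (simp add: m_def binom_E_def)
  next
    case (Suc n) then show ?case unfolding step sh3 m1 m2
      by (simp add: algebra_simps power2_eq_square power3_eq_cube)
  qed
  have m4: "m n 4 = 3 * (real n * x * (1 - x))\<^sup>2 + real n * x * (1 - x) * (1 - 6 * x * (1 - x))" for n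
  proof (induction n)
    case 0 then show ?case by (simp add: m_def binom_E_def)
  next
    case (Suc n) then show ?case unfolding step sh4 m1 m2 m3
      by (simp add: algebra_simps power2_eq_square power3_eq_cube power4_eq_xxxx)
  qed
  show "m n 1 = 0" "m n 2 = real n * x * (1 - x)"
    "m n 3 = real n * x * (1 - x) * (1 - 2 * x)"
    "m n 4 = 3 * (real n * x * (1 - x))\<^sup>2 + real n * x * (1 - x) * (1 - 6 * x * (1 - x))"
    by (fact m1 m2 m3 m4)+
qed

text \<open>Size biasing: x W(n, y) / (y + 1) = W(n + 1, y + 1) / (n + 1), and the right-hand
  weights sum to at most 1 / (n + 1). It averages the error term of
  \<open>stirling_log_gap\<close>.\<close>

lemma binom_E_inverse_Suc_le:
  assumes "0 < x" "x \<le> 1" "n \<ge> 1"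
  shows "binom_E n x (\<lambda>y. 1 / real (Suc y)) \<le> 1 / (real n * x)"
proof -
  have "real n * x * (binom_W n x y * (1 / real (Suc y))) \<le> binom_W (Suc n) x (Suc y)" if "y \<le> n" for y
  proof -
    have "real (Suc n choose Suc y) * real (Suc y) = real (Suc n) * real (n choose y)"
      using Suc_times_binomial_eq[of n y] by (metis of_nat_mult mult.commute)
    then have c: "real (n choose y) / real (Suc y) = real (Suc n choose Suc y) / real (Suc n)"
      by (simp add: field_simps)
    have "x * (binom_W n x y * (1 / real (Suc y))) = binom_W (Suc n) x (Suc y) / real (Suc n)"
    proof -
      have "x * (binom_W n x y * (1 / real (Suc y)))
          = real (n choose y) / real (Suc y) * (x * x ^ y * (1 - x) ^ (n - y))"
        by (simp add: binom_W_def)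
      then show ?thesis unfolding c by (simp add: binom_W_def)
    qed
    then have "real n * x * (binom_W n x y * (1 / real (Suc y)))
        = binom_W (Suc n) x (Suc y) * (real n / real (Suc n))"
      unfolding mult.assoc by simp
    also have "\<dots> \<le> binom_W (Suc n) x (Suc y) * 1"
      using assms by (intro mult_left_mono) (auto simp: binom_W_nonneg)
    finally show ?thesis by simp
  qed
  then have "real n * x * binom_E n x (\<lambda>y. 1 / real (Suc y)) \<le> (\<Sum>y\<le>n. binom_W (Suc n) x (Suc y))"
    unfolding binom_E_def sum_distrib_left by (intro sum_mono) auto
  also have "\<dots> \<le> binom_W (Suc n) x 0 + (\<Sum>y\<le>n. binom_W (Suc n) x (Suc y))"
    using assms by (simp add: binom_W_nonneg)
  also have "\<dots> = 1" by (subst sum.atMost_Suc_shift[symmetric]) (rule sum_binom_W)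
  finally show ?thesis using assms by (simp add: field_simps)
qed

section \<open>Taylor bounds at 1 for ln u and u ln u\<close>

lemma ge_value_at_one:
  fixes f f' :: "real \<Rightarrow> real"
  assumes d: "\<And>u. u > 0 \<Longrightarrow> (f has_real_derivative f' u) (at u)"
    and "\<And>u. u \<ge> 1 \<Longrightarrow> 0 \<le> f' u" "\<And>u. 0 < u \<Longrightarrow> u \<le> 1 \<Longrightarrow> f' u \<le> 0" "u > 0"
  shows "f 1 \<le> f u"
proof (cases "u \<ge> 1")
  case True
  then show ?thesis
    by (rule DERIV_nonneg_imp_nondecreasing) (use assms in \<open>auto intro!: exI d\<close>)
next
  case False
  then have "u \<le> 1" by simp
  then show ?thesis
    by (rule DERIV_nonpos_imp_nonincreasing) (use assms in \<open>auto intro!: exI d\<close>)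
qed

lemma ln_le_cubic:
  assumes "u > 0"
  shows "ln u \<le> (u - 1) - (u - 1)\<^sup>2 / 2 + (u - 1)^3 / (3::real)"
proof -
  let ?f = "\<lambda>u. (u - 1) - (u - 1)\<^sup>2 / 2 + (u - 1)^3 / 3 - ln u :: real"
  have "?f 1 \<le> ?f u"
  proof (rule ge_value_at_one[where f' = "\<lambda>u. (u - 1)^3 / u"])
    fix u :: real assume "u > 0"
    then show "(?f has_real_derivative (u - 1)^3 / u) (at u)"
      by (auto intro!: derivative_eq_intros simp: field_simps power2_eq_square power3_eq_cube)
  qed (use assms in \<open>auto simp: divide_nonpos_pos power3_eq_cube mult_nonpos_nonneg mult_nonpos_nonpos zero_le_mult_iff mult_le_0_iff\<close>)
  then show ?thesis by simp
qed

lemma ln_quadratic_sgn: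
  fixes u :: real
  assumes "u > 0"
  shows "u \<ge> 1 \<Longrightarrow> (u - 1) - (u - 1)\<^sup>2 / 2 \<le> ln u" "u \<le> 1 \<Longrightarrow> ln u \<le> (u - 1) - (u - 1)\<^sup>2 / 2"
proof -
  let ?f = "\<lambda>u. ln u - ((u - 1) - (u - 1)\<^sup>2 / 2) :: real"
  have d: "(?f has_real_derivative (u - 1)^2 / u) (at u)" if "u > 0" for u
    using that by (auto intro!: derivative_eq_intros simp: field_simps power2_eq_square)
  have mono: "?f a \<le> ?f b" if "0 < a" "a \<le> b" for a b
    by (rule DERIV_nonneg_imp_nondecreasing[OF that(2)]) (use that in \<open>auto intro!: exI d\<close>)
  show "u \<ge> 1 \<Longrightarrow> (u - 1) - (u - 1)\<^sup>2 / 2 \<le> ln u" using mono[of 1 u] by simp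
  show "u \<le> 1 \<Longrightarrow> ln u \<le> (u - 1) - (u - 1)\<^sup>2 / 2" using mono[of u 1] assms by simp
qed

lemma xlnx_ge_cubic:
  fixes u :: real
  assumes "u \<ge> 0"
  shows "(u - 1) + (u - 1)\<^sup>2 / 2 - (u - 1)^3 / 6 \<le> u * ln u"
proof (cases "u = 0")
  case False
  let ?f = "\<lambda>u. u * ln u - ((u - 1) + (u - 1)\<^sup>2 / 2 - (u - 1)^3 / 6) :: real"
  have "?f 1 \<le> ?f u"
  proof (rule ge_value_at_one[where f' = "\<lambda>u. ln u - ((u - 1) - (u - 1)\<^sup>2 / 2)"])
    fix u :: real assume "u > 0"
    then show "(?f has_real_derivative ln u - ((u - 1) - (u - 1)\<^sup>2 / 2)) (at u)"
      by (auto intro!: derivative_eq_intros simp: field_simps power2_eq_square power3_eq_cube)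
  qed (use assms False ln_quadratic_sgn in \<open>auto simp: le_diff_eq diff_le_eq\<close>)
  then show ?thesis by simp
qed simp

lemma xlnx_le_quartic:
  fixes u :: real
  assumes "u \<ge> 0"
  shows "u * ln u \<le> (u - 1) + (u - 1)\<^sup>2 / 2 - (u - 1)^3 / 6 + (u - 1)^4 / 3"
proof (cases "u = 0")
  case False
  then have "u * ln u \<le> u * ((u - 1) - (u - 1)\<^sup>2 / 2 + (u - 1)^3 / 3)"
    using assms by (intro mult_left_mono ln_le_cubic) auto
  also have "\<dots> = (u - 1) + (u - 1)\<^sup>2 / 2 - (u - 1)^3 / 6 + (u - 1)^4 / 3"
    by (simp add: field_simps power2_eq_square power3_eq_cube power4_eq_xxxx)
  finally show ?thesis .
qed simp

lemma xlnx_le_quadratic: "0 \<le> u \<Longrightarrow> u * ln u \<le> (u - 1) + (u - 1)\<^sup>2" for u :: real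
proof (cases "u = 0")
  case False
  assume "0 \<le> u"
  with False have "u * ln u \<le> u * (u - 1)" by (intro mult_left_mono ln_le_minus_one) auto
  then show ?thesis by (simp add: power2_eq_square algebra_simps)
qed simp

text \<open>Taylor expansion of u ln u at u = Y / mu, averaged with the central moments: the second
  moment gives (1 - x) / 2, the higher ones are errors of order 1 / mu. The main terms for Y and n -
  Y add up to (1 - x) / 2 + x / 2 = 1 / 2 for every x, which is what makes the divergence from the
  arcsine output nearly constant.\<close>

lemma binom_E_Y_ln_Y:
  assumes "0 < x" "x \<le> 1" "n \<ge> 1"
  defines "\<mu> \<equiv> real n * x"
  shows "(1 - x) / 2 - 1 / (6 * \<mu>) \<le> binom_E n x (\<lambda>y. real y * ln (real y / \<mu>))"
    and "binom_E n x (\<lambda>y. real y * ln (real y / \<mu>)) \<le> (1 - x) / 2 + 3 / (1 + \<mu>)"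
proof -
  have mu: "\<mu> > 0" using assms by (simp add: \<mu>_def)
  define z where "z k y = (real y - real n * x) ^ k" for k y
  define m where "m k = binom_E n x (z k)" for k
  have m: "m 1 = 0" "m 2 = \<mu> * (1 - x)" "m 3 = \<mu> * (1 - x) * (1 - 2 * x)"
    "m 4 = 3 * (\<mu> * (1 - x))\<^sup>2 + \<mu> * (1 - x) * (1 - 6 * x * (1 - x))"
    unfolding m_def z_def \<mu>_def by (rule binom_central_moments)+
  have sc: "(real y / \<mu> - 1) ^ k = z k y / \<mu> ^ k" for k y
    using mu by (simp add: z_def \<mu>_def[symmetric] power_divide[symmetric] diff_divide_distrib)
  have sc1: "real y / \<mu> - 1 = z 1 y / \<mu>" for y using sc[of y 1] by simp
  have eq: "real y * ln (real y / \<mu>) = \<mu> * (real y / \<mu> * ln (real y / \<mu>))" for y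
    using mu by simp
  have "(1 - x) / 2 - 1 / (6 * \<mu>) \<le> (1 - x) / 2 - (1 - x) * (1 - 2 * x) / (6 * \<mu>)"
  proof -
    have "(1 - x) * (1 - 2 * x) \<le> (1 - x) * 1" using assms by (intro mult_left_mono) auto
    also have "\<dots> \<le> 1" using assms by simp
    finally show ?thesis using mu by (intro diff_left_mono divide_right_mono) auto
  qed
  also have "\<dots> = binom_E n x (\<lambda>y. z 1 y + (1 / (2 * \<mu>)) * z 2 y - (1 / (6 * \<mu>\<^sup>2)) * z 3 y)"
    unfolding binom_E_add binom_E_diff binom_E_cmult m_def[symmetric] m
    using mu by (simp add: field_simps power2_eq_square)
  also have "\<dots> \<le> binom_E n x (\<lambda>y. real y * ln (real y / \<mu>))"
  proof (rule binom_E_mono)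
    fix y
    have "\<mu> * (z 1 y / \<mu> + z 2 y / \<mu>\<^sup>2 / 2 - z 3 y / \<mu>^3 / 6) \<le> real y * ln (real y / \<mu>)"
      unfolding eq using xlnx_ge_cubic[of "real y / \<mu>"] mu unfolding sc unfolding sc1
      by (intro mult_left_mono) auto
    moreover have "\<mu> * (z 1 y / \<mu> + z 2 y / \<mu>\<^sup>2 / 2 - z 3 y / \<mu>^3 / 6)
        = z 1 y + (1 / (2 * \<mu>)) * z 2 y - (1 / (6 * \<mu>\<^sup>2)) * z 3 y"
      using mu by (simp add: field_simps power2_eq_square power3_eq_cube)
    ultimately show "z 1 y + (1 / (2 * \<mu>)) * z 2 y - (1 / (6 * \<mu>\<^sup>2)) * z 3 y \<le> real y * ln (real y / \<mu>)"
      by simp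
  qed (use assms in auto)
  finally show "(1 - x) / 2 - 1 / (6 * \<mu>) \<le> binom_E n x (\<lambda>y. real y * ln (real y / \<mu>))" .
  show "binom_E n x (\<lambda>y. real y * ln (real y / \<mu>)) \<le> (1 - x) / 2 + 3 / (1 + \<mu>)"
  proof (cases "\<mu> \<ge> 1")
    case True
    have "binom_E n x (\<lambda>y. real y * ln (real y / \<mu>))
      \<le> binom_E n x (\<lambda>y. z 1 y + (1 / (2 * \<mu>)) * z 2 y - (1 / (6 * \<mu>\<^sup>2)) * z 3 y + (1 / (3 * \<mu>^3)) * z 4 y)"
    proof (rule binom_E_mono)
      fix y
      have "real y * ln (real y / \<mu>)
        \<le> \<mu> * (z 1 y / \<mu> + z 2 y / \<mu>\<^sup>2 / 2 - z 3 y / \<mu>^3 / 6 + z 4 y / \<mu>^4 / 3)"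
        unfolding eq using xlnx_le_quartic[of "real y / \<mu>"] mu unfolding sc unfolding sc1
        by (intro mult_left_mono) auto
      moreover have "\<mu> * (z 1 y / \<mu> + z 2 y / \<mu>\<^sup>2 / 2 - z 3 y / \<mu>^3 / 6 + z 4 y / \<mu>^4 / 3)
        = z 1 y + (1 / (2 * \<mu>)) * z 2 y - (1 / (6 * \<mu>\<^sup>2)) * z 3 y + (1 / (3 * \<mu>^3)) * z 4 y"
        using mu by (simp add: field_simps power2_eq_square power3_eq_cube power4_eq_xxxx)
      ultimately show "real y * ln (real y / \<mu>)
        \<le> z 1 y + (1 / (2 * \<mu>)) * z 2 y - (1 / (6 * \<mu>\<^sup>2)) * z 3 y + (1 / (3 * \<mu>^3)) * z 4 y"
        by simp
    qed (use assms in auto)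
    also have "\<dots> = (1 - x) / 2 + (1 - x) * (2 * x - 1) / (6 * \<mu>) + (1 - x)\<^sup>2 / \<mu>
        + (1 - x) * (1 - 6 * x * (1 - x)) / (3 * \<mu>\<^sup>2)"
      unfolding binom_E_add binom_E_diff binom_E_cmult m_def[symmetric] m
      using mu by (simp add: field_simps power2_eq_square power3_eq_cube)
    also have "\<dots> \<le> (1 - x) / 2 + 1 / (6 * \<mu>) + 1 / \<mu> + 1 / (3 * \<mu>)"
    proof (intro add_mono order_refl)
      have "(1 - x) * (2 * x - 1) \<le> (1 - x) * 1"
        using assms by (intro mult_left_mono) auto
      also have "\<dots> \<le> 1" using assms by simp
      finally show "(1 - x) * (2 * x - 1) / (6 * \<mu>) \<le> 1 / (6 * \<mu>)"
        using mu by (intro divide_right_mono) auto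
      show "(1 - x)\<^sup>2 / \<mu> \<le> 1 / \<mu>"
        using mu assms by (intro divide_right_mono) (auto intro: power_le_one)
      have "(1 - x) * (1 - 6 * x * (1 - x)) \<le> (1 - x) * 1"
        using assms by (intro mult_left_mono) auto
      also have "\<dots> \<le> 1" using assms by simp
      finally have "(1 - x) * (1 - 6 * x * (1 - x)) / (3 * \<mu>\<^sup>2) \<le> 1 / (3 * \<mu>\<^sup>2)"
        using mu by (intro divide_right_mono) auto
      also have "\<dots> \<le> 1 / (3 * \<mu>)"
        using True by (simp add: field_simps power2_eq_square)
      finally show "(1 - x) * (1 - 6 * x * (1 - x)) / (3 * \<mu>\<^sup>2) \<le> 1 / (3 * \<mu>)" .
    qed
    also have "\<dots> \<le> (1 - x) / 2 + 3 / (1 + \<mu>)"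
      using True mu by (simp add: field_simps)
    finally show ?thesis .
  next
    case False
    \<comment> \<open>For small mu the quartic bound would leave terms of order 1 / mu^2; the
      quadratic one gives 1 - x with no negative power of mu.\<close>
    have "binom_E n x (\<lambda>y. real y * ln (real y / \<mu>)) \<le> binom_E n x (\<lambda>y. z 1 y + (1 / \<mu>) * z 2 y)"
    proof (rule binom_E_mono)
      fix y
      have "real y * ln (real y / \<mu>) \<le> \<mu> * (z 1 y / \<mu> + z 2 y / \<mu>\<^sup>2)"
        unfolding eq using xlnx_le_quadratic[of "real y / \<mu>"] mu unfolding sc unfolding sc1
        by (intro mult_left_mono) auto
      moreover have "\<mu> * (z 1 y / \<mu> + z 2 y / \<mu>\<^sup>2) = z 1 y + (1 / \<mu>) * z 2 y"
        using mu by (simp add: field_simps power2_eq_square)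
      ultimately show "real y * ln (real y / \<mu>) \<le> z 1 y + (1 / \<mu>) * z 2 y" by simp
    qed (use assms in auto)
    also have "\<dots> = 1 - x"
      unfolding binom_E_add binom_E_cmult m_def[symmetric] m using mu by simp
    also have "\<dots> \<le> (1 - x) / 2 + 1 / 2" using assms by (simp add: field_simps)
    also have "1 / 2 \<le> 3 / (1 + \<mu>)" using False mu by (simp add: field_simps)
    finally show ?thesis by simp
  qed
qed

section \<open>Divergence from the arcsine output law\<close>

text \<open>This is \<open>c_y\<close> = (2y choose y) / 4^y of the overview, as a Wallis product so
  that the ratio of successive values is explicit.\<close>

definition central_ratio :: "nat \<Rightarrow> real" where
  "central_ratio y = (\<Prod>i<y. real (2 * i + 1) / real (2 * i + 2))"

lemma central_ratio_0 [simp]: "central_ratio 0 = 1"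
  by (simp add: central_ratio_def)

lemma central_ratio_Suc:
  "central_ratio (Suc y) = central_ratio y * (real (2 * y + 1) / real (2 * y + 2))"
  by (simp add: central_ratio_def)

lemma central_ratio_pos: "0 < central_ratio y"
  by (auto simp: central_ratio_def intro!: prod_pos)

text \<open>The left side decreases in y because (2y + 1)(2y + 3) <= (2y + 2)^2. Together with
  \<open>central_ratio_lower\<close>, whose right side increases, it fixes the order y^(-1/2) of
  \<open>central_ratio y\<close>.\<close>

lemma central_ratio_upper: "(central_ratio y)\<^sup>2 * real (2 * y + 1) \<le> 1"
proof (induction y)
  case (Suc y)
  have "(central_ratio (Suc y))\<^sup>2 * real (2 * Suc y + 1)
      = ((central_ratio y)\<^sup>2 * real (2 * y + 1)) * (real ((2 * y + 1) * (2 * y + 3)) / (real (2 * y + 2))\<^sup>2)"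
    unfolding central_ratio_Suc by (simp add: field_simps power2_eq_square)
  also have "real ((2 * y + 1) * (2 * y + 3)) / (real (2 * y + 2))\<^sup>2 \<le> 1"
    by (subst divide_le_eq_1_pos, simp) (simp add: power2_eq_square algebra_simps)
  then have "(central_ratio y)\<^sup>2 * real (2 * y + 1) * (real ((2 * y + 1) * (2 * y + 3)) / (real (2 * y + 2))\<^sup>2) \<le> 1 * 1"
    by (intro mult_mono Suc) auto
  finally show ?case by simp
qed simp

lemma central_ratio_lower: "y \<ge> 1 \<Longrightarrow> 1 \<le> 4 * real y * (central_ratio y)\<^sup>2"
proof (induction y rule: dec_induct)
  case base show ?case by (simp add: central_ratio_def power2_eq_square)
next
  case (step y)
  define Y C where "Y = real y" and "C = (central_ratio y)\<^sup>2"
  have Y: "Y \<ge> 1" using step(1) by (simp add: Y_def)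
  have "1 \<le> 4 * Y * C" using step by (simp add: Y_def C_def)
  also have "\<dots> \<le> 4 * Y * C * ((2 * Y + 1)\<^sup>2 / (4 * Y * (Y + 1)))"
  proof -
    have "1 \<le> (2 * Y + 1)\<^sup>2 / (4 * Y * (Y + 1))"
      using Y by (subst le_divide_eq_1_pos, simp) (simp add: power2_eq_square algebra_simps)
    moreover have "0 \<le> 4 * Y * C" using Y by (simp add: C_def)
    ultimately have "4 * Y * C * 1 \<le> 4 * Y * C * ((2 * Y + 1)\<^sup>2 / (4 * Y * (Y + 1)))"
      by (rule mult_left_mono)
    then show ?thesis by (simp only: mult_1_right)
  qed
  also have "\<dots> = 4 * (Y + 1) * (C * ((2 * Y + 1) / (2 * (Y + 1)))\<^sup>2)"
    using Y by (simp add: divide_simps) (simp add: power2_eq_square algebra_simps)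
  also have "\<dots> = 4 * real (Suc y) * (central_ratio (Suc y))\<^sup>2"
  proof -
    have "(2 * Y + 1) / (2 * (Y + 1)) = real (2 * y + 1) / real (2 * y + 2)"
      by (simp add: Y_def algebra_simps)
    then show ?thesis unfolding central_ratio_Suc C_def power_mult_distrib by (simp add: Y_def add.commute)
  qed
  finally show ?case .
qed

text \<open>By Stirling's formula the quantity whose logarithm is taken here tends to \<open>sqrt 2\<close>.\<close>

definition stirling_log :: "nat \<Rightarrow> real" where
  "stirling_log y = ln (central_ratio y) + ln (fact y) + real y - real y * ln (real y)"

lemma stirling_log_0 [simp]: "stirling_log 0 = 0"
  by (simp add: stirling_log_def)

lemma stirling_log_Suc:
  "stirling_log (Suc y) - stirling_log y
    = 1 + ln (real (2 * y + 1) / real (2 * y + 2)) - real y * (ln (real y + 1) - ln (real y))"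
proof -
  have "ln (central_ratio (Suc y)) = ln (central_ratio y) + ln (real (2 * y + 1) / real (2 * y + 2))"
    unfolding central_ratio_Suc by (rule ln_mult_pos) (auto simp: central_ratio_pos)
  moreover have "ln (fact (Suc y)) = ln (real y + 1) + ln (fact y :: real)"
    by (simp add: ln_mult_pos add.commute)
  ultimately show ?thesis by (simp add: stirling_log_def algebra_simps)
qed

text \<open>The difference of the two sides has derivative ln (1 - t^2) <= 0. At u = 1 / (2y + 1),
  multiplied by 2y + 1, the inequality says that \<open>stirling_log\<close> does not decrease from
  y to y + 1.\<close>

lemma stirling_log_mono_aux:
  fixes u :: real
  assumes "0 \<le> u" "u < 1"
  shows "(1 + u) * ln (1 + u) - (1 - u) * ln (1 - u) \<le> 2 * u"
proof -
  let ?g = "\<lambda>u::real. (1 + u) * ln (1 + u) - (1 - u) * ln (1 - u) - 2 * u"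
  have "?g u \<le> ?g 0"
  proof (rule DERIV_nonpos_imp_nonincreasing[OF assms(1)])
    fix t assume t: "0 \<le> t" "t \<le> u"
    have "(?g has_real_derivative ln (1 + t) + ln (1 - t)) (at t)"
      using t assms by (auto intro!: derivative_eq_intros)
    moreover have "ln (1 + t) + ln (1 - t) \<le> 0"
      using ln_le_minus_one[of "1 + t"] ln_le_minus_one[of "1 - t"] t assms by simp
    ultimately show "\<exists>y. (?g has_real_derivative y) (at t) \<and> y \<le> 0" by blast
  qed
  then show ?thesis by simp
qed

lemma stirling_log_le_Suc: "stirling_log y \<le> stirling_log (Suc y)"
proof (cases "y = 0")
  case True
  have "ln (2::real) \<le> 1" using ln_le_minus_one[of 2] by simp
  then show ?thesis using stirling_log_Suc[of y] True by (simp add: ln_div)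
next
  case False
  define u where "u = 1 / real (2 * y + 1)"
  have "u < 1" "u > 0" using False by (auto simp: u_def)
  then have *: "(1 + u) * ln (1 + u) - (1 - u) * ln (1 - u) \<le> 2 * u"
    by (intro stirling_log_mono_aux) auto
  have e1: "1 + u = real (2 * y + 2) / real (2 * y + 1)" "1 - u = real (2 * y) / real (2 * y + 1)"
    by (auto simp: u_def field_simps)
  have "real (2 * y + 1) * ((1 + u) * ln (1 + u) - (1 - u) * ln (1 - u)) \<le> real (2 * y + 1) * (2 * u)"
    using * by (intro mult_left_mono) auto
  also have "\<dots> = 2" by (simp add: u_def del: of_nat_add of_nat_mult of_nat_Suc)
  also have "real (2 * y + 1) * ((1 + u) * ln (1 + u) - (1 - u) * ln (1 - u))
    = real (2 * y + 2) * ln (1 + u) - real (2 * y) * ln (1 - u)"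
    by (simp add: right_diff_distrib mult.assoc[symmetric] e1 del: of_nat_add of_nat_Suc of_nat_mult)
  also have "ln (1 + u) = ln (2 * (real y + 1)) - ln (real (2 * y + 1))"
    unfolding e1 by (subst ln_div) (auto simp: algebra_simps)
  also have "ln (2 * (real y + 1)) = ln 2 + ln (real y + 1)" by (rule ln_mult_pos) auto
  also have "ln (1 - u) = ln (2 * real y) - ln (real (2 * y + 1))"
    unfolding e1 using False by (subst ln_div) auto
  also have "ln (2 * real y) = ln 2 + ln (real y)" using False by (intro ln_mult_pos) auto
  finally have "(real y + 1) * (ln 2 + ln (real y + 1) - ln (real (2 * y + 1)))
      - real y * (ln 2 + ln (real y) - ln (real (2 * y + 1))) \<le> 1"
    by (simp add: algebra_simps)
  moreover have "ln (real (2 * y + 1) / real (2 * y + 2)) = ln (real (2 * y + 1)) - (ln 2 + ln (real y + 1))"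
    by (subst ln_div) (auto simp: ln_mult_pos[symmetric] algebra_simps)
  ultimately show ?thesis using stirling_log_Suc[of y] by (simp add: algebra_simps)
qed

lemma stirling_log_mono: "y \<le> n \<Longrightarrow> stirling_log y \<le> stirling_log n"
  by (rule lift_Suc_mono_le[of stirling_log]) (rule stirling_log_le_Suc)

lemma stirling_log_nonneg: "0 \<le> stirling_log n"
  using stirling_log_mono[of 0 n] by simp

text \<open>From ln (1 + 1/y) >= 1/y - 1/(2 y^2). The bound is written as a difference so that it
  telescopes in \<open>stirling_log_gap_aux\<close>.\<close>

lemma stirling_log_Suc_le:
  assumes "y \<ge> 1"
  shows "stirling_log (Suc y) - stirling_log y \<le> 1 / (2 * real y) - 1 / (2 * real (Suc y))"
proof -
  have "ln (real (2 * y + 1) / real (2 * y + 2)) \<le> real (2 * y + 1) / real (2 * y + 2) - 1"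
    by (rule ln_le_minus_one) auto
  also have "\<dots> = - 1 / (2 * real (Suc y))" by (simp add: field_simps)
  finally have a: "ln (real (2 * y + 1) / real (2 * y + 2)) \<le> - 1 / (2 * real (Suc y))" .
  define u where "u = (real y + 1) / real y"
  have u1: "u - 1 = 1 / real y" using assms by (simp add: u_def field_simps)
  have "(u - 1) - (u - 1)\<^sup>2 / 2 \<le> ln u"
    by (rule ln_quadratic_sgn) (use assms in \<open>auto simp: u_def field_simps\<close>)
  then have "real y * (1 / real y - (1 / real y)\<^sup>2 / 2) \<le> real y * ln u"
    unfolding u1 by (intro mult_left_mono) auto
  moreover have "real y * (1 / real y - (1 / real y)\<^sup>2 / 2) = 1 - 1 / (2 * real y)"
    using assms by (simp add: field_simps power2_eq_square)
  moreover have "ln u = ln (real y + 1) - ln (real y)"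
    using assms unfolding u_def by (subst ln_div) auto
  ultimately show ?thesis using a stirling_log_Suc[of y] by simp
qed

lemma stirling_log_gap_aux:
  assumes "1 \<le> y" "y \<le> n"
  shows "stirling_log n - stirling_log y \<le> 1 / (2 * real y) - 1 / (2 * real n)"
  using assms(2)
proof (induction n rule: dec_induct)
  case (step m)
  then show ?case using stirling_log_Suc_le[of m] assms(1) by simp
qed simp

text \<open>The weaker form 1 / (y + 1) makes sense at y = 0 and is the function averaged by
  \<open>binom_E_inverse_Suc_le\<close>. For y = 0 the step from 0 to 1 and all later steps cost at
  most 1 / 2 each.\<close>

lemma stirling_log_gap:
  assumes "y \<le> n"
  shows "stirling_log n - stirling_log y \<le> 1 / real (Suc y)"
proof -
  consider "y \<ge> 1" | "y = 0" "n = 0" | "y = 0" "n \<ge> 1" by linarith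
  then show ?thesis
  proof cases
    case 1
    have "stirling_log n - stirling_log y \<le> 1 / (2 * real y)"
      using stirling_log_gap_aux[OF 1 assms] by (smt (verit) of_nat_0_le_iff divide_nonneg_nonneg)
    also have "\<dots> \<le> 1 / real (Suc y)" using 1 by (simp add: field_simps)
    finally show ?thesis .
  next
    case 3
    have "stirling_log n - stirling_log 1 \<le> 1 / 2"
      using stirling_log_gap_aux[of 1 n] 3 by (smt (verit) of_nat_0_le_iff divide_nonneg_nonneg of_nat_1 le_refl mult_1_right)
    moreover have "stirling_log 1 \<le> 1 / 2"
    proof -
      have "ln (1/2::real) \<le> 1/2 - 1" by (rule ln_le_minus_one) auto
      then show ?thesis using stirling_log_Suc[of 0] by simp
    qed
    ultimately show ?thesis using 3 by simp
  qed simp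
qed

text \<open>The law \<open>J\<close> of the overview, introduced by its closed form;
  \<open>out_prob_arcsine\<close> identifies it as the output of
  \<open>arcsine_prior\<close>.\<close>

definition arcsine_output :: "nat \<Rightarrow> nat \<Rightarrow> real" where
  "arcsine_output n y = central_ratio y * central_ratio (n - y)"

lemma arcsine_output_pos: "0 < arcsine_output n y"
  by (simp add: arcsine_output_def central_ratio_pos)

section \<open>The divergence expressed through \<open>stirling_log\<close>\<close>

lemma ln_fact_eq: "ln (fact y) = stirling_log y - ln (central_ratio y) - real y + real y * ln (real y)"
  by (simp add: stirling_log_def)

lemma ln_binom_W:
  assumes "0 < x" "x < 1" "y \<le> n"
  shows "ln (binom_W n x y) = ln (fact n) - ln (fact y) - ln (fact (n - y))
    + real y * ln x + real (n - y) * ln (1 - x)"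
proof -
  have "binom_W n x y = fact n / (fact y * fact (n - y)) * (x ^ y * (1 - x) ^ (n - y))"
    using assms by (simp add: binom_W_def binomial_fact)
  then show ?thesis using assms by (simp add: ln_mult ln_div ln_realpow)
qed

text \<open>The factors c_y and c_(n-y) of the arcsine output cancel those coming from
  \<open>ln_fact_eq\<close> for y! and (n - y)!. Besides the constants, only the bounded
  \<open>stirling_log\<close> terms and two terms of the type t ln t remain.\<close>

lemma ln_binom_W_over_arcsine:
  assumes x: "0 < x" "x < 1" and y: "y \<le> n" and n: "n \<ge> 1"
  shows "ln (binom_W n x y / arcsine_output n y) = stirling_log n - ln (central_ratio n)
    - stirling_log y - stirling_log (n - y)
    - real y * ln (real y / (real n * x)) - real (n - y) * ln (real (n - y) / (real n * (1 - x)))"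
proof -
  have t: "real k * ln (real k / (real n * z)) = real k * ln (real k) - real k * ln (real n) - real k * ln z"
    if "z > 0" for k z
    using that n by (cases "k = 0") (auto simp: ln_div ln_mult algebra_simps)
  have "ln (binom_W n x y / arcsine_output n y)
      = ln (binom_W n x y) - ln (central_ratio y) - ln (central_ratio (n - y))"
    using binom_W_pos[OF x y] central_ratio_pos[of y] central_ratio_pos[of "n - y"]
    by (simp add: ln_div ln_mult arcsine_output_def)
  also have "\<dots> = stirling_log n - ln (central_ratio n) - real n + real n * ln (real n)
    - (stirling_log y - real y + real y * ln (real y))
    - (stirling_log (n - y) - real (n - y) + real (n - y) * ln (real (n - y)))
    + real y * ln x + real (n - y) * ln (1 - x)"
    unfolding ln_binom_W[OF x y] ln_fact_eq by simp
  also have "real n * ln (real n) = real y * ln (real n) + real (n - y) * ln (real n)"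
    using y by (simp add: of_nat_diff algebra_simps)
  finally show ?thesis using x y t[of x y] t[of "1 - x" "n - y"] by (simp add: of_nat_diff)
qed

text \<open>The limit value of \<open>kl_arcsine_eq\<close>: both \<open>stirling_log\<close>
  averages are replaced by \<open>stirling_log n\<close> and the two t ln t terms by 1 / 2 in total.
  Since c_n is asymptotic to (pi n)^(-1/2) and \<open>stirling_log n\<close> tends to (ln 2) / 2, it
  is asymptotically (1/2) ln (n pi / (2 e)), the source of that expression in the theorem.\<close>

definition capacity_main :: "nat \<Rightarrow> real" where
  "capacity_main n = - ln (central_ratio n) - stirling_log n - 1 / 2"

lemma capacity_main_ge:
  assumes "n \<ge> 1" shows "capacity_main n \<ge> ln (real n) / 2 - 3 / 2"
proof -
  have "2 * ln (central_ratio n) + ln (real (2 * n + 1)) = ln ((central_ratio n)\<^sup>2 * real (2 * n + 1))"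
    using central_ratio_pos[of n] by (simp add: ln_mult ln_realpow)
  also have "\<dots> \<le> 0" using central_ratio_upper[of n] central_ratio_pos[of n] by simp
  finally have "ln (real (2 * n + 1)) / 2 \<le> - ln (central_ratio n)" by simp
  moreover have "ln (real n) \<le> ln (real (2 * n + 1))" using assms by simp
  moreover have "stirling_log n \<le> 1" using stirling_log_gap[of 0 n] by simp
  ultimately show ?thesis by (simp add: capacity_main_def)
qed

lemma kl_arcsine_eq:
  assumes x: "0 < x" "x < 1" and n: "n \<ge> 1"
  shows "binom_E n x (\<lambda>y. ln (binom_W n x y / arcsine_output n y))
    = stirling_log n - ln (central_ratio n)
      - binom_E n x stirling_log - binom_E n (1 - x) stirling_log
      - binom_E n x (\<lambda>y. real y * ln (real y / (real n * x)))
      - binom_E n (1 - x) (\<lambda>y. real y * ln (real y / (real n * (1 - x))))"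
proof -
  have "binom_E n x (\<lambda>y. ln (binom_W n x y / arcsine_output n y))
    = binom_E n x (\<lambda>y. (stirling_log n - ln (central_ratio n))
    - stirling_log y - stirling_log (n - y)
    - real y * ln (real y / (real n * x)) - real (n - y) * ln (real (n - y) / (real n * (1 - x))))"
    unfolding binom_E_def
    by (intro sum.cong refl) (simp add: ln_binom_W_over_arcsine[OF x _ n])
  then show ?thesis by (simp only: binom_E_diff binom_E_const binom_E_reflect)
qed

text \<open>\<open>stirling_log_gap\<close> and the lower half of \<open>binom_E_Y_ln_Y\<close>. The
  errors are small only when both n x and n (1 - x) are large, so inputs near the boundary need
  \<open>reference_output\<close>.\<close>

lemma kl_arcsine_upper:
  assumes x: "0 < x" "x < 1" and n: "n \<ge> 1"
  shows "binom_E n x (\<lambda>y. ln (binom_W n x y / arcsine_output n y))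
    \<le> capacity_main n + 2 / (real n * x) + 2 / (real n * (1 - x))"
proof -
  have st: "stirling_log n - 1 / (real n * z) \<le> binom_E n z stirling_log" if "0 < z" "z < 1" for z
  proof -
    have "stirling_log n - 1 / (real n * z) \<le> binom_E n z (\<lambda>y. stirling_log n - 1 / real (Suc y))"
      using binom_E_inverse_Suc_le[of z n] that n
      unfolding binom_E_diff binom_E_const by simp
    also have "\<dots> \<le> binom_E n z stirling_log"
      using that stirling_log_gap by (intro binom_E_mono) (auto simp: algebra_simps simp del: of_nat_Suc)
    finally show ?thesis .
  qed
  have r: "1 / (6 * (real n * z)) \<le> 1 / (real n * z)" if "z > 0" for z
    using that n by (simp add: field_simps)
  have d: "2 / t = 1 / t + 1 / t" for t :: real by simp
  have x': "0 < 1 - x" "1 - x < 1" "1 - x \<le> 1" "x \<le> 1" using x by auto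
  show ?thesis
    unfolding kl_arcsine_eq[OF assms] capacity_main_def d
    using st[OF x] st[OF x'(1,2)] binom_E_Y_ln_Y(1)[OF x(1) x'(4) n] binom_E_Y_ln_Y(1)[OF x'(1,3) n]
      r[OF x(1)] r[OF x'(1)]
    by argo
qed

text \<open>Here monotonicity of \<open>stirling_log\<close> suffices, and the bounded error terms
  cover the closed interval, so that the inequality can be integrated against the prior. At the
  endpoints the output is deterministic and the divergence equals - ln c_n.\<close>

lemma kl_arcsine_lower:
  assumes x: "0 \<le> x" "x \<le> 1" and n: "n \<ge> 1"
  shows "capacity_main n - 3 / (1 + real n * x) - 3 / (1 + real n * (1 - x))
    \<le> binom_E n x (\<lambda>y. ln (binom_W n x y / arcsine_output n y))"
proof -
  have *: "binom_E n z stirling_log \<le> stirling_log n" if "0 \<le> z" "z \<le> 1" for z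
  proof -
    have "binom_E n z stirling_log \<le> binom_E n z (\<lambda>_. stirling_log n)"
      using that by (intro binom_E_mono) (auto intro: stirling_log_mono)
    then show ?thesis by (simp add: binom_E_const)
  qed
  have ends: "capacity_main n \<le> - ln (central_ratio n)" "0 \<le> 3 / (1 + real n * x)" "0 \<le> 3 / (1 + real n * (1 - x))"
    using stirling_log_nonneg[of n] x by (auto simp: capacity_main_def)
  consider "0 < x \<and> x < 1" | "x = 0" | "x = 1" using x by linarith
  then show ?thesis
  proof cases
    case 1
    then show ?thesis
      using *[of x] *[of "1 - x"] binom_E_Y_ln_Y(2)[of x n] binom_E_Y_ln_Y(2)[of "1 - x" n] n
      by (subst kl_arcsine_eq) (auto simp: capacity_main_def field_simps)
  next
    case 2
    have "binom_E n x (\<lambda>y. ln (binom_W n x y / arcsine_output n y)) = - ln (central_ratio n)"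
      using 2 n central_ratio_pos[of n] unfolding binom_E_def
      by (subst sum.remove[of _ 0]) (auto simp: binom_W_def power_0_left arcsine_output_def ln_div intro!: sum.neutral)
    then show ?thesis using ends by linarith
  next
    case 3
    have "binom_E n x (\<lambda>y. ln (binom_W n x y / arcsine_output n y)) = - ln (central_ratio n)"
      using 3 n central_ratio_pos[of n] unfolding binom_E_def
      by (subst sum.remove[of _ n]) (auto simp: binom_W_def power_0_left arcsine_output_def ln_div intro!: sum.neutral)
    then show ?thesis using ends by linarith
  qed
qed

section \<open>The arcsine prior\<close>

lemma sin_ge_half:
  assumes "0 \<le> t" "t \<le> pi / 2" shows "t / 2 \<le> sin t"
proof -
  let ?f = "\<lambda>t. sin t - t / 2"
  have d: "(?f has_real_derivative (cos t - 1 / 2)) (at t)" for t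
    by (auto intro!: derivative_eq_intros)
  have "0 \<le> ?f t"
  proof (cases "t \<le> pi / 3")
    case True
    have "?f 0 \<le> ?f t"
    proof (rule DERIV_nonneg_imp_nondecreasing[OF assms(1)])
      fix s assume "0 \<le> s" "s \<le> t"
      then have "cos (pi / 3) \<le> cos s" using True by (intro cos_monotone_0_pi_le) auto
      then have "0 \<le> cos s - 1 / 2" by (simp add: cos_60)
      with d show "\<exists>y. (?f has_real_derivative y) (at s) \<and> 0 \<le> y" by blast
    qed
    then show ?thesis by simp
  next
    case False
    have "?f (pi / 2) \<le> ?f t"
    proof (rule DERIV_nonpos_imp_nonincreasing[OF assms(2)])
      fix s assume "t \<le> s" "s \<le> pi / 2"
      then have "cos s \<le> cos (pi / 3)" using False by (intro cos_monotone_0_pi_le) auto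
      then have "cos s - 1 / 2 \<le> 0" by (simp add: cos_60)
      with d show "\<exists>y. (?f has_real_derivative y) (at s) \<and> y \<le> 0" by blast
    qed
    moreover have "0 \<le> ?f (pi / 2)" using pi_less_4 by simp
    ultimately show ?thesis by linarith
  qed
  then show ?thesis by simp
qed

lemma sin_half_sq_ge:
  assumes "\<bar>t\<bar> \<le> pi" shows "t\<^sup>2 / 16 \<le> (sin (t / 2))\<^sup>2"
proof -
  have "\<bar>t\<bar> / 4 \<le> sin (\<bar>t\<bar> / 2)" using sin_ge_half[of "\<bar>t\<bar> / 2"] assms by simp
  then have "(\<bar>t\<bar> / 4)\<^sup>2 \<le> (sin (\<bar>t\<bar> / 2))\<^sup>2" by (intro power_mono) auto
  also have "(sin (\<bar>t\<bar> / 2))\<^sup>2 = (sin (t / 2))\<^sup>2" by (cases "t \<ge> 0") auto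
  finally show ?thesis by (simp add: power2_eq_square)
qed

lemma integral_lorentz_le:
  fixes B a :: real
  assumes "B > 0" "a \<le> b"
  shows "integral {a..b} (\<lambda>t. 1 / (1 + B * (t - c)\<^sup>2)) \<le> pi / sqrt B"
proof -
  let ?F = "\<lambda>t. arctan (sqrt B * (t - c)) / sqrt B"
  have "((\<lambda>t. 1 / (1 + B * (t - c)\<^sup>2)) has_integral (?F b - ?F a)) {a..b}"
  proof (rule fundamental_theorem_of_calculus[OF assms(2)])
    fix t
    have "(?F has_real_derivative (1 / (1 + B * (t - c)\<^sup>2))) (at t)"
      using assms(1)
      by (auto intro!: derivative_eq_intros simp: power_mult_distrib real_sqrt_pow2 divide_simps)
    then show "(?F has_vector_derivative 1 / (1 + B * (t - c)\<^sup>2)) (at t within {a..b})"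
      by (auto simp: has_real_derivative_iff_has_vector_derivative[symmetric] intro: DERIV_subset)
  qed
  then have "integral {a..b} (\<lambda>t. 1 / (1 + B * (t - c)\<^sup>2)) = ?F b - ?F a" by (rule integral_unique)
  also have "\<dots> = (arctan (sqrt B * (b - c)) - arctan (sqrt B * (a - c))) / sqrt B"
    by (simp add: diff_divide_distrib)
  also have "\<dots> \<le> pi / sqrt B"
    using arctan_ubound[of "sqrt B * (b - c)"] arctan_lbound[of "sqrt B * (a - c)"] assms(1)
    by (intro divide_right_mono) auto
  finally show ?thesis .
qed

lemma lorentz_neq_0:
  fixes B s :: real
  assumes "B \<ge> 0"
  shows "1 + B * s\<^sup>2 \<noteq> 0" "1 + B * s\<^sup>2 / 16 \<noteq> 0"
  using mult_nonneg_nonneg[OF assms zero_le_power2[of s]] by linarith+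

text \<open>Comparison with a Lorentzian by sin^2 (t/2) >= t^2 / 16. The order B^(-1/2) is used
  twice: for the n^(-1/2) error of the arcsine prior, and for the gain of a standard deviation in
  \<open>fejer_form_coeff_bound\<close>.\<close>

lemma integral_inverse_sin_le:
  fixes B :: real
  assumes "B > 0"
  shows "integral {-pi..pi} (\<lambda>t. 1 / (1 + B * (sin (t / 2))\<^sup>2)) \<le> 4 * pi / sqrt B"
proof -
  have "integral {-pi..pi} (\<lambda>t. 1 / (1 + B * (sin (t / 2))\<^sup>2))
      \<le> integral {-pi..pi} (\<lambda>t. 1 / (1 + (B / 16) * (t - 0)\<^sup>2))"
  proof (rule integral_le)
    fix t assume "t \<in> {-pi..pi}"
    then have "t\<^sup>2 / 16 \<le> (sin (t / 2))\<^sup>2" by (intro sin_half_sq_ge) auto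
    then have "B * (t\<^sup>2 / 16) \<le> B * (sin (t / 2))\<^sup>2" using assms by (intro mult_left_mono) auto
    then show "1 / (1 + B * (sin (t / 2))\<^sup>2) \<le> 1 / (1 + (B / 16) * (t - 0)\<^sup>2)"
      using assms by (intro divide_left_mono) (auto simp: add_pos_nonneg)
  qed (use assms in \<open>auto intro!: integrable_continuous_real continuous_intros simp: lorentz_neq_0\<close>)
  also have "\<dots> \<le> pi / sqrt (B / 16)" using assms by (intro integral_lorentz_le) auto
  also have "\<dots> = 4 * pi / sqrt B" by (simp add: real_sqrt_divide)
  finally show ?thesis .
qed

lemma integral_inverse_cos_le:
  fixes B :: real
  assumes "B > 0"
  shows "integral {-pi..pi} (\<lambda>t. 1 / (1 + B * (cos (t / 2))\<^sup>2)) \<le> 8 * pi / sqrt B"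
proof -
  let ?L = "\<lambda>c t. 1 / (1 + (B / 16) * (t - c)\<^sup>2)"
  have i: "?L c integrable_on {-pi..pi}" for c
    using assms by (auto intro!: integrable_continuous_real continuous_intros simp: lorentz_neq_0)
  \<comment> \<open>The cosine vanishes at both ends of the interval, hence one Lorentzian centred
    at each of them.\<close>
  have "integral {-pi..pi} (\<lambda>t. 1 / (1 + B * (cos (t / 2))\<^sup>2))
      \<le> integral {-pi..pi} (\<lambda>t. ?L (-pi) t + ?L pi t)"
  proof (rule integral_le)
    fix t assume t: "t \<in> {-pi..pi}"
    have *: "1 / (1 + B * (cos (t / 2))\<^sup>2) \<le> ?L c t" if "\<bar>t - c\<bar> \<le> pi" "c = pi \<or> c = -pi" for c
    proof -
      have "(t - c)\<^sup>2 / 16 \<le> (sin ((t - c) / 2))\<^sup>2" using that by (intro sin_half_sq_ge) auto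
      also have "(sin ((t - c) / 2))\<^sup>2 = (cos (t / 2))\<^sup>2"
        using that(2) by (auto simp: diff_divide_distrib add_divide_distrib sin_diff sin_add)
      finally have "B * ((t - c)\<^sup>2 / 16) \<le> B * (cos (t / 2))\<^sup>2" using assms by (intro mult_left_mono) auto
      then show ?thesis
        using assms by (intro divide_left_mono) (auto simp: add_pos_nonneg)
    qed
    have nn: "0 \<le> ?L c t" for c using assms by (simp add: add_nonneg_nonneg)
    show "1 / (1 + B * (cos (t / 2))\<^sup>2) \<le> ?L (-pi) t + ?L pi t"
    proof (cases "t \<ge> 0")
      case True
      then have "\<bar>t - pi\<bar> \<le> pi" using t by auto
      from *[OF this disjI1[OF refl]] nn[of "-pi"] show ?thesis by linarith
    next
      case False
      then have "\<bar>t - (-pi)\<bar> \<le> pi" using t by auto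
      from *[OF this disjI2[OF refl]] nn[of pi] show ?thesis by linarith
    qed
  qed (use assms i in \<open>auto intro!: integrable_continuous_real continuous_intros integrable_add simp: lorentz_neq_0\<close>)
  also have "\<dots> = integral {-pi..pi} (?L (-pi)) + integral {-pi..pi} (?L pi)"
    by (rule integral_add[OF i i])
  also have "\<dots> \<le> pi / sqrt (B / 16) + pi / sqrt (B / 16)"
    using assms by (intro add_mono integral_lorentz_le) auto
  also have "\<dots> = 8 * pi / sqrt B" by (simp add: real_sqrt_divide)
  finally show ?thesis .
qed

text \<open>The Beta integral at half-integers. The identity sin^2 + cos^2 = 1
  (\<open>split\<close>) and integration by parts (\<open>parts\<close>) together yield one-step
  recursions in each exponent, matching that of \<open>central_ratio\<close>.\<close>

lemma integral_sin_cos_powers: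
  "integral {-pi..pi} (\<lambda>t. sin (t / 2) ^ (2 * a) * cos (t / 2) ^ (2 * b))
    = 2 * pi * (central_ratio a * central_ratio b / real ((a + b) choose a))"
proof -
  define I where "I a b = integral {-pi..pi} (\<lambda>t. sin (t / 2) ^ (2 * a) * cos (t / 2) ^ (2 * b))" for a b :: nat
  have int: "(\<lambda>t. sin (t / 2) ^ k * cos (t / 2) ^ m) integrable_on {-pi..pi}" for k m :: nat
    by (intro integrable_continuous_real continuous_intros) auto
  have split: "I a b = I (Suc a) b + I a (Suc b)" for a b
    unfolding I_def
  proof (subst integral_add[symmetric, OF int int], rule arg_cong[where f = "integral _"], rule ext)
    fix t :: real
    have "S ^ (2 * Suc a) * C ^ (2 * b) + S ^ (2 * a) * C ^ (2 * Suc b)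
        = S ^ (2 * a) * C ^ (2 * b) * (S\<^sup>2 + C\<^sup>2)" for S C :: real
      by (simp add: power2_eq_square algebra_simps)
    from this[of "sin (t/2)" "cos (t/2)"] show "sin (t/2) ^ (2 * a) * cos (t/2) ^ (2 * b) =
      sin (t/2) ^ (2 * Suc a) * cos (t/2) ^ (2 * b) + sin (t/2) ^ (2 * a) * cos (t/2) ^ (2 * Suc b)"
      by simp
  qed
  have parts: "real (2 * a + 1) * I a (Suc b) = real (2 * b + 1) * I (Suc a) b" for a b
  proof -
    \<comment> \<open>The boundary terms vanish because cos (t/2) = 0 at t = pi and t = -
      pi.\<close>
    let ?F = "\<lambda>t. 2 * (sin (t / 2) ^ (2 * a + 1) * cos (t / 2) ^ (2 * b + 1))"
    let ?f = "\<lambda>t. real (2 * a + 1) * (sin (t / 2) ^ (2 * a) * cos (t / 2) ^ (2 * Suc b))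
        - real (2 * b + 1) * (sin (t / 2) ^ (2 * Suc a) * cos (t / 2) ^ (2 * b))"
    have "(?f has_integral (?F pi - ?F (-pi))) {-pi..pi}"
    proof (rule fundamental_theorem_of_calculus)
      fix t
      have "(?F has_real_derivative ?f t) (at t)"
        by (auto intro!: derivative_eq_intros simp del: power_Suc simp: field_simps) (simp add: algebra_simps)
      then show "(?F has_vector_derivative ?f t) (at t within {-pi..pi})"
        by (auto simp: has_real_derivative_iff_has_vector_derivative[symmetric] intro: DERIV_subset)
    qed simp
    then have "integral {-pi..pi} ?f = 0" by (simp add: integral_unique)
    moreover have "integral {-pi..pi} ?f = real (2 * a + 1) * I a (Suc b) - real (2 * b + 1) * I (Suc a) b"
      unfolding I_def
      by (subst integral_diff, (intro integrable_on_mult_right int)+) simp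
    ultimately show ?thesis by simp
  qed
  have stepa: "I (Suc a) b * real (2 * (a + b + 1)) = real (2 * a + 1) * I a b" for a b
    using split[of a b] parts[of a b] by (simp add: algebra_simps)
  have base: "I 0 b = 2 * pi * central_ratio b" for b
  proof (induction b)
    case 0 then show ?case by (simp add: I_def)
  next
    case (Suc b)
    have "real (2 * (b + 1)) * I 0 (Suc b) = real (2 * b + 1) * I 0 b"
      using split[of 0 b] parts[of 0 b] stepa[of 0 b] by (simp add: algebra_simps)
    then have "I 0 (Suc b) = I 0 b * (real (2 * b + 1) / real (2 * b + 2))"
      by (simp add: field_simps)
    then show ?case unfolding central_ratio_Suc Suc by simp
  qed
  have "I a b * real ((a + b) choose a) = 2 * pi * (central_ratio a * central_ratio b)"
  proof (induction a)
    case 0 then show ?case by (simp add: base)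
  next
    case (Suc a)
    have ch: "real (Suc a) * real ((Suc a + b) choose Suc a) = real (a + b + 1) * real ((a + b) choose a)"
      using arg_cong[OF Suc_times_binomial_eq[of "a + b" a], of real]
      by (simp only: of_nat_mult mult.commute add_Suc Suc_eq_plus1 add_ac)
    have "real (2 * (a + b + 1)) * real (Suc a) * (I (Suc a) b * real ((Suc a + b) choose Suc a))
        = (I (Suc a) b * real (2 * (a + b + 1))) * (real (Suc a) * real ((Suc a + b) choose Suc a))"
      by (simp only: mult_ac)
    also have "\<dots> = real (2 * a + 1) * real (a + b + 1) * (I a b * real ((a + b) choose a))"
      unfolding stepa ch by (simp only: mult_ac)
    also have "\<dots> = real (2 * a + 1) * real (a + b + 1) * (2 * pi * (central_ratio a * central_ratio b))"
      unfolding Suc ..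
    also have "\<dots> = real (2 * (a + b + 1)) * real (Suc a) * (2 * pi * (central_ratio (Suc a) * central_ratio b))"
      unfolding central_ratio_Suc by (simp add: divide_simps) (simp add: algebra_simps)
    finally show ?case by (simp only: mult_cancel_left of_nat_eq_0_iff mult_eq_0_iff) auto
  qed
  moreover have "real ((a + b) choose a) > 0" by simp
  ultimately show ?thesis unfolding I_def[symmetric] by (simp add: field_simps)
qed

lemma arcsine_output_eq_integral:
  assumes "y \<le> n"
  shows "integral {-pi..pi} (\<lambda>t. binom_W n ((sin (t / 2))\<^sup>2) y) = 2 * pi * arcsine_output n y"
proof -
  have "binom_W n ((sin (t / 2))\<^sup>2) y
     = real (n choose y) * (sin (t / 2) ^ (2 * y) * cos (t / 2) ^ (2 * (n - y)))" for t
    unfolding binom_W_def cos_squared_eq[symmetric] by (simp add: power_mult)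
  then have "integral {-pi..pi} (\<lambda>t. binom_W n ((sin (t / 2))\<^sup>2) y)
     = real (n choose y) * integral {-pi..pi} (\<lambda>t. sin (t / 2) ^ (2 * y) * cos (t / 2) ^ (2 * (n - y)))"
    by simp
  also have "\<dots> = 2 * pi * arcsine_output n y"
    unfolding integral_sin_cos_powers using assms by (simp add: arcsine_output_def)
  finally show ?thesis .
qed

lemma sum_arcsine_output: "(\<Sum>y\<le>n. arcsine_output n y) = 1"
proof -
  have "2 * pi * (\<Sum>y\<le>n. arcsine_output n y) = (\<Sum>y\<le>n. integral {-pi..pi} (\<lambda>t. binom_W n ((sin (t / 2))\<^sup>2) y))"
    unfolding sum_distrib_left by (intro sum.cong refl) (simp add: arcsine_output_eq_integral)
  also have "\<dots> = integral {-pi..pi} (\<lambda>t. \<Sum>y\<le>n. binom_W n ((sin (t / 2))\<^sup>2) y)"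
    by (subst integral_sum) (auto simp: binom_W_def intro!: integrable_continuous_real continuous_intros)
  also have "\<dots> = 2 * pi" by (simp add: sum_binom_W)
  finally show ?thesis by simp
qed

section \<open>The prior as a measure, and its mutual information\<close>

definition arcsine_prior :: "real measure" where
  "arcsine_prior = distr (uniform_measure lborel {-pi..pi}) borel (\<lambda>t. (sin (t / 2))\<^sup>2)"

lemma prob_space_uniform_pi: "prob_space (uniform_measure lborel {-pi..pi})"
  by (rule prob_space_uniform_measure) auto

lemma prob_space_arcsine: "prob_space arcsine_prior"
  unfolding arcsine_prior_def
  by (rule prob_space.prob_space_distr[OF prob_space_uniform_pi]) auto

lemma sets_arcsine_prior [simp, measurable_cong]: "sets arcsine_prior = sets borel"
  by (simp add: arcsine_prior_def)

lemma sin_half_sq_le_1: "(sin (t / 2))\<^sup>2 \<le> (1::real)"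
  by (simp add: abs_square_le_1)

lemma AE_arcsine: "AE x in arcsine_prior. 0 \<le> x \<and> x \<le> 1"
  unfolding arcsine_prior_def by (subst AE_distr_iff) (auto simp: sin_half_sq_le_1)

lemma arcsine_in_input_dists: "arcsine_prior \<in> input_dists"
proof -
  interpret prob_space arcsine_prior by (rule prob_space_arcsine)
  have "AE x in arcsine_prior. x \<in> {0..1}" using AE_arcsine by eventually_elim auto
  then have "emeasure arcsine_prior {0..1} = 1" by (intro emeasure_eq_1_AE) auto
  then show ?thesis by (auto simp: input_dists_def prob_space_arcsine)
qed

lemma integral_arcsine:
  fixes f :: "real \<Rightarrow> real"
  assumes [measurable]: "f \<in> borel_measurable borel"
    and c: "continuous_on {-pi..pi} (\<lambda>t. f ((sin (t / 2))\<^sup>2))"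
  shows "(\<integral>x. f x \<partial>arcsine_prior) = integral {-pi..pi} (\<lambda>t. f ((sin (t / 2))\<^sup>2)) / (2 * pi)"
proof -
  have "(\<integral>x. f x \<partial>arcsine_prior) = (\<integral>t. f ((sin (t / 2))\<^sup>2) \<partial>uniform_measure lborel {-pi..pi})"
    unfolding arcsine_prior_def by (rule integral_distr) auto
  also have "uniform_measure lborel {-pi..pi} = density lborel (\<lambda>t. ennreal (indicator {-pi..pi} t / (2 * pi)))"
    unfolding uniform_measure_def
    by (intro arg_cong[where f = "density lborel"] ext) (auto simp: indicator_def divide_ennreal ennreal_1[symmetric] simp del: ennreal_1)
  also have "(\<integral>t. f ((sin (t / 2))\<^sup>2) \<partial>\<dots>) = (\<integral>t. (indicator {-pi..pi} t / (2 * pi)) *\<^sub>R f ((sin (t / 2))\<^sup>2) \<partial>lborel)"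
    by (rule integral_density) auto
  also have "\<dots> = (LINT t:{-pi..pi}|lborel. f ((sin (t / 2))\<^sup>2)) / (2 * pi)"
    by (simp add: set_lebesgue_integral_def)
  also have "(LINT t:{-pi..pi}|lborel. f ((sin (t / 2))\<^sup>2)) = integral {-pi..pi} (\<lambda>t. f ((sin (t / 2))\<^sup>2))"
    by (rule set_borel_integral_eq_integral, rule borel_integrable_atLeastAtMost') (rule c)
  finally show ?thesis .
qed

lemma borel_measurable_binom_W [measurable]: "(\<lambda>x. binom_W n x y) \<in> borel_measurable borel"
  unfolding binom_W_def by measurable

lemma out_prob_arcsine: "y \<le> n \<Longrightarrow> out_prob n arcsine_prior y = arcsine_output n y"
proof -
  assume y: "y \<le> n"
  have "continuous_on {-pi..pi} (\<lambda>t. binom_W n ((sin (t / 2))\<^sup>2) y)"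
    unfolding binom_W_def by (intro continuous_intros) auto
  then show ?thesis
    unfolding out_prob_def by (subst integral_arcsine) (auto simp: arcsine_output_eq_integral y)
qed

lemma mutual_info_eq:
  "mutual_info n M = (\<Sum>y\<le>n. \<integral>x. binom_W n x y * ln (binom_W n x y / out_prob n M y) \<partial>M)"
  unfolding mutual_info_def by (intro sum.cong refl Bochner_Integration.integral_cong) auto

lemma abs_xlnx_le:
  fixes w q :: real
  assumes "0 \<le> w" "w \<le> 1" "0 < q"
  shows "\<bar>w * ln (w / q)\<bar> \<le> 1 + \<bar>ln q\<bar>"
proof (cases "w = 0")
  case False
  with assms have w: "w > 0" by simp
  have "w * ln w \<le> 0" using assms w by (intro mult_nonneg_nonpos) auto
  moreover have "- ln w \<le> 1 / w - 1" using ln_le_minus_one[of "1 / w"] w by (simp add: ln_div)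
  then have "w * (- ln w) \<le> w * (1 / w - 1)" using w by (intro mult_left_mono) auto
  then have "- 1 \<le> w * ln w" using w by (simp add: algebra_simps)
  moreover have "\<bar>w * ln q\<bar> \<le> 1 * \<bar>ln q\<bar>" unfolding abs_mult using assms by (intro mult_right_mono) auto
  ultimately show ?thesis using w assms by (simp add: ln_div right_diff_distrib) 
qed simp

text \<open>\<open>kl_arcsine_lower\<close> integrated over the prior. The errors average to (3 * 4
  pi + 3 * 8 pi) / (2 pi) = 18 times n^(-1/2), since the prior puts mass only of that order within 1
  / n of the endpoints.\<close>

lemma mutual_info_arcsine_ge:
  assumes n: "n \<ge> 1"
  shows "mutual_info n arcsine_prior \<ge> capacity_main n - 18 / sqrt (real n)"
proof -
  interpret prob_space arcsine_prior by (rule prob_space_arcsine)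
  \<comment> \<open>The absolute values change nothing on [0, 1] and keep the denominators at least
    1 on the whole line.\<close>
  let ?h = "\<lambda>x. 3 * (1 / (1 + real n * \<bar>x\<bar>)) + 3 * (1 / (1 + real n * \<bar>1 - x\<bar>))"
  have pos: "1 + real n * \<bar>x\<bar> \<noteq> 0" for x :: real
    using mult_nonneg_nonneg[of "real n" "\<bar>x\<bar>"] by linarith
  have f_int: "integrable arcsine_prior (\<lambda>x. binom_W n x y * ln (binom_W n x y / arcsine_output n y))" for y
  proof (rule integrable_const_bound[where B = "1 + \<bar>ln (arcsine_output n y)\<bar>"])
    show "AE x in arcsine_prior. norm (binom_W n x y * ln (binom_W n x y / arcsine_output n y)) \<le> 1 + \<bar>ln (arcsine_output n y)\<bar>"
      using AE_arcsine
    proof eventually_elim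
      case (elim x)
      then show ?case
        unfolding real_norm_def
        by (intro abs_xlnx_le binom_W_nonneg binom_W_le_1 arcsine_output_pos) auto
    qed
  qed measurable
  have h_meas: "?h \<in> borel_measurable borel"
    by measurable
  have h_int: "integrable arcsine_prior ?h"
  proof (rule integrable_const_bound[where B = 6])
    have *: "1 / (1 + real n * \<bar>x\<bar>) \<le> 1 \<and> 0 \<le> 1 / (1 + real n * \<bar>x\<bar>)" for x :: real
    proof -
      have "1 / (1 + real n * \<bar>x\<bar>) \<le> 1 / 1"
        by (rule divide_left_mono) (auto intro: add_pos_nonneg)
      then show ?thesis by simp
    qed
    have "norm (?h x) \<le> 6" for x
      using *[of x] *[of "1 - x"] unfolding real_norm_def abs_le_iff by argo
    then show "AE x in arcsine_prior. norm (?h x) \<le> 6" by simp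
  qed (use h_meas in measurable)
  have "(\<integral>x. ?h x \<partial>arcsine_prior) = integral {-pi..pi} (\<lambda>t. ?h ((sin (t / 2))\<^sup>2)) / (2 * pi)"
    by (rule integral_arcsine[OF h_meas]) (intro continuous_intros ballI pos, auto)
  also have "integral {-pi..pi} (\<lambda>t. ?h ((sin (t / 2))\<^sup>2))
     = integral {-pi..pi} (\<lambda>t. 3 * (1 / (1 + real n * (sin (t / 2))\<^sup>2)) + 3 * (1 / (1 + real n * (cos (t / 2))\<^sup>2)))"
    by (intro arg_cong[where f = "integral _"] ext) (simp add: cos_squared_eq sin_half_sq_le_1)
  also have "\<dots> = 3 * integral {-pi..pi} (\<lambda>t. 1 / (1 + real n * (sin (t / 2))\<^sup>2))
      + 3 * integral {-pi..pi} (\<lambda>t. 1 / (1 + real n * (cos (t / 2))\<^sup>2))"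
  proof -
    have i: "(\<lambda>t. 3 * (1 / (1 + real n * (f (t / 2))\<^sup>2))) integrable_on {-pi..pi}"
      if "continuous_on UNIV f" for f :: "real \<Rightarrow> real"
      by (intro integrable_continuous_real continuous_intros continuous_on_compose2[OF that])
        (auto simp: lorentz_neq_0)
    have "continuous_on UNIV (sin :: real \<Rightarrow> real)" "continuous_on UNIV (cos :: real \<Rightarrow> real)"
      by (auto intro: continuous_intros)
    then show ?thesis
      by (subst integral_add[OF i i]) (simp_all only: integral_mult_right)
  qed
  also have "\<dots> \<le> 3 * (4 * pi / sqrt (real n)) + 3 * (8 * pi / sqrt (real n))"
    using n by (intro add_mono mult_left_mono integral_inverse_sin_le integral_inverse_cos_le) auto
  also have "(3 * (4 * pi / sqrt (real n)) + 3 * (8 * pi / sqrt (real n))) / (2 * pi) = 18 / sqrt (real n)"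
    by simp
  finally have hb: "(\<integral>x. ?h x \<partial>arcsine_prior) \<le> 18 / sqrt (real n)"
    by (simp add: divide_right_mono)
  have "capacity_main n - 18 / sqrt (real n) \<le> (\<integral>x. capacity_main n - ?h x \<partial>arcsine_prior)"
    using hb h_int by (subst Bochner_Integration.integral_diff) (auto simp: prob_space)
  also have "\<dots> \<le> (\<integral>x. (\<Sum>y\<le>n. binom_W n x y * ln (binom_W n x y / arcsine_output n y)) \<partial>arcsine_prior)"
  proof (rule integral_mono_AE)
    show "AE x in arcsine_prior. capacity_main n - ?h x
        \<le> (\<Sum>y\<le>n. binom_W n x y * ln (binom_W n x y / arcsine_output n y))"
      using AE_arcsine
    proof eventually_elim
      case (elim x)
      then show ?case using kl_arcsine_lower[of x n] n by (simp add: binom_E_def)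
    qed
  qed (use h_int f_int in auto)
  also have "\<dots> = (\<Sum>y\<le>n. \<integral>x. binom_W n x y * ln (binom_W n x y / arcsine_output n y) \<partial>arcsine_prior)"
    by (rule Bochner_Integration.integral_sum) (rule f_int)
  also have "\<dots> = mutual_info n arcsine_prior"
    unfolding mutual_info_eq by (intro sum.cong refl) (simp add: out_prob_arcsine)
  finally show ?thesis .
qed

section \<open>Finitely supported inputs\<close>

lemma input_distsD:
  assumes "M \<in> input_dists"
  shows "sets M = sets borel" "prob_space M" "emeasure M {0..1} = 1"
  using assms by (auto simp: input_dists_def)

lemma AE_input_dist:
  assumes "M \<in> input_dists" shows "AE x in M. 0 \<le> x \<and> x \<le> 1"
proof -
  interpret prob_space M by (rule input_distsD[OF assms])
  have "AE x in M. x \<in> {0..1}"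
    by (rule AE_prob_1) (simp add: measure_def input_distsD[OF assms])
  then show ?thesis by eventually_elim auto
qed

text \<open>By second countability the complement of the support is covered by the countably many
  basic open sets of measure zero.\<close>

lemma AE_msupp:
  assumes "sets M = sets borel" shows "AE x in M. x \<in> msupp M"
proof -
  obtain B :: "real set set" where B: "countable B" "topological_basis B"
    using ex_countable_basis by blast
  let ?N = "\<Union>U\<in>{U \<in> B. emeasure M U = 0}. U"
  have "?N \<in> null_sets M"
  proof (rule null_sets_UN')
    show "countable {U \<in> B. emeasure M U = 0}" using B(1) by auto
    show "U \<in> null_sets M" if "U \<in> {U \<in> B. emeasure M U = 0}" for U
    proof -
      have "open U" using that B(2) topological_basis_open by blast
      then show ?thesis using that assms by (auto simp: null_sets_def)
    qed
  qed
  moreover have "{x \<in> space M. x \<notin> msupp M} \<subseteq> ?N"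
  proof
    fix x assume "x \<in> {x \<in> space M. x \<notin> msupp M}"
    then obtain U where U: "open U" "x \<in> U" "emeasure M U = 0"
      by (auto simp: msupp_def)
    then obtain V where V: "V \<in> B" "x \<in> V" "V \<subseteq> U"
      using topological_basisE[OF B(2)] by metis
    have "emeasure M V \<le> emeasure M U"
      using V U assms by (intro emeasure_mono) auto
    then show "x \<in> ?N" using V U by auto
  qed
  ultimately show ?thesis by (rule AE_I')
qed

lemma msupp_subset:
  assumes "M \<in> input_dists" shows "msupp M \<subseteq> {0..1}"
proof
  interpret prob_space M by (rule input_distsD[OF assms])
  fix x assume x: "x \<in> msupp M"
  show "x \<in> {0..1}"
  proof (rule ccontr)
    assume "x \<notin> {0..1}"
    then have "emeasure M (- {0..1}) > 0" using x by (auto simp: msupp_def open_Compl)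
    moreover have "emeasure M (- {0..1}) = 0"
    proof -
      have "AE x in M. x \<notin> - {0..1}" using AE_input_dist[OF assms] by eventually_elim auto
      then have "- {0..1} \<in> null_sets M"
        using input_distsD(1)[OF assms] by (subst AE_iff_null_sets) auto
      then show ?thesis by auto
    qed
    ultimately show False by simp
  qed
qed

lemma integral_finite_support:
  fixes f :: "real \<Rightarrow> real"
  assumes M: "sets M = sets borel" "prob_space M" and S: "finite S" "AE x in M. x \<in> S"
    and f: "f \<in> borel_measurable borel"
  shows "(\<integral>x. f x \<partial>M) = (\<Sum>x\<in>S. measure M {x} * f x)"
proof -
  interpret prob_space M by (rule M)
  have "(\<integral>x. f x \<partial>M) = (\<integral>x. (\<Sum>s\<in>S. f s * indicator {s} x) \<partial>M)"
  proof (rule integral_cong_AE)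
    show "AE x in M. f x = (\<Sum>s\<in>S. f s * indicator {s} x)"
      using S(2)
    proof eventually_elim
      case (elim x)
      then show ?case using S(1) by (subst sum.remove[of _ x]) (auto intro!: sum.neutral simp: indicator_def)
    qed
  qed (use M f in \<open>auto simp: measurable_cong_sets[OF M(1) refl]\<close>)
  also have "\<dots> = (\<Sum>s\<in>S. \<integral>x. f s * indicator {s} x \<partial>M)"
    using M(1) by (intro Bochner_Integration.integral_sum) (auto intro!: integrable_mult_right integrable_real_indicator simp: emeasure_eq_measure)
  also have "\<dots> = (\<Sum>x\<in>S. measure M {x} * f x)"
    using M(1) sets_eq_imp_space_eq[OF M(1)] by (intro sum.cong refl) simp
  finally show ?thesis .
qed

lemma sum_atoms:
  fixes M :: "real measure"
  assumes "sets M = sets borel" "prob_space M" "finite S" "AE x in M. x \<in> S"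
  shows "(\<Sum>x\<in>S. measure M {x}) = 1"
  using integral_finite_support[OF assms, of "\<lambda>_. 1"] prob_space.prob_space[OF assms(2)] by simp

lemma out_prob_atoms:
  assumes "sets M = sets borel" "prob_space M" "finite S" "AE x in M. x \<in> S"
  shows "out_prob n M y = (\<Sum>x\<in>S. measure M {x} * binom_W n x y)"
  unfolding out_prob_def by (rule integral_finite_support[OF assms]) measurable

lemma mutual_info_atoms:
  assumes "sets M = sets borel" "prob_space M" "finite S" "AE x in M. x \<in> S"
  shows "mutual_info n M
    = (\<Sum>x\<in>S. measure M {x} * binom_E n x (\<lambda>y. ln (binom_W n x y / out_prob n M y)))"
proof -
  have "mutual_info n M = (\<Sum>y\<le>n. \<Sum>x\<in>S. measure M {x} * (binom_W n x y * ln (binom_W n x y / out_prob n M y)))"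
    unfolding mutual_info_eq
    by (intro sum.cong refl integral_finite_support[OF assms]) measurable
  also have "\<dots> = (\<Sum>x\<in>S. \<Sum>y\<le>n. measure M {x} * (binom_W n x y * ln (binom_W n x y / out_prob n M y)))"
    by (rule sum.swap)
  finally show ?thesis by (simp add: binom_E_def sum_distrib_left)
qed

text \<open>A crude bound that makes the supremum in \<open>capacity\<close> bounded above, so that
  \<open>cSUP_upper\<close> applies.\<close>

lemma mutual_info_le:
  assumes M: "M \<in> input_dists"
  shows "mutual_info n M \<le> real (n + 1)"
proof -
  interpret prob_space M by (rule input_distsD[OF M])
  have sb [measurable_cong]: "sets M = sets borel" by (rule input_distsD[OF M])
  have "(\<integral>x. binom_W n x y * ln (binom_W n x y / out_prob n M y) \<partial>M) \<le> 1" for y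
  proof -
    define Q where "Q = out_prob n M y"
    have int: "integrable M (\<lambda>x. binom_W n x y)"
    proof (rule integrable_const_bound[where B = 1])
      show "AE x in M. norm (binom_W n x y) \<le> 1"
        using AE_input_dist[OF M] by eventually_elim (auto simp: binom_W_nonneg binom_W_le_1)
    qed measurable
    have Q0: "Q \<ge> 0" unfolding Q_def out_prob_def
      using AE_input_dist[OF M] by (intro integral_nonneg_AE) (auto simp: binom_W_nonneg elim: eventually_mono)
    show ?thesis
    proof (cases "Q = 0")
      \<comment> \<open>With Q = 0 the conventions x / 0 = 0 and ln 0 = 0 make the integrand
        vanish.\<close>
      case True
      then show ?thesis by (simp add: Q_def[symmetric])
    next
      case False
      with Q0 have Q: "Q > 0" by simp
      have "(\<integral>x. binom_W n x y * ln (binom_W n x y / Q) \<partial>M) \<le> (\<integral>x. binom_W n x y / Q \<partial>M)"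
      proof (cases "integrable M (\<lambda>x. binom_W n x y * ln (binom_W n x y / Q))")
        case True
        show ?thesis
        proof (rule integral_mono_AE[OF True])
          show "AE x in M. binom_W n x y * ln (binom_W n x y / Q) \<le> binom_W n x y / Q"
            using AE_input_dist[OF M]
          proof eventually_elim
            case (elim x)
            define w where "w = binom_W n x y"
            have w: "0 \<le> w" "w \<le> 1" using elim by (auto simp: w_def binom_W_nonneg binom_W_le_1)
            have "w * ln (w / Q) \<le> w / Q"
            proof (cases "w = 0")
              case False
              then have "ln (w / Q) \<le> w / Q" using w Q by (intro order_trans[OF ln_le_minus_one]) auto
              then have "w * ln (w / Q) \<le> w * (w / Q)" using w by (intro mult_left_mono) auto
              also have "\<dots> \<le> 1 * (w / Q)" using w Q by (intro mult_right_mono) auto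
              finally show ?thesis by simp
            qed simp
            then show ?case by (simp add: w_def)
          qed
        qed (use int in auto)
      next
        \<comment> \<open>A non-integrable function has Bochner integral 0 by convention, so
          nonnegativity of the right side is enough.\<close>
        case False
        have "0 \<le> (\<integral>x. binom_W n x y / Q \<partial>M)"
          using Q0 by (simp add: Q_def out_prob_def)
        then show ?thesis using False by (simp add: not_integrable_integral_eq)
      qed
      also have "\<dots> = 1" using Q by (simp add: Q_def out_prob_def)
      finally show ?thesis by (simp add: Q_def)
    qed
  qed
  then have "mutual_info n M \<le> (\<Sum>y\<le>n. 1)" unfolding mutual_info_eq by (intro sum_mono) auto
  then show ?thesis by simp
qed

lemma mutual_info_le_capacity: "M \<in> input_dists \<Longrightarrow> mutual_info n M \<le> capacity n"
  unfolding capacity_def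
  by (rule cSUP_upper) (auto intro!: bdd_aboveI2 mutual_info_le)

lemma capacity_ge_ln2:
  assumes "n \<ge> 1" shows "ln 2 \<le> capacity n"
proof -
  let ?p = "pmf_of_set {0, 1::real}"
  define M where "M = distr (measure_pmf ?p) borel (\<lambda>x. x)"
  have M: "sets M = sets borel" "prob_space M"
    by (auto simp: M_def intro!: prob_space.prob_space_distr prob_space_measure_pmf)
  have AE: "AE x in M. x \<in> {0, 1}"
    unfolding M_def by (subst AE_distr_iff) (auto simp: AE_measure_pmf_iff)
  have m: "measure M {x} = 1 / 2" if "x \<in> {0, 1}" for x
    using that unfolding M_def by (subst measure_distr) (auto simp: measure_pmf_single)
  have in_d: "M \<in> input_dists"
  proof -
    interpret prob_space M by (rule M)
    have "AE x in M. x \<in> {0..1}" using AE by eventually_elim auto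
    then have "emeasure M {0..1} = 1" using M(1) by (intro emeasure_eq_1_AE) auto
    then show ?thesis using M by (simp add: input_dists_def)
  qed
  have o: "out_prob n M y = (binom_W n 0 y + binom_W n 1 y) / 2" for y
  proof -
    have "out_prob n M y = (\<Sum>x\<in>{0, 1}. 1 / 2 * binom_W n x y)"
      by (subst out_prob_atoms[OF M _ AE], simp, intro sum.cong refl, subst m) auto
    then show ?thesis by simp
  qed
  have W0: "binom_W n 0 y = (if y = 0 then 1 else 0)" for y
    by (auto simp: binom_W_def power_0_left)
  have W1: "binom_W n 1 y = (if y = n then 1 else 0)" if "y \<le> n" for y
    using that by (auto simp: binom_W_def power_0_left)
  have e0: "binom_E n 0 (\<lambda>y. ln (binom_W n 0 y / out_prob n M y)) = ln 2"
    unfolding binom_E_def using assms by (subst sum.remove[of _ 0]) (auto simp: W0 o W1 intro!: sum.neutral)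
  have e1: "binom_E n 1 (\<lambda>y. ln (binom_W n 1 y / out_prob n M y)) = ln 2"
    unfolding binom_E_def using assms by (subst sum.remove[of _ n]) (auto simp: W0 o W1 intro!: sum.neutral)
  have "mutual_info n M = ln 2"
    by (subst mutual_info_atoms[OF M _ AE]) (auto simp: m e0 e1)
  then show ?thesis using mutual_info_le_capacity[OF in_d, of n] by simp
qed

text \<open>The output law dominates p_x W_x pointwise, so the divergence at x is at most - ln p_x;
  the resulting entropy is bounded by ln K termwise, using ln t <= t - 1 at t = 1 / (p_x K).\<close>

lemma mutual_info_le_ln_card:
  assumes M: "sets M = sets borel" "prob_space M" "finite S" "AE x in M. x \<in> S" and S: "S \<subseteq> {0..1}"
  shows "mutual_info n M \<le> ln (real (card S))"
proof -
  define p where "p x = measure M {x}" for x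
  define Q where "Q = out_prob n M"
  define K where "K = real (card S)"
  have p0: "p x \<ge> 0" for x by (simp add: p_def)
  have p1: "(\<Sum>x\<in>S. p x) = 1" unfolding p_def by (rule sum_atoms[OF M])
  have K: "K > 0" using p1 M(3) by (cases "S = {}") (auto simp: K_def card_gt_0_iff)
  have Q: "Q y = (\<Sum>x\<in>S. p x * binom_W n x y)" for y
    unfolding Q_def p_def by (rule out_prob_atoms[OF M])
  have "p x * binom_E n x (\<lambda>y. ln (binom_W n x y / Q y)) \<le> p x * ln K + (1 / K - p x)" if x: "x \<in> S" for x
  proof (cases "p x = 0")
    case True then show ?thesis using K by simp
  next
    case False
    then have px: "p x > 0" using p0[of x] by simp
    have x01: "0 \<le> x" "x \<le> 1" using x S by auto
    have "binom_E n x (\<lambda>y. ln (binom_W n x y / Q y)) \<le> binom_E n x (\<lambda>y. - ln (p x))"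
      unfolding binom_E_def
    proof (rule sum_mono)
      fix y
      show "binom_W n x y * ln (binom_W n x y / Q y) \<le> binom_W n x y * - ln (p x)"
      proof (cases "binom_W n x y = 0")
        case False
        then have w: "binom_W n x y > 0" using binom_W_nonneg[OF x01, of n y] by simp
        have "p x * binom_W n x y \<le> Q y"
          unfolding Q using x S M(3) p0 by (intro member_le_sum) (auto simp: binom_W_nonneg subset_iff)
        moreover have "p x * binom_W n x y > 0" using px w by simp
        ultimately have "Q y > 0" "ln (p x * binom_W n x y) \<le> ln (Q y)" by auto
        then have "ln (binom_W n x y) + ln (p x) \<le> ln (Q y)" "Q y > 0"
          using px w by (auto simp: ln_mult)
        then have "ln (binom_W n x y / Q y) \<le> - ln (p x)" using w by (simp add: ln_div)
        then show ?thesis using w by (intro mult_left_mono) auto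
      qed simp
    qed
    also have "\<dots> = - ln (p x)" by (rule binom_E_const)
    also have "\<dots> \<le> ln K + (1 / (p x * K) - 1)"
    proof -
      have "ln (1 / (p x * K)) \<le> 1 / (p x * K) - 1" using px K by (intro ln_le_minus_one) auto
      then show ?thesis using px K by (simp add: ln_div ln_mult)
    qed
    finally have "p x * binom_E n x (\<lambda>y. ln (binom_W n x y / Q y)) \<le> p x * (ln K + (1 / (p x * K) - 1))"
      using px by (intro mult_left_mono) auto
    also have "\<dots> = p x * ln K + (1 / K - p x)" using px K by (simp add: algebra_simps)
    finally show ?thesis .
  qed
  then have "mutual_info n M \<le> (\<Sum>x\<in>S. p x * ln K + (1 / K - p x))"
    unfolding mutual_info_atoms[OF M] p_def[symmetric] Q_def[symmetric] by (intro sum_mono) auto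
  also have "\<dots> = ln K + (real (card S) / K - 1)"
    using p1 by (simp add: sum.distrib sum_subtractf sum_distrib_right[symmetric])
  also have "\<dots> = ln K" using K by (simp add: K_def)
  finally show ?thesis by (simp add: K_def)
qed

text \<open>The compensation identity: the average divergence from q is the mutual information plus
  the divergence of the output law from q. It converts near-optimality of q into closeness of the
  optimal output to q.\<close>

lemma kl_compensation:
  assumes M: "sets M = sets borel" "prob_space M" "finite S" "AE x in M. x \<in> S" and S: "S \<subseteq> {0..1}"
    and q: "\<And>y. y \<le> n \<Longrightarrow> 0 < q y"
  shows "(\<Sum>y\<le>n. out_prob n M y * ln (out_prob n M y / q y))
    = (\<Sum>x\<in>S. measure M {x} * binom_E n x (\<lambda>y. ln (binom_W n x y / q y))) - mutual_info n M"
proof -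
  define p where "p x = measure M {x}" for x
  define Q where "Q = out_prob n M"
  have p0: "p x \<ge> 0" for x by (simp add: p_def)
  have Q: "Q y = (\<Sum>x\<in>S. p x * binom_W n x y)" for y
    unfolding Q_def p_def by (rule out_prob_atoms[OF M])
  have trm: "p x * (binom_W n x y * ln (binom_W n x y / q y)) - p x * (binom_W n x y * ln (binom_W n x y / Q y))
      = p x * binom_W n x y * ln (Q y / q y)" if x: "x \<in> S" and y: "y \<le> n" for x y
  proof (cases "p x * binom_W n x y = 0")
    case False
    have w0: "binom_W n x' y \<ge> 0" if "x' \<in> S" for x' using that S by (auto intro!: binom_W_nonneg)
    have w: "binom_W n x y > 0" "p x > 0" using False w0[OF x] p0[of x] by (auto simp: less_le)
    have "p x * binom_W n x y \<le> Q y"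
      unfolding Q using x w0 M(3) p0 by (intro member_le_sum) auto
    then have "Q y > 0" using w by (auto intro: less_le_trans[rotated])
    then show ?thesis using w q[OF y] by (simp add: ln_div algebra_simps)
  qed auto
  have "(\<Sum>x\<in>S. p x * binom_E n x (\<lambda>y. ln (binom_W n x y / q y))) - mutual_info n M
     = (\<Sum>x\<in>S. \<Sum>y\<le>n. p x * binom_W n x y * ln (Q y / q y))"
    unfolding mutual_info_atoms[OF M] p_def[symmetric] Q_def[symmetric] sum_subtractf[symmetric]
      binom_E_def sum_distrib_left
    by (intro sum.cong refl trm) auto
  also have "\<dots> = (\<Sum>y\<le>n. Q y * ln (Q y / q y))"
    by (subst sum.swap) (simp add: Q sum_distrib_right)
  finally show ?thesis by (simp add: Q_def p_def)
qed

text \<open>Through the Hellinger distance: ln t <= t - 1 at t = sqrt (q / Q) bounds it by the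
  divergence, and Cauchy-Schwarz applied to |Q - q| = |sqrt Q - sqrt q| (sqrt Q + sqrt q) gives
  total variation. This allows q of mass below 1, as happens for
  \<open>reference_output\<close>.\<close>

lemma total_variation_le_kl:
  fixes Q q :: "'a \<Rightarrow> real"
  assumes A: "finite A" and Q: "\<And>y. y \<in> A \<Longrightarrow> 0 \<le> Q y" and q: "\<And>y. y \<in> A \<Longrightarrow> 0 < q y"
    and sums: "(\<Sum>y\<in>A. Q y) = 1" "(\<Sum>y\<in>A. q y) \<le> 1"
    and D: "(\<Sum>y\<in>A. Q y * ln (Q y / q y)) \<le> D"
  shows "(\<Sum>y\<in>A. \<bar>Q y - q y\<bar>) \<le> 2 * sqrt D"
proof -
  let ?a = "\<lambda>y. \<bar>sqrt (Q y) - sqrt (q y)\<bar>" and ?b = "\<lambda>y. sqrt (Q y) + sqrt (q y)"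
  have trm: "2 * Q y - 2 * sqrt (Q y * q y) \<le> Q y * ln (Q y / q y)" if y: "y \<in> A" for y
  proof (cases "Q y = 0")
    case False
    then have pos: "Q y > 0" "q y > 0" using Q[OF y] q[OF y] by auto
    have "ln (sqrt (q y / Q y)) \<le> sqrt (q y / Q y) - 1" using pos by (intro ln_le_minus_one) auto
    then have "- ln (Q y / q y) \<le> 2 * (sqrt (q y / Q y) - 1)" using pos by (simp add: ln_sqrt ln_div)
    then have "Q y * (- ln (Q y / q y)) \<le> Q y * (2 * (sqrt (q y / Q y) - 1))"
      using pos by (intro mult_left_mono) auto
    moreover have "Q y * sqrt (q y / Q y) = sqrt (Q y * q y)"
      using pos by (simp add: real_sqrt_divide real_sqrt_mult field_simps)
    ultimately show ?thesis by (simp add: algebra_simps)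
  qed simp
  have sq: "(\<Sum>y\<in>A. (?a y)\<^sup>2) \<le> D"
  proof -
    have "(\<Sum>y\<in>A. (?a y)\<^sup>2) = (\<Sum>y\<in>A. Q y + q y - 2 * sqrt (Q y * q y))"
      using Q q by (intro sum.cong refl) (auto simp: power2_diff real_sqrt_mult less_imp_le)
    also have "\<dots> = 1 + (\<Sum>y\<in>A. q y) - 2 * (\<Sum>y\<in>A. sqrt (Q y * q y))"
      by (simp add: sum.distrib sum_subtractf sums sum_distrib_left)
    also have "\<dots> \<le> 2 * (\<Sum>y\<in>A. Q y) - 2 * (\<Sum>y\<in>A. sqrt (Q y * q y))" using sums by simp
    also have "\<dots> = (\<Sum>y\<in>A. 2 * Q y - 2 * sqrt (Q y * q y))"
      by (simp add: sum_subtractf sum_distrib_left)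
    also have "\<dots> \<le> (\<Sum>y\<in>A. Q y * ln (Q y / q y))" by (rule sum_mono) (rule trm)
    finally show ?thesis using D by simp
  qed
  have sqb: "(\<Sum>y\<in>A. (?b y)\<^sup>2) \<le> 4"
  proof -
    have "(\<Sum>y\<in>A. (?b y)\<^sup>2) \<le> (\<Sum>y\<in>A. 2 * Q y + 2 * q y)"
    proof (rule sum_mono)
      fix y assume y: "y \<in> A"
      have "(?b y)\<^sup>2 + (sqrt (Q y) - sqrt (q y))\<^sup>2 = 2 * (sqrt (Q y))\<^sup>2 + 2 * (sqrt (q y))\<^sup>2"
        by (simp add: power2_eq_square algebra_simps)
      also have "\<dots> = 2 * Q y + 2 * q y" using Q[OF y] q[OF y] by simp
      finally show "(?b y)\<^sup>2 \<le> 2 * Q y + 2 * q y" by (smt (verit) zero_le_power2)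
    qed
    also have "\<dots> \<le> 4" using sums by (simp add: sum.distrib flip: sum_distrib_left)
    finally show ?thesis .
  qed
  have eq: "(\<Sum>y\<in>A. \<bar>Q y - q y\<bar>) = (\<Sum>y\<in>A. ?a y * ?b y)"
  proof (rule sum.cong[OF refl])
    fix y assume y: "y \<in> A"
    have "Q y - q y = (sqrt (Q y) - sqrt (q y)) * (sqrt (Q y) + sqrt (q y))"
      using Q[OF y] q[OF y] by (simp add: algebra_simps)
    then show "\<bar>Q y - q y\<bar> = ?a y * ?b y"
      using Q[OF y] q[OF y] by (simp add: abs_mult)
  qed
  have "(\<Sum>y\<in>A. ?a y * ?b y)\<^sup>2 \<le> (\<Sum>y\<in>A. (?a y)\<^sup>2) * (\<Sum>y\<in>A. (?b y)\<^sup>2)"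
    by (rule Cauchy_Schwarz_ineq_sum)
  also have "\<dots> \<le> D * 4"
    using sq sqb by (intro mult_mono) (auto intro: sum_nonneg order_trans[OF sum_nonneg sq])
  finally have "(\<Sum>y\<in>A. ?a y * ?b y) \<le> sqrt (D * 4)" by (rule real_le_rsqrt)
  then show ?thesis unfolding eq by (simp add: real_sqrt_mult mult.commute)
qed

section \<open>Fejer forms\<close>

text \<open>Homogeneous polynomials of degree N in (c, s). At (cos (t/2), sin (t/2)) with N = 2n,
  the monomials with even powers of s are multiples of the Bernstein basis at x = sin^2 (t/2).
  Complex arguments are allowed because the coefficients are later extracted on circles |s| = r with
  c = 1.\<close>

definition hform :: "nat \<Rightarrow> (complex \<Rightarrow> complex \<Rightarrow> complex) \<Rightarrow> bool" where
  "hform N F \<longleftrightarrow> (\<exists>g. \<forall>c s. F c s = (\<Sum>m\<le>N. g m * s ^ m * c ^ (N - m)))"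

lemma hform_const: "hform 0 (\<lambda>c s. k)"
  by (auto simp: hform_def intro!: exI[of _ "\<lambda>_. k"])

lemma hform_linear:
  assumes "hform N F" shows "hform (Suc N) (\<lambda>c s. (\<alpha> * c + \<beta> * s) * F c s)"
proof -
  obtain g where g: "\<And>c s. F c s = (\<Sum>m\<le>N. g m * s ^ m * c ^ (N - m))"
    using assms by (auto simp: hform_def)
  define h where "h m = \<alpha> * (if m \<le> N then g m else 0) + \<beta> * (if m = 0 then 0 else g (m - 1))" for m
  have "(\<alpha> * c + \<beta> * s) * F c s = (\<Sum>m\<le>Suc N. h m * s ^ m * c ^ (Suc N - m))" for c s
  proof -
    have "(\<Sum>m\<le>Suc N. h m * s ^ m * c ^ (Suc N - m))
      = (\<Sum>m\<le>Suc N. \<alpha> * (if m \<le> N then g m else 0) * s ^ m * c ^ (Suc N - m))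
      + (\<Sum>m\<le>Suc N. \<beta> * (if m = 0 then 0 else g (m - 1)) * s ^ m * c ^ (Suc N - m))"
      by (simp only: h_def distrib_right sum.distrib)
    also have "(\<Sum>m\<le>Suc N. \<alpha> * (if m \<le> N then g m else 0) * s ^ m * c ^ (Suc N - m)) = \<alpha> * c * F c s"
      unfolding g sum_distrib_left by (simp add: Suc_diff_le mult_ac)
    also have "(\<Sum>m\<le>Suc N. \<beta> * (if m = 0 then 0 else g (m - 1)) * s ^ m * c ^ (Suc N - m)) = \<beta> * s * F c s"
      unfolding g sum_distrib_left by (subst sum.atMost_Suc_shift) (simp add: mult_ac)
    finally show ?thesis by (simp add: distrib_right)
  qed
  then show ?thesis unfolding hform_def by (intro exI[of _ h]) auto
qed

lemma hform_cmult: "hform N F \<Longrightarrow> hform N (\<lambda>c s. k * F c s)"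
  unfolding hform_def
proof (elim exE)
  fix g assume "\<forall>c s. F c s = (\<Sum>m\<le>N. g m * s ^ m * c ^ (N - m))"
  then show "\<exists>g. \<forall>c s. k * F c s = (\<Sum>m\<le>N. g m * s ^ m * c ^ (N - m))"
    by (intro exI[of _ "\<lambda>m. k * g m"]) (simp add: sum_distrib_left mult_ac)
qed

lemma hform_diff:
  assumes "hform N F" "hform N G" shows "hform N (\<lambda>c s. F c s - G c s)"
proof -
  obtain g h where "\<And>c s. F c s = (\<Sum>m\<le>N. g m * s ^ m * c ^ (N - m))"
    "\<And>c s. G c s = (\<Sum>m\<le>N. h m * s ^ m * c ^ (N - m))"
    using assms by (auto simp: hform_def)
  then show ?thesis unfolding hform_def
    by (intro exI[of _ "\<lambda>m. g m - h m"]) (simp add: sum_subtractf left_diff_distrib)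
qed

lemma hform_sum:
  assumes "finite A" "\<And>i. i \<in> A \<Longrightarrow> hform N (F i)" shows "hform N (\<lambda>c s. \<Sum>i\<in>A. F i c s)"
proof -
  have "\<forall>i\<in>A. \<exists>g. \<forall>c s. F i c s = (\<Sum>m\<le>N. g m * s ^ m * c ^ (N - m))"
    using assms(2) by (auto simp: hform_def)
  then obtain g where g: "\<And>i c s. i \<in> A \<Longrightarrow> F i c s = (\<Sum>m\<le>N. g i m * s ^ m * c ^ (N - m))"
    by metis
  have "(\<Sum>i\<in>A. F i c s) = (\<Sum>m\<le>N. (\<Sum>i\<in>A. g i m) * s ^ m * c ^ (N - m))" for c s
    by (simp add: g sum_distrib_right) (rule sum.swap)
  then show ?thesis unfolding hform_def by (intro exI[of _ "\<lambda>m. \<Sum>i\<in>A. g i m"]) auto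
qed

lemma hform_conjugate_powers: "hform (p + q) (\<lambda>c s. (c + \<i> * s) ^ p * (c - \<i> * s) ^ q)"
proof (induction p)
  case 0
  show ?case
  proof (induction q)
    case 0 then show ?case using hform_const[of 1] by simp
  next
    case (Suc q)
    show ?case using hform_linear[OF Suc, of 1 "- \<i>"] by simp
  qed
next
  case (Suc p)
  show ?case using hform_linear[OF Suc, of 1 "\<i>"] by (simp add: mult.assoc)
qed

text \<open>With 4 d points every angle is within pi / (4 d) of the grid, close enough for
  \<open>fejer_kernel_ge\<close>, and frequencies below d are not aliased, as
  \<open>sum_cis_grid\<close> needs.\<close>

definition grid :: "nat \<Rightarrow> nat \<Rightarrow> real" where
  "grid d j = 2 * pi * real j / real (4 * d)"

text \<open>At \<open>c = cos (\<theta> / 2)\<close>, \<open>s = sin (\<theta> / 2)\<close> this is \<open>1\<close> minus twice the sum of the normalized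
  Fejer kernels of degree \<open>d\<close> centred at the grid points with index in \<open>S\<close>.\<close>

definition fejer_form :: "nat \<Rightarrow> nat \<Rightarrow> nat set \<Rightarrow> complex \<Rightarrow> complex \<Rightarrow> complex" where
  "fejer_form n d S c s = (c + \<i> * s) ^ n * (c - \<i> * s) ^ n
    - (2 / (of_nat d)\<^sup>2) * (\<Sum>j\<in>S. \<Sum>a<d. \<Sum>b<d. cis ((real b - real a) * grid d j)
        * ((c + \<i> * s) ^ (n + a - b) * (c - \<i> * s) ^ (n + b - a)))"

text \<open>The exponents n + a - b and n + b - a always sum to 2n; d <= n keeps the natural
  subtractions exact.\<close>

lemma hform_fejer_form:
  assumes "d \<le> n" "finite S" shows "hform (2 * n) (fejer_form n d S)"
proof -
  have "hform (2 * n) (\<lambda>c s. (c + \<i> * s) ^ (n + a - b) * (c - \<i> * s) ^ (n + b - a))"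
    if "a \<le> d" "b \<le> d" for a b
    using hform_conjugate_powers[of "n + a - b" "n + b - a"] that assms by (simp add: mult_2)
  moreover have "hform (2 * n) (\<lambda>c s. (c + \<i> * s) ^ n * (c - \<i> * s) ^ n)"
    using hform_conjugate_powers[of n n] by (simp add: mult_2)
  ultimately show ?thesis
    unfolding fejer_form_def using assms
    by (intro hform_diff hform_cmult hform_sum) auto
qed

lemma sum_cis_grid:
  assumes "d \<ge> 1" "a < d" "b < d"
  shows "(\<Sum>j<4*d. cis ((real a - real b) * grid d j)) = (if a = b then of_nat (4 * d) else 0)"
proof (cases "a = b")
  case False
  define x where "x = (real a - real b) * (2 * pi / real (4 * d))"
  have p: "cis ((real a - real b) * grid d j) = cis x ^ j" for j
    unfolding Complex.DeMoivre x_def grid_def by (simp add: mult_ac)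
  have "cis x ^ (4 * d) = cis (2 * pi * of_int (int a - int b))"
  proof -
    have "real (4 * d) * x = 2 * pi * of_int (int a - int b)" using assms by (simp add: x_def field_simps)
    then show ?thesis unfolding Complex.DeMoivre by (simp only:)
  qed
  then have one: "cis x ^ (4 * d) = 1" by (simp only: cis_multiple_2pi Ints_of_int)
  have "cis x \<noteq> 1"
  proof
    assume "cis x = 1"
    then have "cos x = 1" by (metis cis.sel(1) one_complex.sel(1))
    then obtain k :: int where k: "x = of_int k * 2 * pi" using cos_one_2pi_int by blast
    have "(real a - real b) = of_int k * real (4 * d)"
    proof -
      have "(real a - real b) * (2 * pi) = (of_int k * real (4 * d)) * (2 * pi)"
        using k assms by (simp add: x_def field_simps)
      then show ?thesis by (simp only: mult_cancel_right) simp
    qed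
    then have "real_of_int (int a - int b) = of_int (k * int (4 * d))" by simp
    then have "int a - int b = k * int (4 * d)" by (simp only: of_int_eq_iff)
    moreover have "k \<noteq> 0" using calculation False by auto
    then have "1 * int (4 * d) \<le> \<bar>k\<bar> * int (4 * d)" by (intro mult_right_mono) auto
    then have "\<bar>k * int (4 * d)\<bar> \<ge> int (4 * d)" by (simp add: abs_mult)
    ultimately show False using assms by auto
  qed
  then have "(\<Sum>j<4*d. cis x ^ j) = 0" using one by (simp add: geometric_sum)
  then show ?thesis using False p by simp
qed simp

text \<open>Summing over the whole grid costs 4 d however many grid points are actually used, which
  keeps the bound on \<open>fejer_form\<close> free of the cardinality of S.\<close>

lemma parseval_grid:
  assumes "d \<ge> 1"
  shows "(\<Sum>j<4*d. (cmod (\<Sum>a<d. cis (real a * grid d j) * z a))\<^sup>2) = real (4 * d) * (\<Sum>a<d. (cmod (z a))\<^sup>2)"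
proof -
  have "complex_of_real (\<Sum>j<4*d. (cmod (\<Sum>a<d. cis (real a * grid d j) * z a))\<^sup>2)
      = (\<Sum>j<4*d. (\<Sum>a<d. cis (real a * grid d j) * z a) * cnj (\<Sum>b<d. cis (real b * grid d j) * z b))"
    by (simp only: of_real_sum complex_norm_square)
  also have "\<dots> = (\<Sum>j<4*d. \<Sum>a<d. \<Sum>b<d. cis ((real a - real b) * grid d j) * (z a * cnj (z b)))"
  proof -
    have "cis ((real a - real b) * x) = cis (real a * x) * cnj (cis (real b * x))" for a b x
      by (simp add: cis_cnj cis_mult left_diff_distrib)
    then show ?thesis
      unfolding cnj_sum complex_cnj_mult sum_product
      by (intro sum.cong refl) (simp only: mult_ac)
  qed
  also have "\<dots> = (\<Sum>a<d. \<Sum>b<d. \<Sum>j<4*d. cis ((real a - real b) * grid d j) * (z a * cnj (z b)))"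
    by (subst sum.swap, rule sum.cong[OF refl], rule sum.swap)
  also have "\<dots> = (\<Sum>a<d. \<Sum>b<d. (if a = b then of_nat (4 * d) else 0) * (z a * cnj (z b)))"
    using assms by (intro sum.cong refl) (simp add: sum_cis_grid flip: sum_distrib_right)
  also have "\<dots> = (\<Sum>a<d. of_nat (4 * d) * (z a * cnj (z a)))"
    by (intro sum.cong refl) (simp add: if_distrib[where f = "\<lambda>x. x * _"] sum.delta' cong: if_cong)
  also have "\<dots> = complex_of_real (real (4 * d) * (\<Sum>a<d. (cmod (z a))\<^sup>2))"
    by (simp only: complex_norm_square sum_distrib_left of_real_mult of_real_sum of_real_of_nat_eq)
  finally show ?thesis by (simp only: of_real_eq_iff)
qed

lemma parseval_grid_cnj:
  assumes "d \<ge> 1"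
  shows "(\<Sum>j<4*d. (cmod (\<Sum>a<d. cis (- (real a * grid d j)) * z a))\<^sup>2) = real (4 * d) * (\<Sum>a<d. (cmod (z a))\<^sup>2)"
proof -
  have "cmod (\<Sum>a<d. cis (- (real a * grid d j)) * z a)
      = cmod (\<Sum>a<d. cis (real a * grid d j) * cnj (z a))" for j
    by (subst complex_mod_cnj[symmetric]) (simp add: cis_cnj del: complex_mod_cnj)
  then show ?thesis using parseval_grid[OF assms, of "\<lambda>a. cnj (z a)"] by simp
qed

text \<open>Off the real circle a Fejer kernel is no longer a squared modulus, but still a product
  of two sums to which Parseval applies. The remaining power (u v)^(n - d) supplies the decay in
  \<open>fejer_form_circle_bound\<close>.\<close>

lemma fejer_form_factor:
  assumes "d \<le> n"
  defines "u \<equiv> \<lambda>c s. c + \<i> * s" and "v \<equiv> \<lambda>c s. c - \<i> * s"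
  shows "fejer_form n d S c s = (u c s * v c s) ^ n - (2 / (of_nat d)\<^sup>2) * ((u c s * v c s) ^ (n - d)
    * (\<Sum>j\<in>S. (\<Sum>a<d. cis (- (real a * grid d j)) * (u c s ^ a * v c s ^ (d - a)))
        * (\<Sum>b<d. cis (real b * grid d j) * (u c s ^ (d - b) * v c s ^ b))))"
proof -
  have e: "u c s ^ (n + a - b) * v c s ^ (n + b - a)
      = (u c s * v c s) ^ (n - d) * (u c s ^ a * v c s ^ (d - a)) * (u c s ^ (d - b) * v c s ^ b)"
    if "a < d" "b < d" for a b
  proof -
    have "n + a - b = (n - d) + (a + (d - b))" "n + b - a = (n - d) + ((d - a) + b)"
      using that assms by auto
    then show ?thesis by (simp only: power_add power_mult_distrib mult_ac)
  qed
  have "(\<Sum>a<d. \<Sum>b<d. cis ((real b - real a) * grid d j) * (u c s ^ (n + a - b) * v c s ^ (n + b - a)))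
     = (u c s * v c s) ^ (n - d) * ((\<Sum>a<d. cis (- (real a * grid d j)) * (u c s ^ a * v c s ^ (d - a)))
        * (\<Sum>b<d. cis (real b * grid d j) * (u c s ^ (d - b) * v c s ^ b)))" for j
    unfolding sum_product unfolding sum_distrib_left
  proof (intro sum.cong refl)
    fix a b assume ab: "a \<in> {..<d}" "b \<in> {..<d}"
    have "cis ((real b - real a) * grid d j) = cis (- (real a * grid d j)) * cis (real b * grid d j)"
      by (simp add: cis_mult left_diff_distrib)
    then show "cis ((real b - real a) * grid d j) * (u c s ^ (n + a - b) * v c s ^ (n + b - a))
      = (u c s * v c s) ^ (n - d) * (cis (- (real a * grid d j)) * (u c s ^ a * v c s ^ (d - a)) *
         (cis (real b * grid d j) * (u c s ^ (d - b) * v c s ^ b)))"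
      using ab by (simp add: e)
  qed
  then show ?thesis
    unfolding fejer_form_def u_def[symmetric] v_def[symmetric]
    by (simp add: power_mult_distrib sum_distrib_left u_def v_def)
qed

text \<open>Each product A_j B_j is at most (|A_j|^2 + |B_j|^2) / 2; S is then enlarged to the full
  grid and Parseval applied. The constant is 9 = 1 + 8, with 8 = (2 / d^2) * (4 d) * d.\<close>

lemma fejer_form_bound:
  assumes d: "1 \<le> d" "d \<le> n" and S: "S \<subseteq> {..<4*d}"
    and m: "cmod (c + \<i> * s) \<le> m" "cmod (c - \<i> * s) \<le> m"
  shows "cmod (fejer_form n d S c s) \<le> 9 * (cmod ((c + \<i> * s) * (c - \<i> * s)) ^ (n - d) * m ^ (2 * d))"
proof -
  define u v where "u = c + \<i> * s" and "v = c - \<i> * s"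
  have m0: "0 \<le> m" using m(1) norm_ge_zero order_trans by blast
  define A where "A j = (\<Sum>a<d. cis (- (real a * grid d j)) * (u ^ a * v ^ (d - a)))" for j
  define B where "B j = (\<Sum>b<d. cis (real b * grid d j) * (u ^ (d - b) * v ^ b))" for j
  have pw: "(cmod (u ^ a * v ^ (d - a)))\<^sup>2 \<le> m ^ (2 * d)" "(cmod (u ^ (d - a) * v ^ a))\<^sup>2 \<le> m ^ (2 * d)"
    if "a < d" for a
  proof -
    have "cmod u ^ i * cmod v ^ k \<le> m ^ i * m ^ k" for i k
      using m m0 by (intro mult_mono power_mono) (auto simp: u_def v_def)
    from this[of a "d - a"] this[of "d - a" a]
    have "cmod (u ^ a * v ^ (d - a)) \<le> m ^ d" "cmod (u ^ (d - a) * v ^ a) \<le> m ^ d"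
      using that by (auto simp: norm_mult norm_power simp flip: power_add)
    then show "(cmod (u ^ a * v ^ (d - a)))\<^sup>2 \<le> m ^ (2 * d)" "(cmod (u ^ (d - a) * v ^ a))\<^sup>2 \<le> m ^ (2 * d)"
      using power_mono[of "cmod (u ^ a * v ^ (d - a))" "m ^ d" 2] power_mono[of "cmod (u ^ (d - a) * v ^ a)" "m ^ d" 2]
      by (auto simp only: norm_ge_zero power_mult[symmetric] mult.commute[of 2])
  qed
  have AB: "(\<Sum>j<4*d. (cmod (A j))\<^sup>2) \<le> 4 * real d * (real d * m ^ (2 * d))"
    "(\<Sum>j<4*d. (cmod (B j))\<^sup>2) \<le> 4 * real d * (real d * m ^ (2 * d))"
  proof -
    have "(\<Sum>a<d. (cmod (u ^ a * v ^ (d - a)))\<^sup>2) \<le> (\<Sum>a<d. m ^ (2 * d))"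
      by (intro sum_mono pw) auto
    then show "(\<Sum>j<4*d. (cmod (A j))\<^sup>2) \<le> 4 * real d * (real d * m ^ (2 * d))"
      unfolding A_def parseval_grid_cnj[OF d(1)] by (simp add: mult_left_mono)
    have "(\<Sum>a<d. (cmod (u ^ (d - a) * v ^ a))\<^sup>2) \<le> (\<Sum>a<d. m ^ (2 * d))"
      by (intro sum_mono pw) auto
    then show "(\<Sum>j<4*d. (cmod (B j))\<^sup>2) \<le> 4 * real d * (real d * m ^ (2 * d))"
      unfolding B_def parseval_grid[OF d(1)] by (simp add: mult_left_mono)
  qed
  have "cmod (\<Sum>j\<in>S. A j * B j) \<le> (\<Sum>j\<in>S. cmod (A j) * cmod (B j))"
    by (rule order_trans[OF norm_sum]) (simp add: norm_mult)
  also have "\<dots> \<le> (\<Sum>j\<in>S. ((cmod (A j))\<^sup>2 + (cmod (B j))\<^sup>2) / 2)"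
  proof (rule sum_mono)
    fix j
    show "cmod (A j) * cmod (B j) \<le> ((cmod (A j))\<^sup>2 + (cmod (B j))\<^sup>2) / 2"
      using sum_squares_bound[of "cmod (A j)" "cmod (B j)"] by simp
  qed
  also have "\<dots> \<le> (\<Sum>j<4*d. ((cmod (A j))\<^sup>2 + (cmod (B j))\<^sup>2) / 2)"
    using S by (intro sum_mono2) auto
  also have "\<dots> \<le> 4 * real d * (real d * m ^ (2 * d))"
    using AB by (simp add: sum.distrib add_divide_distrib sum_divide_distrib[symmetric])
  finally have sAB: "cmod (\<Sum>j\<in>S. A j * B j) \<le> 4 * real d * (real d * m ^ (2 * d))" .
  have uvd: "cmod (u * v) ^ d \<le> m ^ (2 * d)"
  proof -
    have "cmod (u * v) \<le> m * m" unfolding norm_mult using m m0 by (intro mult_mono) (auto simp: u_def v_def)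
    then have "cmod (u * v) ^ d \<le> (m * m) ^ d" by (intro power_mono) auto
    then show ?thesis by (simp add: power_mult power2_eq_square)
  qed
  have "fejer_form n d S c s = (u * v) ^ n - (2 / (of_nat d)\<^sup>2) * ((u * v) ^ (n - d) * (\<Sum>j\<in>S. A j * B j))"
    unfolding fejer_form_factor[OF d(2)] A_def B_def u_def v_def ..
  also have "cmod \<dots> \<le> cmod ((u * v) ^ n) + cmod ((2 / (of_nat d)\<^sup>2) * ((u * v) ^ (n - d) * (\<Sum>j\<in>S. A j * B j)))"
    by (rule norm_triangle_ineq4)
  also have "cmod ((u * v) ^ n) = cmod (u * v) ^ (n - d) * cmod (u * v) ^ d"
    using d by (simp add: norm_power flip: power_add)
  also have "cmod ((2 / (of_nat d)\<^sup>2) * ((u * v) ^ (n - d) * (\<Sum>j\<in>S. A j * B j)))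
     = cmod (u * v) ^ (n - d) * ((2 / (real d)\<^sup>2) * cmod (\<Sum>j\<in>S. A j * B j))"
    by (simp add: norm_mult norm_power norm_divide)
  also have "cmod (u * v) ^ (n - d) * cmod (u * v) ^ d + cmod (u * v) ^ (n - d) * ((2 / (real d)\<^sup>2) * cmod (\<Sum>j\<in>S. A j * B j))
     \<le> cmod (u * v) ^ (n - d) * m ^ (2 * d) + cmod (u * v) ^ (n - d) * ((2 / (real d)\<^sup>2) * (4 * real d * (real d * m ^ (2 * d))))"
    using uvd sAB by (intro add_mono mult_left_mono) auto
  also have "(2 / (real d)\<^sup>2) * (4 * real d * (real d * m ^ (2 * d))) = 8 * m ^ (2 * d)"
    using d by (simp add: power2_eq_square)
  finally show ?thesis by (simp add: u_def v_def algebra_simps)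
qed

section \<open>Real angles: sign near the centres, covering, and mean\<close>

lemma fejer_form_trig:
  assumes "d \<le> n"
  shows "fejer_form n d S (of_real (cos (t / 2))) (of_real (sin (t / 2)))
    = 1 - (2 / (of_nat d)\<^sup>2) * (\<Sum>j\<in>S. \<Sum>a<d. \<Sum>b<d. cis ((real a - real b) * (t - grid d j)))"
proof -
  let ?c = "complex_of_real (cos (t / 2))" and ?s = "complex_of_real (sin (t / 2))"
  have u: "?c + \<i> * ?s = cis (t / 2)" "?c - \<i> * ?s = cis (- (t / 2))"
    by (auto simp: complex_eq_iff)
  have e: "cis ((real b - real a) * grid d j) * (cis (t / 2) ^ (n + a - b) * cis (- (t / 2)) ^ (n + b - a))
     = cis ((real a - real b) * (t - grid d j))" if "a < d" "b < d" for a b j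
  proof -
    have "real (n + a - b) = real n + real a - real b" "real (n + b - a) = real n + real b - real a"
      using that assms by auto
    moreover have "(real b - real a) * grid d j + (A * (t / 2) + B * - (t / 2)) = (real a - real b) * (t - grid d j)"
      if "A = real n + real a - real b" "B = real n + real b - real a" for A B
      unfolding that by (simp add: field_simps)
    ultimately show ?thesis unfolding Complex.DeMoivre cis_mult by (simp only:)
  qed
  show ?thesis
  proof -
    have "(\<Sum>j\<in>S. \<Sum>a<d. \<Sum>b<d. cis ((real b - real a) * grid d j)
        * (cis (t / 2) ^ (n + a - b) * cis (- (t / 2)) ^ (n + b - a)))
      = (\<Sum>j\<in>S. \<Sum>a<d. \<Sum>b<d. cis ((real a - real b) * (t - grid d j)))"
      by (intro sum.cong refl e) auto
    moreover have "cis (t / 2) ^ n * cis (- (t / 2)) ^ n = 1"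
      unfolding Complex.DeMoivre cis_mult by simp
    ultimately show ?thesis unfolding fejer_form_def u by (simp only:)
  qed
qed

lemma Re_fejer_form_trig:
  assumes "d \<le> n"
  shows "Re (fejer_form n d S (of_real (cos (t / 2))) (of_real (sin (t / 2))))
    = 1 - (2 / (real d)\<^sup>2) * (\<Sum>j\<in>S. \<Sum>a<d. \<Sum>b<d. cos ((real a - real b) * (t - grid d j)))"
proof -
  have "(2 / (of_nat d)\<^sup>2 :: complex) = of_real (2 / (real d)\<^sup>2)" by simp
  then show ?thesis unfolding fejer_form_trig[OF assms] by (simp del: of_real_divide)
qed

lemma fejer_kernel_eq:
  "(\<Sum>a<d. \<Sum>b<d. cos ((real a - real b) * x)) = (cmod (\<Sum>a<d. cis (real a * x)))\<^sup>2"
proof -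
  have "complex_of_real ((cmod (\<Sum>a<d. cis (real a * x)))\<^sup>2) = (\<Sum>a<d. \<Sum>b<d. cis ((real a - real b) * x))"
    unfolding complex_norm_square by (simp add: sum_product cis_cnj cis_mult left_diff_distrib)
  then have "Re (complex_of_real ((cmod (\<Sum>a<d. cis (real a * x)))\<^sup>2)) = (\<Sum>a<d. \<Sum>b<d. cos ((real a - real b) * x))"
    by simp
  then show ?thesis by simp
qed

text \<open>Close to the centre all phases a * delta stay within pi / 4, so every summand has real
  part at least sqrt 2 / 2. After the factor 2 / d^2 the kernel is at least 1 there, which makes
  \<open>fejer_form\<close> nonpositive.\<close>

lemma fejer_kernel_ge:
  assumes "d \<ge> 1" "\<bar>x - 2 * pi * of_int k\<bar> \<le> pi / real (4 * d)"
  shows "(\<Sum>a<d. \<Sum>b<d. cos ((real a - real b) * x)) \<ge> (real d)\<^sup>2 / 2"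
proof -
  define \<delta> where "\<delta> = x - 2 * pi * of_int k"
  have cos_eq: "cos (real a * x) = cos (real a * \<delta>)" for a
  proof -
    have "real a * x = real a * \<delta> + 2 * pi * of_int (int a * k)" by (simp add: \<delta>_def algebra_simps)
    then show ?thesis using cos.plus_of_int[of "real a * \<delta>" "int a * k"] by (simp add: mult_ac)
  qed
  have "sqrt 2 / 2 \<le> cos (real a * \<delta>)" if "a < d" for a
  proof -
    have "\<bar>real a * \<delta>\<bar> \<le> real d * (pi / real (4 * d))"
      unfolding abs_mult using that assms by (intro mult_mono) (auto simp: \<delta>_def)
    also have "\<dots> = pi / 4" using assms by simp
    finally have "cos (pi / 4) \<le> cos \<bar>real a * \<delta>\<bar>" by (intro cos_monotone_0_pi_le) auto
    then show ?thesis by (simp only: cos_45 cos_abs_real)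
  qed
  then have "real d * (sqrt 2 / 2) \<le> (\<Sum>a<d. cos (real a * \<delta>))"
    using sum_mono[of "{..<d}" "\<lambda>_. sqrt 2 / 2" "\<lambda>a. cos (real a * \<delta>)"] by simp
  also have "\<dots> = Re (\<Sum>a<d. cis (real a * x))" by (simp add: cos_eq)
  also have "\<dots> \<le> cmod (\<Sum>a<d. cis (real a * x))" by (rule complex_Re_le_cmod)
  finally have "(real d * (sqrt 2 / 2))\<^sup>2 \<le> (cmod (\<Sum>a<d. cis (real a * x)))\<^sup>2"
    by (intro power_mono) auto
  then show ?thesis unfolding fejer_kernel_eq by (simp add: power_mult_distrib power_divide)
qed

lemma fejer_kernel_nonneg: "0 \<le> (\<Sum>a<d. \<Sum>b<d. cos ((real a - real b) * x))"
  unfolding fejer_kernel_eq by simp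

lemma Re_fejer_form_nonpos:
  assumes "1 \<le> d" "d \<le> n" "finite S" "j \<in> S" "\<bar>t - grid d j - 2 * pi * of_int k\<bar> \<le> pi / real (4 * d)"
  shows "Re (fejer_form n d S (of_real (cos (t / 2))) (of_real (sin (t / 2)))) \<le> 0"
proof -
  have "(real d)\<^sup>2 / 2 \<le> (\<Sum>a<d. \<Sum>b<d. cos ((real a - real b) * (t - grid d j)))"
    by (rule fejer_kernel_ge[OF assms(1,5)])
  also have "\<dots> \<le> (\<Sum>j\<in>S. \<Sum>a<d. \<Sum>b<d. cos ((real a - real b) * (t - grid d j)))"
    using assms by (intro member_le_sum[of j S "\<lambda>j. \<Sum>a<d. \<Sum>b<d. cos ((real a - real b) * (t - grid d j))"] fejer_kernel_nonneg) auto
  finally have "(2 / (real d)\<^sup>2) * ((real d)\<^sup>2 / 2) \<le> (2 / (real d)\<^sup>2) * (\<Sum>j\<in>S. \<Sum>a<d. \<Sum>b<d. cos ((real a - real b) * (t - grid d j)))"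
    by (intro mult_left_mono) auto
  then show ?thesis unfolding Re_fejer_form_trig[OF assms(2)] using assms(1) by simp
qed

lemma grid_covers:
  assumes "d \<ge> 1"
  shows "\<exists>j<4*d. \<exists>k::int. \<bar>t - grid d j - 2 * pi * of_int k\<bar> \<le> pi / real (4 * d)"
proof -
  define N where "N = real (4 * d)"
  have N: "N > 0" using assms by (simp add: N_def)
  define i where "i = round (t * N / (2 * pi))"
  have r: "\<bar>of_int i - t * N / (2 * pi)\<bar> \<le> 1 / 2" unfolding i_def by (rule of_int_round_abs_le)
  define j where "j = nat (i mod int (4 * d))"
  define k where "k = i div int (4 * d)"
  have j: "int j = i mod int (4 * d)" "j < 4 * d" using assms by (auto simp: j_def nat_less_iff)
  have "i = k * int (4 * d) + int j" unfolding j k_def by (rule div_mult_mod_eq[symmetric])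
  then have i: "real_of_int i = of_int k * N + real j" by (simp add: N_def)
  have "t - grid d j - 2 * pi * of_int k = (2 * pi / N) * (t * N / (2 * pi) - of_int i)"
    unfolding i grid_def N_def[symmetric] using N by (simp add: field_simps)
  then have "\<bar>t - grid d j - 2 * pi * of_int k\<bar> = (2 * pi / N) * \<bar>of_int i - t * N / (2 * pi)\<bar>"
    using N by (simp add: abs_mult abs_minus_commute)
  also have "\<dots> \<le> (2 * pi / N) * (1 / 2)" using r N by (intro mult_left_mono) auto
  finally show ?thesis using j(2) by (auto simp: N_def)
qed

lemma integral_cos_multiple:
  "integral {-pi..pi} (\<lambda>t. cos ((real a - real b) * (\<sigma> * t - e))) = (if a = b then 2 * pi else 0)"
  if "\<sigma> = 1 \<or> \<sigma> = - 1"
proof (cases "a = b")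
  case False
  define k where "k = (real a - real b) * \<sigma>"
  have k: "k \<noteq> 0" using False that by (auto simp: k_def)
  define K where "K = (int a - int b) * (if \<sigma> = 1 then 1 else -1)"
  have kK: "k = of_int K" using that by (auto simp: k_def K_def)
  define E where "E = (real a - real b) * e"
  have "((\<lambda>t. cos (k * t - E)) has_integral (sin (k * pi - E) / k - sin (k * (-pi) - E) / k)) {-pi..pi}"
    by (rule fundamental_theorem_of_calculus)
      (use k in \<open>auto intro!: derivative_eq_intros simp: has_real_derivative_iff_has_vector_derivative[symmetric]\<close>)
  moreover have "sin (k * pi - E) = sin (k * (-pi) - E)"
  proof -
    have "k * pi - E = (k * (-pi) - E) + 2 * pi * of_int K" by (simp add: kK algebra_simps)
    then show ?thesis using sin.plus_of_int[of "k * (-pi) - E" K] by (simp add: mult_ac)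
  qed
  ultimately have "integral {-pi..pi} (\<lambda>t. cos (k * t - E)) = 0" by (simp add: integral_unique)
  moreover have "(real a - real b) * (\<sigma> * t - e) = k * t - E" for t
    by (simp add: k_def E_def algebra_simps)
  ultimately show ?thesis using False by simp
qed simp

text \<open>Only the d diagonal terms a = b of each kernel survive integration. The sign
  \<open>\<sigma>\<close> covers the reflected angle as well.\<close>

lemma integral_Re_fejer_form:
  assumes "1 \<le> d" "d \<le> n" "finite S" and \<sigma>: "\<sigma> = 1 \<or> \<sigma> = - 1"
  shows "integral {-pi..pi} (\<lambda>t. Re (fejer_form n d S (of_real (cos (\<sigma> * t / 2))) (of_real (sin (\<sigma> * t / 2)))))
    = 2 * pi * (1 - 2 * real (card S) / real d)"
proof -
  let ?f = "\<lambda>j a b t. cos ((real a - real b) * (\<sigma> * t - grid d j))"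
  have i: "?f j a b integrable_on {-pi..pi}" for j a b
    by (intro integrable_continuous_real continuous_intros)
  have "integral {-pi..pi} (\<lambda>t. 1 - (2 / (real d)\<^sup>2) * (\<Sum>j\<in>S. \<Sum>a<d. \<Sum>b<d. ?f j a b t))
     = integral {-pi..pi} (\<lambda>t. 1) - integral {-pi..pi} (\<lambda>t. (2 / (real d)\<^sup>2) * (\<Sum>j\<in>S. \<Sum>a<d. \<Sum>b<d. ?f j a b t))"
    by (rule integral_diff) (use assms(1) in \<open>auto intro!: integrable_continuous_real continuous_intros\<close>)
  also have "integral {-pi..pi} (\<lambda>t. (2 / (real d)\<^sup>2) * (\<Sum>j\<in>S. \<Sum>a<d. \<Sum>b<d. ?f j a b t))
     = (2 / (real d)\<^sup>2) * (\<Sum>j\<in>S. \<Sum>a<d. \<Sum>b<d. integral {-pi..pi} (?f j a b))"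
  proof -
    have "((\<lambda>t. \<Sum>j\<in>S. \<Sum>a<d. \<Sum>b<d. ?f j a b t) has_integral
        (\<Sum>j\<in>S. \<Sum>a<d. \<Sum>b<d. integral {-pi..pi} (?f j a b))) {-pi..pi}"
      by (intro has_integral_sum assms finite_lessThan integrable_integral i)
    then show ?thesis unfolding integral_mult_right by (simp only: integral_unique)
  qed
  also have "(\<Sum>j\<in>S. \<Sum>a<d. \<Sum>b<d. integral {-pi..pi} (?f j a b)) = real (card S) * (real d * (2 * pi))"
    unfolding integral_cos_multiple[OF \<sigma>] by simp
  also have "integral {-pi..pi} (\<lambda>t. 1) - (2 / (real d)\<^sup>2) * (real (card S) * (real d * (2 * pi)))
     = 2 * pi * (1 - 2 * real (card S) / real d)"
    using assms(1) by (simp add: field_simps power2_eq_square)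
  finally show ?thesis unfolding Re_fejer_form_trig[OF assms(2)] .
qed

section \<open>The test function\<close>

lemma sum_even_part:
  fixes f :: "nat \<Rightarrow> 'a::comm_ring_1"
  shows "(\<Sum>m\<le>2*n. f m + (-1) ^ m * f m) = 2 * (\<Sum>y\<le>n. f (2 * y))"
proof (induction n)
  case (Suc n)
  have "(\<Sum>m\<le>2*Suc n. f m + (-1) ^ m * f m)
     = (\<Sum>m\<le>2*n. f m + (-1) ^ m * f m) + 2 * f (2 * Suc n)"
    by simp
  then show ?case unfolding Suc by (simp add: algebra_simps)
qed simp

text \<open>At x = y / n the t ln t terms of \<open>ln_binom_W_over_arcsine\<close> vanish, leaving
  bounded \<open>stirling_log\<close> terms; \<open>central_ratio_lower\<close> and
  \<open>central_ratio_upper\<close> then give the local limit order 1 / R. R is the standard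
  deviation of the binomial law at this x.\<close>

lemma binom_W_mode_lower:
  assumes "0 < y" "y < n"
  defines "R \<equiv> sqrt (real y * real (n - y) / real n)"
  shows "1 / (4 * exp 1 * R) \<le> binom_W n (real y / real n) y"
proof -
  let ?x = "real y / real n"
  have x: "0 < ?x" "?x < 1" using assms by auto
  have n: "n \<ge> 1" using assms by simp
  have R: "R > 0" unfolding R_def using assms by auto
  have e1: "real n * ?x = real y" using n by simp
  have e2: "real n * (1 - ?x) = real (n - y)" using assms by (simp add: field_simps of_nat_diff)
  have "ln (binom_W n ?x y / arcsine_output n y) = stirling_log n - ln (central_ratio n) - stirling_log y - stirling_log (n - y)"
    using ln_binom_W_over_arcsine[OF x, of y n] assms n unfolding e1 e2 by simp
  also have "\<dots> \<ge> - ln (central_ratio n) - 1"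
    using stirling_log_mono[of y n] stirling_log_gap[of 0 "n - y"] assms by simp
  finally have "exp (- ln (central_ratio n) - 1) \<le> exp (ln (binom_W n ?x y / arcsine_output n y))" by simp
  then have "1 / (central_ratio n * exp 1) \<le> binom_W n ?x y / arcsine_output n y"
    using central_ratio_pos[of n] binom_W_pos[OF x, of y n] arcsine_output_pos[of n y] assms
    by (simp add: exp_diff exp_minus field_simps)
  then have W: "arcsine_output n y / (central_ratio n * exp 1) \<le> binom_W n ?x y"
    using arcsine_output_pos[of n y] by (simp add: field_simps)
  have "1 / (4 * R) \<le> arcsine_output n y / central_ratio n"
  proof -
    have lo: "1 \<le> (4 * real y * (central_ratio y)\<^sup>2) * (4 * real (n - y) * (central_ratio (n - y))\<^sup>2)"
      using mult_mono[OF central_ratio_lower[of y] central_ratio_lower[of "n - y"]] assms by simp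
    have "(central_ratio n)\<^sup>2 * real n \<le> (central_ratio n)\<^sup>2 * real (2 * n + 1)"
      by (intro mult_left_mono) auto
    then have "(central_ratio n)\<^sup>2 * real n \<le> 1" using central_ratio_upper[of n] by linarith
    then have "(central_ratio n)\<^sup>2 * real n \<le> 16 * (real y * real (n - y)) * (arcsine_output n y)\<^sup>2"
    proof (rule order_trans)
      show "1 \<le> 16 * (real y * real (n - y)) * (arcsine_output n y)\<^sup>2"
      proof -
        have "(4 * a * p) * (4 * b * q) = 16 * (a * b) * (p * q)" for a b p q :: real by simp
        with lo show ?thesis unfolding arcsine_output_def power_mult_distrib by (simp only:)
      qed
    qed
    then have "(central_ratio n)\<^sup>2 \<le> 16 * R\<^sup>2 * (arcsine_output n y)\<^sup>2"
      using n by (simp add: R_def field_simps)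
    also have "\<dots> = (4 * R * arcsine_output n y)\<^sup>2" by (simp add: power_mult_distrib)
    finally have "central_ratio n \<le> 4 * R * arcsine_output n y"
      by (rule power2_le_imp_le) (use R arcsine_output_pos[of n y] in auto)
    then show ?thesis using R central_ratio_pos[of n] by (simp add: field_simps)
  qed
  then have "1 / (4 * R) / exp 1 \<le> arcsine_output n y / central_ratio n / exp 1"
    by (intro divide_right_mono) auto
  then show ?thesis using W by (simp add: mult_ac)
qed

lemma exp_neg_le: "0 \<le> v \<Longrightarrow> exp (- v) \<le> 1 / (1 + v)" for v :: real
  using exp_ge_add_one_self[of v] by (simp add: exp_minus field_simps)

text \<open>Away from real s the two factors u, v have moduli (1 + rho -+ 2 r sin alpha)^(1/2).
  Their product loses exp (- 2 z^2) per power, and this pays for the growth exp (2 z) per degree of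
  the kernel. The Lorentzian on the right keeps part of the loss for the later integration over the
  angle.\<close>

lemma fejer_form_circle_bound:
  fixes r \<alpha> :: real
  assumes d: "1 \<le> d" "2 * d \<le> n" and S: "S \<subseteq> {..<4*d}"
  defines "\<rho> \<equiv> r\<^sup>2"
  shows "cmod (fejer_form n d S 1 (of_real r * cis \<alpha>))
    \<le> 9 * (1 + \<rho>) ^ n * exp (2 * (real d)\<^sup>2 / real n) * (1 / (1 + (real n * \<rho> / (1 + \<rho>)\<^sup>2 / 2) * (sin \<alpha>)\<^sup>2))"
proof -
  define w where "w = of_real r * cis \<alpha>"
  define \<kappa> where "\<kappa> = \<bar>r\<bar> / (1 + \<rho>)"
  define z where "z = \<kappa> * \<bar>sin \<alpha>\<bar>"
  have rho: "\<rho> \<ge> 0" by (simp add: \<rho>_def)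
  have k0: "\<kappa> \<ge> 0" "z \<ge> 0" using rho by (auto simp: \<kappa>_def z_def)
  have k2: "\<kappa>\<^sup>2 = \<rho> / (1 + \<rho>)\<^sup>2" by (simp add: \<kappa>_def power_divide \<rho>_def)
  have sc: "(sin \<alpha>)\<^sup>2 + (cos \<alpha>)\<^sup>2 = 1" by simp
  have u2: "(cmod (1 + \<i> * w))\<^sup>2 = 1 + \<rho> - 2 * r * sin \<alpha>"
  proof -
    have "(cmod (1 + \<i> * w))\<^sup>2 = (1 - r * sin \<alpha>)\<^sup>2 + (r * cos \<alpha>)\<^sup>2"
      by (simp add: cmod_power2 w_def)
    also have "\<dots> = 1 - 2 * r * sin \<alpha> + r\<^sup>2 * ((sin \<alpha>)\<^sup>2 + (cos \<alpha>)\<^sup>2)"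
      by (simp only: power2_eq_square) algebra
    finally show ?thesis unfolding sc by (simp add: \<rho>_def)
  qed
  have v2: "(cmod (1 - \<i> * w))\<^sup>2 = 1 + \<rho> + 2 * r * sin \<alpha>"
  proof -
    have "(cmod (1 - \<i> * w))\<^sup>2 = (1 + r * sin \<alpha>)\<^sup>2 + (r * cos \<alpha>)\<^sup>2"
      by (simp add: cmod_power2 w_def)
    also have "\<dots> = 1 + 2 * r * sin \<alpha> + r\<^sup>2 * ((sin \<alpha>)\<^sup>2 + (cos \<alpha>)\<^sup>2)"
      by (simp only: power2_eq_square) algebra
    finally show ?thesis unfolding sc by (simp add: \<rho>_def)
  qed
  define m where "m = sqrt ((1 + \<rho>) * (1 + 2 * z))"
  have m2: "m\<^sup>2 = (1 + \<rho>) * (1 + 2 * z)" unfolding m_def using rho k0 by simp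
  have m0: "m \<ge> 0" unfolding m_def using rho k0 by simp
  have m2': "m\<^sup>2 = 1 + \<rho> + 2 * \<bar>r * sin \<alpha>\<bar>"
  proof -
    have "(1 + \<rho>) * z = \<bar>r * sin \<alpha>\<bar>" using rho by (simp add: z_def \<kappa>_def abs_mult)
    then show ?thesis unfolding m2 by (simp add: algebra_simps)
  qed
  have um: "cmod (1 + \<i> * w) \<le> m" "cmod (1 - \<i> * w) \<le> m"
  proof -
    have "- (r * sin \<alpha>) \<le> \<bar>r * sin \<alpha>\<bar>" "r * sin \<alpha> \<le> \<bar>r * sin \<alpha>\<bar>" by auto
    then have "(cmod (1 + \<i> * w))\<^sup>2 \<le> m\<^sup>2" "(cmod (1 - \<i> * w))\<^sup>2 \<le> m\<^sup>2"
      unfolding u2 v2 m2' by linarith+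
    then show "cmod (1 + \<i> * w) \<le> m" "cmod (1 - \<i> * w) \<le> m"
      using m0 power2_le_imp_le by blast+
  qed
  have uv: "cmod ((1 + \<i> * w) * (1 - \<i> * w)) \<le> (1 + \<rho>) * exp (- (2 * z\<^sup>2))"
  proof (rule power2_le_imp_le)
    have "(cmod ((1 + \<i> * w) * (1 - \<i> * w)))\<^sup>2 = (1 + \<rho>)\<^sup>2 - 4 * \<rho> * (sin \<alpha>)\<^sup>2"
      unfolding norm_mult power_mult_distrib u2 v2 by (simp add: \<rho>_def power2_eq_square algebra_simps)
    also have "\<dots> = (1 + \<rho>)\<^sup>2 * (1 + - (4 * z\<^sup>2))"
      using rho by (simp add: z_def power_mult_distrib k2 right_diff_distrib)
    also have "\<dots> \<le> (1 + \<rho>)\<^sup>2 * exp (- (4 * z\<^sup>2))"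
      by (intro mult_left_mono exp_ge_add_one_self) auto
    also have "exp (- (4 * z\<^sup>2)) = (exp (- (2 * z\<^sup>2)))\<^sup>2" by (simp add: power2_eq_square flip: exp_add)
    finally show "(cmod ((1 + \<i> * w) * (1 - \<i> * w)))\<^sup>2 \<le> ((1 + \<rho>) * exp (- (2 * z\<^sup>2)))\<^sup>2"
      by (simp add: power_mult_distrib)
  qed (use rho in auto)
  have "cmod (fejer_form n d S 1 w) \<le> 9 * (cmod ((1 + \<i> * w) * (1 - \<i> * w)) ^ (n - d) * m ^ (2 * d))"
    by (rule fejer_form_bound[OF d(1) _ S um]) (use d in auto)
  also have "\<dots> \<le> 9 * (((1 + \<rho>) * exp (- (2 * z\<^sup>2))) ^ (n - d) * ((1 + \<rho>) * exp (2 * z)) ^ d)"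
  proof (intro mult_left_mono mult_mono power_mono uv)
    have "m ^ (2 * d) = ((1 + \<rho>) * (1 + 2 * z)) ^ d" unfolding power_mult m2 ..
    also have "\<dots> \<le> ((1 + \<rho>) * exp (2 * z)) ^ d"
      using rho k0 by (intro power_mono mult_left_mono exp_ge_add_one_self) auto
    finally show "m ^ (2 * d) \<le> ((1 + \<rho>) * exp (2 * z)) ^ d" .
  qed (use rho m0 in auto)
  also have "((1 + \<rho>) * exp (- (2 * z\<^sup>2))) ^ (n - d) * ((1 + \<rho>) * exp (2 * z)) ^ d
     = (1 + \<rho>) ^ n * exp (real (n - d) * (- (2 * z\<^sup>2)) + real d * (2 * z))"
  proof -
    have "(1 + \<rho>) ^ n = (1 + \<rho>) ^ (n - d) * (1 + \<rho>) ^ d" using d by (simp flip: power_add)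
    then show ?thesis unfolding power_mult_distrib exp_of_nat_mult[symmetric] exp_add by (simp add: mult_ac)
  qed
  also have "exp (real (n - d) * (- (2 * z\<^sup>2)) + real d * (2 * z))
     \<le> exp (2 * (real d)\<^sup>2 / real n) * (1 / (1 + real n / 2 * z\<^sup>2))"
  \<comment> \<open>As n - d >= n / 2, the exponent is at most - n z^2 + 2 d z. Half of the
    quadratic completes the square in z - 2 d / n and produces 2 d^2 / n; the other half survives as
    decay.\<close>
  proof -
    have np: "real n > 0" using d by simp
    have "real n * z\<^sup>2 \<le> 2 * real (n - d) * z\<^sup>2"
      using d by (intro mult_right_mono) auto
    moreover have "0 \<le> real n / 2 * (z - 2 * real d / real n)\<^sup>2" by simp
    moreover have "real n / 2 * (z - 2 * real d / real n)\<^sup>2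
        = real n / 2 * z\<^sup>2 - real d * (2 * z) + 2 * (real d)\<^sup>2 / real n"
      using np by (simp add: power2_eq_square field_simps)
    ultimately have "real (n - d) * (- (2 * z\<^sup>2)) + real d * (2 * z)
        \<le> 2 * (real d)\<^sup>2 / real n + - (real n / 2 * z\<^sup>2)"
      by linarith
    then have "exp (real (n - d) * (- (2 * z\<^sup>2)) + real d * (2 * z))
        \<le> exp (2 * (real d)\<^sup>2 / real n) * exp (- (real n / 2 * z\<^sup>2))"
      by (simp flip: exp_add)
    also have "\<dots> \<le> exp (2 * (real d)\<^sup>2 / real n) * (1 / (1 + real n / 2 * z\<^sup>2))"
      by (intro mult_left_mono exp_neg_le) auto
    finally show ?thesis .
  qed
  finally have "cmod (fejer_form n d S 1 w)
     \<le> 9 * ((1 + \<rho>) ^ n * (exp (2 * (real d)\<^sup>2 / real n) * (1 / (1 + real n / 2 * z\<^sup>2))))"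
    using rho by (simp add: mult_left_mono)
  moreover have "real n / 2 * z\<^sup>2 = (real n * \<rho> / (1 + \<rho>)\<^sup>2 / 2) * (sin \<alpha>)\<^sup>2"
    by (simp add: z_def power_mult_distrib k2)
  ultimately show ?thesis by (simp only: w_def mult.assoc)
qed

lemma integral_cis_multiple:
  "((\<lambda>t. cis ((real a - real b) * t)) has_integral complex_of_real (if a = b then 2 * pi else 0)) {-pi..pi}"
proof (cases "a = b")
  case True
  then show ?thesis using has_integral_const_real[of "1::complex" "-pi" pi] by (simp add: scaleR_conv_of_real)
next
  case False
  define k where "k = real a - real b"
  have k: "k \<noteq> 0" using False by (simp add: k_def)
  have "((\<lambda>t. cis (k * t)) has_integral (cis (k * pi) / (\<i> * k) - cis (k * (-pi)) / (\<i> * k))) {-pi..pi}"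
  proof (rule fundamental_theorem_of_calculus)
    fix t
    have "((\<lambda>t. cis (k * t)) has_vector_derivative (k *\<^sub>R (\<i> * cis (k * t)))) (at t within {-pi..pi})"
      unfolding has_vector_derivative_def by (auto intro!: derivative_eq_intros)
    then show "((\<lambda>t. cis (k * t) / (\<i> * k)) has_vector_derivative cis (k * t)) (at t within {-pi..pi})"
      using k has_vector_derivative_mult_left[of "\<lambda>t. cis (k * t)" _ _ "1 / (\<i> * k)"]
      by (fastforce simp: scaleR_conv_of_real)
  qed simp
  moreover have "cis (k * pi) = cis (k * (-pi))"
  proof -
    have "k * pi = k * (-pi) + 2 * pi * of_int (int a - int b)" by (simp add: k_def algebra_simps)
    then have "cis (k * pi) = cis (k * (-pi)) * cis (2 * pi * of_int (int a - int b))" by (simp only: cis_mult)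
    then show ?thesis by (simp only: cis_multiple_2pi Ints_of_int mult_1_right)
  qed
  ultimately show ?thesis using False by (simp add: k_def)
qed


text \<open>Averaging over the reflection s -> - s removes the odd powers of s and leaves a
  combination of Bernstein basis polynomials.\<close>

lemma fejer_form_even_part:
  assumes g: "\<And>c s. fejer_form n d S c s = (\<Sum>m\<le>2*n. g m * s ^ m * c ^ (2 * n - m))"
  shows "fejer_form n d S c s + fejer_form n d S c (- s) = 2 * (\<Sum>y\<le>n. g (2 * y) * s ^ (2 * y) * c ^ (2 * (n - y)))"
proof -
  have "fejer_form n d S c s + fejer_form n d S c (- s)
     = (\<Sum>m\<le>2*n. g m * s ^ m * c ^ (2 * n - m) + (-1) ^ m * (g m * s ^ m * c ^ (2 * n - m)))"
    unfolding g sum.distrib[symmetric] by (intro sum.cong refl) (simp add: power_minus[of s] mult_ac)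
  also have "\<dots> = 2 * (\<Sum>y\<le>n. g (2 * y) * s ^ (2 * y) * c ^ (2 * n - 2 * y))"
    by (rule sum_even_part)
  finally show ?thesis by (simp add: diff_mult_distrib2)
qed

text \<open>Cauchy's formula on |s| = r. The factor (1 + rho)^n / rho^y equals the binomial
  coefficient divided by the mode probability, so it costs a factor of order R, and integrating the
  Lorentzian over the angle gains 1 / R. What is left is exp (2 d^2 / n) up to a constant.\<close>

lemma fejer_form_coeff_bound:
  assumes d: "1 \<le> d" "2 * d \<le> n" and S: "S \<subseteq> {..<4*d}" and y: "y \<le> n"
    and g: "\<And>c s. fejer_form n d S c s = (\<Sum>m\<le>2*n. g m * s ^ m * c ^ (2 * n - m))"
  shows "cmod (g (2 * y)) \<le> 300 * exp (2 * (real d)\<^sup>2 / real n) * real (n choose y)"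
proof -
  have nine: "9 \<le> 300 * exp (2 * (real d)\<^sup>2 / real n)"
  proof -
    have "1 \<le> exp (2 * (real d)\<^sup>2 / real n)" by simp
    then show ?thesis by linarith
  qed
  consider "y = 0" | "y = n" "n > 0" | "0 < y" "y < n" using y by linarith
  then show ?thesis
  proof cases
    case 1
    have "fejer_form n d S 1 0 = g 0" 
    proof -
      have "(\<Sum>m\<le>2*n. g m * 0 ^ m * 1 ^ (2 * n - m)) = (\<Sum>m\<in>{0}. g m * 0 ^ m * 1 ^ (2 * n - m))"
        by (rule sum.mono_neutral_right) auto
      then show ?thesis unfolding g by simp
    qed
    then have "cmod (g 0) \<le> 9" using fejer_form_bound[OF d(1) _ S, of n 1 0 1] d by simp
    then show ?thesis using nine 1 by simp
  next
    case 2
    have "fejer_form n d S 0 1 = g (2 * n)"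
    proof -
      have "(\<Sum>m\<le>2*n. g m * 1 ^ m * 0 ^ (2 * n - m)) = (\<Sum>m\<in>{2*n}. g m * 1 ^ m * 0 ^ (2 * n - m))"
        by (rule sum.mono_neutral_right) auto
      then show ?thesis unfolding g by simp
    qed
    then have "cmod (g (2 * n)) \<le> 9" using fejer_form_bound[OF d(1) _ S, of n 0 1 1] d by simp
    then show ?thesis using nine 2 by simp
  next
    case 3
    \<comment> \<open>This minimises (1 + rho)^n / rho^y and corresponds to x = y / n, where y is
      the mode. For y = 0 and y = n it degenerates, hence the direct evaluations above.\<close>
    define \<rho> where "\<rho> = real y / real (n - y)"
    define r where "r = sqrt \<rho>"
    define E where "E = exp (2 * (real d)\<^sup>2 / real n)"
    define R where "R = sqrt (real y * real (n - y) / real n)"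
    have R: "R > 0" unfolding R_def using 3 by auto
    have rho: "\<rho> > 0" using 3 by (simp add: \<rho>_def)
    have r2: "r\<^sup>2 = \<rho>" using rho by (simp add: r_def)
    have rho1: "1 + \<rho> = real n / real (n - y)" using 3 by (simp add: \<rho>_def field_simps of_nat_diff)
    have RR: "real n * \<rho> / (1 + \<rho>)\<^sup>2 = R\<^sup>2"
      using 3 unfolding rho1 by (simp add: \<rho>_def R_def power2_eq_square field_simps del: of_nat_diff)
    let ?w = "\<lambda>t. complex_of_real r * cis (t / 2)"
    \<comment> \<open>With the half angle, s^(2k) turns by k t, so multiplying by
      \<open>cis (- (real y * t))\<close> and integrating over one period isolates the coefficient
      with index 2 y.\<close>
    define F where "F t = (fejer_form n d S 1 (?w t) + fejer_form n d S 1 (- ?w t)) / 2 * cis (- (real y * t))" for t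
    define G where "G t = 9 * (1 + \<rho>) ^ n * E * (1 / (1 + (R\<^sup>2 / 2) * (sin (t / 2))\<^sup>2))" for t
    have F_eq: "F t = (\<Sum>k\<le>n. g (2 * k) * of_real (\<rho> ^ k) * cis ((real k - real y) * t))" for t
    proof -
      have "F t = (\<Sum>k\<le>n. g (2 * k) * (?w t) ^ (2 * k)) * cis (- (real y * t))"
        unfolding F_def fejer_form_even_part[OF g] by simp
      also have "\<dots> = (\<Sum>k\<le>n. g (2 * k) * of_real (\<rho> ^ k) * cis ((real k - real y) * t))"
        unfolding sum_distrib_right
      proof (intro sum.cong refl)
        fix k
        have "(?w t) ^ (2 * k) = of_real (\<rho> ^ k) * cis (real k * t)"
          unfolding power_mult_distrib Complex.DeMoivre by (simp add: power_mult r2 flip: of_real_power)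
        moreover have "cis ((real k - real y) * t) = cis (real k * t) * cis (- (real y * t))"
          by (simp add: cis_mult left_diff_distrib)
        ultimately show "g (2 * k) * (?w t) ^ (2 * k) * cis (- (real y * t))
            = g (2 * k) * of_real (\<rho> ^ k) * cis ((real k - real y) * t)"
          by (simp only: mult.assoc)
      qed
      finally show ?thesis .
    qed
    have "(F has_integral (\<Sum>k\<le>n. g (2 * k) * of_real (\<rho> ^ k) * complex_of_real (if k = y then 2 * pi else 0))) {-pi..pi}"
      unfolding F_eq
      by (intro has_integral_sum has_integral_mult_right integral_cis_multiple finite_atMost)
    also have "(\<Sum>k\<le>n. g (2 * k) * of_real (\<rho> ^ k) * complex_of_real (if k = y then 2 * pi else 0))
      = g (2 * y) * of_real (\<rho> ^ y) * (2 * pi)"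
      using y by (subst sum.remove[of _ y]) (auto intro!: sum.neutral)
    finally have FI: "(F has_integral (g (2 * y) * of_real (\<rho> ^ y) * (2 * pi))) {-pi..pi}" .
    have FG: "cmod (F t) \<le> G t" for t
    proof -
      have b: "cmod (fejer_form n d S 1 (of_real s * cis (t / 2))) \<le> G t" if "s\<^sup>2 = \<rho>" for s
        using fejer_form_circle_bound[OF d S, of s "t / 2"] unfolding that RR G_def E_def .
      have "cmod (F t) = cmod (fejer_form n d S 1 (?w t) + fejer_form n d S 1 (- ?w t)) / 2"
        by (simp add: F_def norm_mult norm_divide)
      also have "\<dots> \<le> (cmod (fejer_form n d S 1 (?w t)) + cmod (fejer_form n d S 1 (- ?w t))) / 2"
        by (intro divide_right_mono norm_triangle_ineq) auto
      also have "\<dots> \<le> (G t + G t) / 2"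
        using b[of r] b[of "- r"] r2 by (intro divide_right_mono add_mono) auto
      finally show ?thesis by simp
    qed
    have Gint: "G integrable_on {-pi..pi}"
      unfolding G_def using lorentz_neq_0(1)[of "R\<^sup>2 / 2"]
      by (intro integrable_continuous_real continuous_intros) auto
    have "cmod (g (2 * y)) * \<rho> ^ y * (2 * pi) = cmod (integral {-pi..pi} F)"
      using FI rho by (simp add: integral_unique norm_mult norm_power)
    also have "\<dots> \<le> integral {-pi..pi} G"
      using FI Gint FG by (intro integral_norm_bound_integral) (auto simp: integrable_on_def)
    also have "\<dots> = 9 * (1 + \<rho>) ^ n * E * integral {-pi..pi} (\<lambda>t. 1 / (1 + (R\<^sup>2 / 2) * (sin (t / 2))\<^sup>2))"
      unfolding G_def by (rule integral_mult_right)
    also have "\<dots> \<le> 9 * (1 + \<rho>) ^ n * E * (4 * pi / sqrt (R\<^sup>2 / 2))"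
      using R rho by (intro mult_left_mono integral_inverse_sin_le) (auto simp: E_def)
    also have "sqrt (R\<^sup>2 / 2) = R / sqrt 2" using R by (simp add: real_sqrt_divide)
    finally have "cmod (g (2 * y)) * \<rho> ^ y * (2 * pi) \<le> (18 * sqrt 2 * E * (1 + \<rho>) ^ n / R) * (2 * pi)"
      by (simp add: field_simps)
    then have c1: "cmod (g (2 * y)) * \<rho> ^ y \<le> 18 * sqrt 2 * E * (1 + \<rho>) ^ n / R"
      by (rule mult_right_le_imp_le) simp
    have Wmode: "binom_W n (real y / real n) y = real (n choose y) * \<rho> ^ y / (1 + \<rho>) ^ n"
    proof -
      have "real n ^ n = real n ^ y * real n ^ (n - y)" "real (n - y) ^ n = real (n - y) ^ y * real (n - y) ^ (n - y)"
        using y by (simp_all flip: power_add)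
      moreover have "1 - real y / real n = real (n - y) / real n" using 3 by (simp add: field_simps of_nat_diff)
      moreover have "real (n - y) \<noteq> 0" "real n \<noteq> 0" using 3 by auto
      ultimately show ?thesis
        unfolding binom_W_def rho1 by (simp add: \<rho>_def power_divide del: of_nat_diff)
    qed
    have "1 / (4 * exp 1 * R) \<le> real (n choose y) * \<rho> ^ y / (1 + \<rho>) ^ n"
      using binom_W_mode_lower[OF 3] unfolding Wmode R_def .
    then have c2: "(1 + \<rho>) ^ n / R \<le> 4 * exp 1 * (real (n choose y) * \<rho> ^ y)"
      using R rho by (simp add: field_simps)
    have "cmod (g (2 * y)) * \<rho> ^ y \<le> 18 * sqrt 2 * E * (4 * exp 1 * (real (n choose y) * \<rho> ^ y))"
      using c1 mult_left_mono[OF c2, of "18 * sqrt 2 * E"] by (simp add: E_def)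
    also have "\<dots> = (72 * sqrt 2 * exp 1) * (E * real (n choose y) * \<rho> ^ y)" by simp
    \<comment> \<open>The constant 72 sqrt 2 e collects 18 sqrt 2 from the integral and 4 e from
      \<open>binom_W_mode_lower\<close>; it is below 72 * (3/2) * 2.72 < 300.\<close>
    also have "\<dots> \<le> 300 * (E * real (n choose y) * \<rho> ^ y)"
    proof (intro mult_right_mono)
      have "sqrt 2 \<le> 3 / (2::real)" by (rule real_le_lsqrt) (auto simp: power2_eq_square)
      moreover have "exp 1 \<le> (272 / 100 :: real)" using e_less_272 by simp
      ultimately have "sqrt 2 * exp 1 \<le> 3 / 2 * (272 / 100 :: real)" by (intro mult_mono) auto
      then have "72 * (sqrt 2 * exp 1) \<le> (300::real)" by linarith
      then show "72 * sqrt 2 * exp 1 \<le> (300::real)" by (simp only: mult.assoc)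
    qed (use rho in \<open>auto simp: E_def\<close>)
    finally have "cmod (g (2 * y)) * \<rho> ^ y \<le> (300 * E * real (n choose y)) * \<rho> ^ y" by simp
    then show ?thesis unfolding E_def by (rule mult_right_le_imp_le) (use rho in auto)
  qed
qed

lemma test_function_exists:
  assumes K: "K \<ge> 1" "16 * K \<le> n" and X: "finite X" "X \<subseteq> {0..1}" "card X \<le> K"
  obtains \<phi> :: "nat \<Rightarrow> real" where "\<And>x. x \<in> X \<Longrightarrow> binom_E n x \<phi> \<le> 0"
    "\<And>y. y \<le> n \<Longrightarrow> \<bar>\<phi> y\<bar> \<le> 300 * exp (128 * (real K)\<^sup>2 / real n)"
    "1 / 2 \<le> (\<Sum>y\<le>n. arcsine_output n y * \<phi> y)"
proof -
  \<comment> \<open>With at most 2 K centres the mean is at least 1 - 2 (2 K) / (8 K) = 1 / 2.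
    Moreover 2 d^2 = 128 K^2, and 2 d <= n is the hypothesis 16 K <= n.\<close>
  define d where "d = 8 * K"
  have d: "1 \<le> d" "2 * d \<le> n" "d \<le> n" using K by (auto simp: d_def)
  define \<theta> where "\<theta> x = 2 * arcsin (sqrt x)" for x
  have th: "(sin (\<theta> x / 2))\<^sup>2 = x" if "x \<in> X" for x
  proof -
    have x: "0 \<le> x" "x \<le> 1" using that X(2) by auto
    have "sin (arcsin (sqrt x)) = sqrt x"
      by (rule sin_arcsin) (use x in \<open>auto intro: order_trans[OF _ real_sqrt_ge_zero]\<close>)
    then show ?thesis using x by (simp add: \<theta>_def)
  qed
  have "\<forall>t. \<exists>j. j < 4 * d \<and> (\<exists>k::int. \<bar>t - grid d j - 2 * pi * of_int k\<bar> \<le> pi / real (4 * d))"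
    using grid_covers[OF d(1)] by blast
  then obtain j where j: "\<And>t. j t < 4 * d"
    "\<And>t. \<exists>k::int. \<bar>t - grid d (j t) - 2 * pi * of_int k\<bar> \<le> pi / real (4 * d)"
    by metis
  \<comment> \<open>Both signs of the angle get a centre, because the even part averages h(t) and
    h(- t) and both must be nonpositive.\<close>
  define S where "S = (\<lambda>x. j (\<theta> x)) ` X \<union> (\<lambda>x. j (- \<theta> x)) ` X"
  have S: "S \<subseteq> {..<4*d}" "finite S" using j(1) X by (auto simp: S_def)
  have cS: "card S \<le> 2 * K"
  proof -
    have "card S \<le> card ((\<lambda>x. j (\<theta> x)) ` X) + card ((\<lambda>x. j (- \<theta> x)) ` X)"
      unfolding S_def by (rule card_Un_le)
    also have "\<dots> \<le> card X + card X" by (intro add_mono card_image_le X)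
    finally show ?thesis using X(3) by simp
  qed
  obtain g where g: "\<And>c s. fejer_form n d S c s = (\<Sum>m\<le>2*n. g m * s ^ m * c ^ (2 * n - m))"
    using hform_fejer_form[OF d(3) S(2)] unfolding hform_def by blast
  \<comment> \<open>Dividing the monomial coefficient by the binomial coefficient gives the
    Bernstein coefficient, so \<open>binom_E n x \<phi>\<close> recovers the even part of the
    trigonometric polynomial.\<close>
  define \<phi> where "\<phi> y = Re (g (2 * y)) / real (n choose y)" for y
  define h where "h t = Re (fejer_form n d S (of_real (cos (t / 2))) (of_real (sin (t / 2))))" for t
  have key: "binom_E n ((sin (t / 2))\<^sup>2) \<phi> = (h t + h (- t)) / 2" for t
  proof -
    let ?c = "complex_of_real (cos (t / 2))" and ?s = "complex_of_real (sin (t / 2))"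
    have "h t + h (- t) = Re (fejer_form n d S ?c ?s + fejer_form n d S ?c (- ?s))"
      by (simp add: h_def)
    also have "\<dots> = 2 * (\<Sum>y\<le>n. Re (g (2 * y) * of_real (sin (t / 2) ^ (2 * y) * cos (t / 2) ^ (2 * (n - y)))))"
      unfolding fejer_form_even_part[OF g] by (simp add: mult.assoc)
    also have "(\<Sum>y\<le>n. Re (g (2 * y) * of_real (sin (t / 2) ^ (2 * y) * cos (t / 2) ^ (2 * (n - y)))))
        = binom_E n ((sin (t / 2))\<^sup>2) \<phi>"
      unfolding binom_E_def
    proof (intro sum.cong refl)
      fix y assume "y \<in> {..n}"
      then have "real (n choose y) \<noteq> 0" by simp
      then show "Re (g (2 * y) * of_real (sin (t / 2) ^ (2 * y) * cos (t / 2) ^ (2 * (n - y))))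
          = binom_W n ((sin (t / 2))\<^sup>2) y * \<phi> y"
        unfolding binom_W_def cos_squared_eq[symmetric] \<phi>_def
        by (simp add: power_mult flip: of_real_power of_real_mult)
    qed
    finally show ?thesis by simp
  qed
  show thesis
  proof (rule that[of \<phi>])
    fix x assume x: "x \<in> X"
    have "h t \<le> 0" if jt: "j t \<in> S" for t
    proof -
      obtain k :: int where "\<bar>t - grid d (j t) - 2 * pi * of_int k\<bar> \<le> pi / real (4 * d)" using j(2) by blast
      then show ?thesis unfolding h_def by (rule Re_fejer_form_nonpos[OF d(1,3) S(2) jt])
    qed
    moreover have "j (\<theta> x) \<in> S" "j (- \<theta> x) \<in> S" using x by (auto simp: S_def)
    ultimately have "h (\<theta> x) \<le> 0" "h (- \<theta> x) \<le> 0" by auto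
    then show "binom_E n x \<phi> \<le> 0" using key[of "\<theta> x"] th[OF x] by simp
  next
    fix y assume y: "y \<le> n"
    then have pos: "real (n choose y) > 0" by simp
    have "\<bar>Re (g (2 * y))\<bar> \<le> 300 * exp (2 * (real d)\<^sup>2 / real n) * real (n choose y)"
      using abs_Re_le_cmod fejer_form_coeff_bound[OF d(1,2) S(1) y g] by (rule order_trans)
    then show "\<bar>\<phi> y\<bar> \<le> 300 * exp (128 * (real K)\<^sup>2 / real n)"
      using pos by (simp add: \<phi>_def abs_divide d_def power_mult_distrib pos_divide_le_eq)
  next
    have hI: "h integrable_on {-pi..pi}" "(\<lambda>t. h (- t)) integrable_on {-pi..pi}"
      unfolding h_def Re_fejer_form_trig[OF d(3)] by (intro integrable_continuous_real continuous_intros; use d in simp)+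
    have "2 * pi * (\<Sum>y\<le>n. arcsine_output n y * \<phi> y)
        = (\<Sum>y\<le>n. integral {-pi..pi} (\<lambda>t. binom_W n ((sin (t / 2))\<^sup>2) y * \<phi> y))"
      unfolding sum_distrib_left by (intro sum.cong refl) (simp add: arcsine_output_eq_integral)
    also have "\<dots> = integral {-pi..pi} (\<lambda>t. binom_E n ((sin (t / 2))\<^sup>2) \<phi>)"
      unfolding binom_E_def
      by (subst integral_sum) (auto simp: binom_W_def intro!: integrable_continuous_real continuous_intros)
    also have "\<dots> = integral {-pi..pi} (\<lambda>t. (h t + h (- t)) / 2)" unfolding key ..
    also have "\<dots> = (integral {-pi..pi} h + integral {-pi..pi} (\<lambda>t. h (- t))) / 2"
      using integral_add[OF hI] by simp
    also have "integral {-pi..pi} h = 2 * pi * (1 - 2 * real (card S) / real d)"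
      using integral_Re_fejer_form[OF d(1,3) S(2), of 1] by (simp add: h_def[abs_def])
    also have "integral {-pi..pi} (\<lambda>t. h (- t)) = 2 * pi * (1 - 2 * real (card S) / real d)"
      using integral_Re_fejer_form[OF d(1,3) S(2), of "-1"] by (simp add: h_def)
    finally have "(\<Sum>y\<le>n. arcsine_output n y * \<phi> y) = 1 - 2 * real (card S) / real d" by simp
    moreover have "2 * real (card S) / real d \<le> 1 / 2"
      using cS K(1) by (simp add: d_def field_simps flip: of_nat_mult)
    ultimately show "1 / 2 \<le> (\<Sum>y\<le>n. arcsine_output n y * \<phi> y)" by simp
  qed
qed

section \<open>The lower bounds\<close>

text \<open>Each half telescopes to at most 1 / 2. The decay is polynomial, so the negative
  logarithm grows only like 2 ln (y + 2), and a rare large output costs little.\<close>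

definition edge_weight :: "nat \<Rightarrow> nat \<Rightarrow> real" where
  "edge_weight n y = (1 / ((real y + 1) * (real y + 2)) + 1 / ((real (n - y) + 1) * (real (n - y) + 2))) / 2"

text \<open>The output of the arcsine prior is too small near \<open>0\<close> and \<open>n\<close> for inputs within \<open>r / n\<close> of the
  boundary; a heavy-tailed weight of total mass \<open>1 / r\<close> repairs this.\<close>

definition reference_output :: "nat \<Rightarrow> real \<Rightarrow> nat \<Rightarrow> real" where
  "reference_output n r y = (1 - 1 / r) * arcsine_output n y + (1 / r) * edge_weight n y"

lemma edge_weight_ge: "1 / ((real y + 1) * (real y + 2)) / 2 \<le> edge_weight n y"
  unfolding edge_weight_def by (intro divide_right_mono) auto

lemma edge_weight_pos: "0 < edge_weight n y"
  by (rule less_le_trans[OF _ edge_weight_ge]) (simp add: add_pos_pos)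

lemma sum_edge_weight: "(\<Sum>y\<le>n. edge_weight n y) \<le> 1"
proof -
  have s: "(\<Sum>y\<le>n. 1 / ((real y + 1) * (real y + 2))) \<le> 1"
  proof -
    have "(\<Sum>y\<le>n. 1 / ((real y + 1) * (real y + 2))) = 1 - 1 / (real n + 2)"
    proof (induction n)
      case (Suc n)
      have "1 / ((a + 2) * (a + 3)) = 1 / (a + 2) - 1 / (a + 3)" if "a \<ge> 0" for a :: real
        using that by (simp add: field_simps)
      from this[of "real n"] show ?case using Suc by (simp add: algebra_simps)
    qed simp
    then show ?thesis by simp
  qed
  have "(\<Sum>y\<le>n. 1 / ((real (n - y) + 1) * (real (n - y) + 2))) = (\<Sum>y\<le>n. 1 / ((real y + 1) * (real y + 2)))"
    by (rule sum.reindex_bij_witness[of _ "\<lambda>y. n - y" "\<lambda>y. n - y"]) auto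
  then show ?thesis using s unfolding edge_weight_def by (simp add: sum.distrib flip: sum_divide_distrib)
qed

lemma reference_output_pos: "1 < r \<Longrightarrow> 0 < reference_output n r y"
  unfolding reference_output_def
  by (intro add_pos_pos mult_pos_pos arcsine_output_pos edge_weight_pos) auto

lemma sum_reference_output: "1 < r \<Longrightarrow> (\<Sum>y\<le>n. reference_output n r y) \<le> 1"
proof -
  assume r: "1 < r"
  have "(1 / r) * (\<Sum>y\<le>n. edge_weight n y) \<le> (1 / r) * 1"
    using r by (intro mult_left_mono sum_edge_weight) auto
  then show ?thesis
    unfolding reference_output_def sum.distrib sum_distrib_left[symmetric] sum_arcsine_output by simp
qed

lemma reference_output_reflect: "y \<le> n \<Longrightarrow> reference_output n r (n - y) = reference_output n r y"
  by (simp add: reference_output_def arcsine_output_def edge_weight_def mult.commute add.commute)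

lemma binom_E_kl_mono:
  assumes x: "0 \<le> x" "x \<le> 1" and f: "\<And>y. y \<le> n \<Longrightarrow> 0 < binom_W n x y \<Longrightarrow> f y \<le> g y"
  shows "binom_E n x f \<le> binom_E n x g"
  unfolding binom_E_def
proof (rule sum_mono)
  fix y assume "y \<in> {..n}"
  then show "binom_W n x y * f y \<le> binom_W n x y * g y"
    using f[of y] binom_W_nonneg[OF x, of n y] by (cases "binom_W n x y = 0") (auto simp: mult_left_mono)
qed

text \<open>Three costs of 2 / r: one for the mixing factor 1 - 1 / r, and one for each boundary
  error in \<open>kl_arcsine_upper\<close>.\<close>

lemma kl_reference_bulk:
  assumes n: "n \<ge> 1" and r: "r \<ge> 2" and x: "0 < x" "x < 1" "r \<le> real n * x" "r \<le> real n * (1 - x)"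
  shows "binom_E n x (\<lambda>y. ln (binom_W n x y / reference_output n r y)) \<le> capacity_main n + 6 / r"
proof -
  have l: "- ln (1 - 1 / r) \<le> 2 / r"
  proof -
    have "ln (1 / (1 - 1 / r)) \<le> 1 / (1 - 1 / r) - 1" using r by (intro ln_le_minus_one) auto
    also have "\<dots> = 1 / (r - 1)" using r by (simp add: field_simps)
    also have "\<dots> \<le> 2 / r" using r by (simp add: field_simps)
    finally show ?thesis using r by (simp add: ln_div)
  qed
  have "binom_E n x (\<lambda>y. ln (binom_W n x y / reference_output n r y))
      \<le> binom_E n x (\<lambda>y. ln (binom_W n x y / arcsine_output n y) + 2 / r)"
  proof (rule binom_E_kl_mono)
    fix y assume w: "0 < binom_W n x y"
    have J: "0 < (1 - 1 / r) * arcsine_output n y" using r arcsine_output_pos[of n y] by simp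
    have "(1 - 1 / r) * arcsine_output n y \<le> reference_output n r y"
      unfolding reference_output_def using r edge_weight_pos[of n y] by simp
    then have "ln ((1 - 1 / r) * arcsine_output n y) \<le> ln (reference_output n r y)" using J by simp
    moreover have "ln ((1 - 1 / r) * arcsine_output n y) = ln (1 - 1 / r) + ln (arcsine_output n y)"
      using r arcsine_output_pos[of n y] by (intro ln_mult_pos) auto
    moreover have "reference_output n r y > 0" using r by (intro reference_output_pos) simp
    ultimately show "ln (binom_W n x y / reference_output n r y) \<le> ln (binom_W n x y / arcsine_output n y) + 2 / r"
      using w l arcsine_output_pos[of n y] by (simp add: ln_div)
  qed (use x in auto)
  also have "\<dots> = binom_E n x (\<lambda>y. ln (binom_W n x y / arcsine_output n y)) + 2 / r"
    unfolding binom_E_add binom_E_const ..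
  also have "\<dots> \<le> capacity_main n + 2 / (real n * x) + 2 / (real n * (1 - x)) + 2 / r"
    using kl_arcsine_upper[OF x(1,2) n] by simp
  also have "\<dots> \<le> capacity_main n + 2 / r + 2 / r + 2 / r"
    using r x n by (intro add_mono order_refl divide_left_mono mult_pos_pos) auto
  finally show ?thesis by simp
qed

text \<open>Since the binomial probability is at most 1, only - ln of the reference matters, at most
  ln (2 r) + 2 ln (y + 2). Concavity linearises the second term at the mean, where the linear part
  averages to 0, and mu + 2 <= 2 r.\<close>

lemma kl_reference_edge:
  assumes r: "r \<ge> 2" and x: "0 \<le> x" "x \<le> 1" "real n * x \<le> r"
  shows "binom_E n x (\<lambda>y. ln (binom_W n x y / reference_output n r y)) \<le> 3 * ln (2 * r)"
proof -
  define \<mu> where "\<mu> = real n * x"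
  have mu: "\<mu> \<ge> 0" using x by (simp add: \<mu>_def)
  have "binom_E n x (\<lambda>y. ln (binom_W n x y / reference_output n r y))
     \<le> binom_E n x (\<lambda>y. (ln (2 * r) + 2 * ln (\<mu> + 2)) + (2 / (\<mu> + 2)) * (real y - real n * x) ^ 1)"
  proof (rule binom_E_kl_mono)
    fix y assume w: "0 < binom_W n x y"
    have ref: "reference_output n r y > 0" using r by (intro reference_output_pos) simp
    have "1 / (2 * r * ((real y + 2) * (real y + 2))) \<le> reference_output n r y"
    proof -
      have "1 / (2 * r * ((real y + 2) * (real y + 2))) \<le> 1 / (2 * r * ((real y + 1) * (real y + 2)))"
        using r by (intro divide_left_mono mult_left_mono mult_right_mono) auto
      also have "\<dots> = (1 / r) * (1 / ((real y + 1) * (real y + 2)) / 2)" by simp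
      also have "\<dots> \<le> (1 / r) * edge_weight n y" using r by (intro mult_left_mono edge_weight_ge) auto
      also have "\<dots> \<le> reference_output n r y"
        unfolding reference_output_def using r arcsine_output_pos[of n y] by simp
      finally show ?thesis .
    qed
    then have "ln (1 / (2 * r * ((real y + 2) * (real y + 2)))) \<le> ln (reference_output n r y)"
      using r by (subst ln_le_cancel_iff) (auto simp: ref)
    moreover have "ln (1 / (2 * r * ((real y + 2) * (real y + 2)))) = - (ln (2 * r) + 2 * ln (real y + 2))"
      using r by (simp add: ln_div ln_mult)
    moreover have "ln (binom_W n x y) \<le> 0" using w binom_W_le_1[OF x(1,2), of n y] by simp
    moreover have "ln (real y + 2) \<le> ln (\<mu> + 2) + (real y - \<mu>) / (\<mu> + 2)"
    proof -
      have "ln ((real y + 2) / (\<mu> + 2)) \<le> (real y + 2) / (\<mu> + 2) - 1" using mu by (intro ln_le_minus_one) auto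
      moreover have "(real y + 2) / (\<mu> + 2) - 1 = (real y - \<mu>) / (\<mu> + 2)" using mu by (simp add: field_simps)
      ultimately show ?thesis using mu by (simp add: ln_div)
    qed
    moreover have "(2 / (\<mu> + 2)) * (real y - real n * x) ^ 1 = 2 * ((real y - \<mu>) / (\<mu> + 2))"
      by (simp add: \<mu>_def)
    moreover have "ln (binom_W n x y / reference_output n r y) = ln (binom_W n x y) - ln (reference_output n r y)"
      using w ref by (simp add: ln_div)
    ultimately show "ln (binom_W n x y / reference_output n r y)
        \<le> (ln (2 * r) + 2 * ln (\<mu> + 2)) + (2 / (\<mu> + 2)) * (real y - real n * x) ^ 1"
      by linarith
  qed (use x in auto)
  also have "\<dots> = ln (2 * r) + 2 * ln (\<mu> + 2)"
    unfolding binom_E_add binom_E_cmult binom_E_const binom_central_moments by simp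
  also have "ln (\<mu> + 2) \<le> ln (2 * r)"
  proof -
    have "\<mu> + 2 \<le> 2 * r" using r x(3) by (simp add: \<mu>_def)
    then show ?thesis using mu by simp
  qed
  finally show ?thesis by simp
qed

lemma kl_reference_le:
  assumes n: "n \<ge> 1" and r: "r \<ge> 2" "3 * ln (2 * r) \<le> capacity_main n" and x: "0 \<le> x" "x \<le> 1"
  shows "binom_E n x (\<lambda>y. ln (binom_W n x y / reference_output n r y)) \<le> capacity_main n + 6 / r"
proof -
  have r0: "0 \<le> 6 / r" using r by simp
  consider "real n * x \<le> r" | "real n * (1 - x) \<le> r" | "r \<le> real n * x" "r \<le> real n * (1 - x)" by linarith
  then show ?thesis
  proof cases
    case 1
    then show ?thesis using kl_reference_edge[OF r(1) x 1] r(2) r0 by linarith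
  next
    case 2
    have "binom_E n x (\<lambda>y. ln (binom_W n x y / reference_output n r y))
       = binom_E n (1 - (1 - x)) (\<lambda>y. ln (binom_W n x y / reference_output n r y))" by simp
    also have "\<dots> = binom_E n (1 - x) (\<lambda>y. ln (binom_W n x (n - y) / reference_output n r (n - y)))"
      by (rule binom_E_reflect)
    also have "\<dots> = binom_E n (1 - x) (\<lambda>y. ln (binom_W n (1 - x) y / reference_output n r y))"
      unfolding binom_E_def
      by (intro sum.cong refl) (use binom_W_reflect[of _ n "1 - x"] in \<open>simp add: reference_output_reflect\<close>)
    also have "\<dots> \<le> 3 * ln (2 * r)" using kl_reference_edge[OF r(1), of "1 - x" n] x 2 by simp
    finally show ?thesis using r(2) r0 by linarith
  next
    case 3
    then have "0 < real n * x" "0 < real n * (1 - x)" using r by auto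
    then have "0 < x" "x < 1" using n by (auto simp: zero_less_mult_iff)
    then show ?thesis using kl_reference_bulk[OF n r(1)] 3 by simp
  qed
qed

text \<open>In \<open>kl_compensation\<close> the average is at most
  \<open>capacity_main n + 6 / r\<close>, while the capacity is at least
  \<open>capacity_main n - 18 / sqrt n\<close>. With r <= sqrt n the divergence is at most 24 / r,
  and 2 sqrt 24 <= 10.\<close>

lemma output_close_to_reference:
  assumes n: "n \<ge> 1" and M: "cap_achieving n M" and fin: "finite (msupp M)"
    and r: "r \<ge> 2" "3 * ln (2 * r) \<le> capacity_main n" "r \<le> sqrt (real n)"
  shows "(\<Sum>y\<le>n. \<bar>out_prob n M y - reference_output n r y\<bar>) \<le> 10 / sqrt r"
proof -
  have Md: "M \<in> input_dists" and MI: "mutual_info n M = capacity n"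
    using M by (auto simp: cap_achieving_def)
  note A = input_distsD(1,2)[OF Md] fin AE_msupp[OF input_distsD(1)[OF Md]]
  have S: "msupp M \<subseteq> {0..1}" by (rule msupp_subset[OF Md])
  have pos: "reference_output n r y > 0" for y using r by (intro reference_output_pos) simp
  have p1: "(\<Sum>x\<in>msupp M. measure M {x}) = 1" by (rule sum_atoms[OF A])
  have "(\<Sum>y\<le>n. out_prob n M y * ln (out_prob n M y / reference_output n r y))
     = (\<Sum>x\<in>msupp M. measure M {x} * binom_E n x (\<lambda>y. ln (binom_W n x y / reference_output n r y))) - mutual_info n M"
    using kl_compensation[OF A S pos] by simp
  also have "\<dots> \<le> (\<Sum>x\<in>msupp M. measure M {x} * (capacity_main n + 6 / r)) - mutual_info n M"
    using S by (intro diff_right_mono sum_mono mult_left_mono kl_reference_le[OF n r(1,2)]) auto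
  also have "\<dots> = capacity_main n + 6 / r - capacity n"
    unfolding sum_distrib_right[symmetric] p1 MI by simp
  also have "\<dots> \<le> 6 / r + 18 / sqrt (real n)"
    using mutual_info_arcsine_ge[OF n] mutual_info_le_capacity[OF arcsine_in_input_dists, of n] by simp
  also have "\<dots> \<le> 6 / r + 18 / r" using r n by (intro add_mono divide_left_mono mult_pos_pos) auto
  finally have D: "(\<Sum>y\<le>n. out_prob n M y * ln (out_prob n M y / reference_output n r y)) \<le> 24 / r" by simp
  have oy: "out_prob n M y = (\<Sum>x\<in>msupp M. measure M {x} * binom_W n x y)" for y
    by (rule out_prob_atoms[OF A])
  have o0: "out_prob n M y \<ge> 0" for y
    unfolding oy using S by (intro sum_nonneg mult_nonneg_nonneg binom_W_nonneg) auto
  have o1: "(\<Sum>y\<le>n. out_prob n M y) = 1"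
  proof -
    have "(\<Sum>y\<le>n. out_prob n M y) = (\<Sum>x\<in>msupp M. \<Sum>y\<le>n. measure M {x} * binom_W n x y)"
      unfolding oy by (rule sum.swap)
    also have "\<dots> = 1" by (simp add: sum_binom_W p1 flip: sum_distrib_left)
    finally show ?thesis .
  qed
  have "(\<Sum>y\<le>n. \<bar>out_prob n M y - reference_output n r y\<bar>) \<le> 2 * sqrt (24 / r)"
    by (rule total_variation_le_kl) (use o0 o1 pos D sum_reference_output[of r n] r in auto)
  also have "\<dots> \<le> 2 * sqrt (25 / r)" using r by (simp add: divide_right_mono)
  also have "\<dots> = 10 / sqrt r" by (simp add: real_sqrt_divide)
  finally show ?thesis .
qed

text \<open>The test function has mean at most 0 under the optimal output, but about 1 / 2 under the
  reference, up to B / r from the edge weight. The total variation bound makes these means differ by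
  at most 10 B / sqrt r, which forces B to be of order at least sqrt r.\<close>

lemma support_size_bound:
  assumes n: "n \<ge> 1" and M: "cap_achieving n M" and fin: "finite (msupp M)"
    and r: "r \<ge> 2" "3 * ln (2 * r) \<le> capacity_main n" "r \<le> sqrt (real n)"
    and K: "1 \<le> card (msupp M)" "16 * card (msupp M) \<le> n"
  shows "sqrt r \<le> 24 * (300 * exp (128 * (real (card (msupp M)))\<^sup>2 / real n))"
proof -
  have Md: "M \<in> input_dists" using M by (auto simp: cap_achieving_def)
  note A = input_distsD(1,2)[OF Md] fin AE_msupp[OF input_distsD(1)[OF Md]]
  have S: "msupp M \<subseteq> {0..1}" by (rule msupp_subset[OF Md])
  define B where "B = 300 * exp (128 * (real (card (msupp M)))\<^sup>2 / real n)"
  have B1: "B \<ge> 1"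
  proof -
    have "1 \<le> exp (128 * (real (card (msupp M)))\<^sup>2 / real n)" by simp
    then show ?thesis unfolding B_def by linarith
  qed
  obtain \<phi> where phi: "\<And>x. x \<in> msupp M \<Longrightarrow> binom_E n x \<phi> \<le> 0"
    "\<And>y. y \<le> n \<Longrightarrow> \<bar>\<phi> y\<bar> \<le> B" "1 / 2 \<le> (\<Sum>y\<le>n. arcsine_output n y * \<phi> y)"
    using test_function_exists[OF K fin S order_refl] unfolding B_def by blast
  have "(\<Sum>y\<le>n. out_prob n M y * \<phi> y) = (\<Sum>y\<le>n. \<Sum>x\<in>msupp M. measure M {x} * (binom_W n x y * \<phi> y))"
    by (simp add: out_prob_atoms[OF A] sum_distrib_right mult.assoc)
  also have "\<dots> = (\<Sum>x\<in>msupp M. measure M {x} * binom_E n x \<phi>)"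
    by (subst sum.swap) (simp add: binom_E_def sum_distrib_left)
  also have "\<dots> \<le> 0" by (intro sum_nonpos mult_nonneg_nonpos phi) auto
  finally have Q: "(\<Sum>y\<le>n. out_prob n M y * \<phi> y) \<le> 0" .
  have "(\<Sum>y\<le>n. reference_output n r y * \<phi> y) - (\<Sum>y\<le>n. out_prob n M y * \<phi> y)
      = (\<Sum>y\<le>n. (reference_output n r y - out_prob n M y) * \<phi> y)"
    by (simp add: sum_subtractf left_diff_distrib)
  also have "\<dots> \<le> (\<Sum>y\<le>n. \<bar>out_prob n M y - reference_output n r y\<bar> * B)"
  proof (rule sum_mono)
    fix y assume "y \<in> {..n}"
    have "(reference_output n r y - out_prob n M y) * \<phi> y \<le> \<bar>(reference_output n r y - out_prob n M y) * \<phi> y\<bar>"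
      by simp
    also have "\<dots> \<le> \<bar>out_prob n M y - reference_output n r y\<bar> * B"
      unfolding abs_mult abs_minus_commute[of "reference_output n r y"]
      using phi(2) \<open>y \<in> {..n}\<close> by (intro mult_left_mono) auto
    finally show "(reference_output n r y - out_prob n M y) * \<phi> y \<le> \<bar>out_prob n M y - reference_output n r y\<bar> * B" .
  qed
  also have "\<dots> \<le> 10 / sqrt r * B"
    unfolding sum_distrib_right[symmetric]
    using output_close_to_reference[OF n M fin r] B1 by (intro mult_right_mono) auto
  finally have up: "(\<Sum>y\<le>n. reference_output n r y * \<phi> y) \<le> 10 / sqrt r * B" using Q by simp
  have ew: "- B \<le> (\<Sum>y\<le>n. edge_weight n y * \<phi> y)"
  proof -
    have "(\<Sum>y\<le>n. edge_weight n y * (- B)) \<le> (\<Sum>y\<le>n. edge_weight n y * \<phi> y)"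
    proof (rule sum_mono)
      fix y assume "y \<in> {..n}"
      then have "- B \<le> \<phi> y" using phi(2)[of y] by (auto simp: abs_le_iff)
      then show "edge_weight n y * (- B) \<le> edge_weight n y * \<phi> y"
        using edge_weight_pos[of n y] by (intro mult_left_mono) auto
    qed
    moreover have "(\<Sum>y\<le>n. edge_weight n y) * B \<le> 1 * B"
      using B1 sum_edge_weight[of n] by (intro mult_right_mono) auto
    ultimately show ?thesis by (simp add: sum_negf sum_distrib_right)
  qed
  have "(1 - 1 / r) * (1 / 2) + (1 / r) * (- B)
      \<le> (1 - 1 / r) * (\<Sum>y\<le>n. arcsine_output n y * \<phi> y) + (1 / r) * (\<Sum>y\<le>n. edge_weight n y * \<phi> y)"
    using r phi(3) ew by (intro add_mono mult_left_mono) auto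
  also have "\<dots> = (\<Sum>y\<le>n. reference_output n r y * \<phi> y)"
    by (simp add: reference_output_def distrib_right sum.distrib sum_distrib_left mult.assoc)
  also note up
  finally have "1 / 2 \<le> 10 / sqrt r * B + (1 / r) * (B + 1 / 2)" by (simp add: algebra_simps)
  also have "\<dots> \<le> 10 / sqrt r * B + (1 / sqrt r) * (2 * B)"
  proof (intro add_left_mono mult_mono)
    have "sqrt r \<le> r" using r by (simp add: real_sqrt_le_iff sqrt_le_D real_le_lsqrt power2_eq_square)
    then show "1 / r \<le> 1 / sqrt r" using r by (intro divide_left_mono) auto
  qed (use r B1 in auto)
  also have "\<dots> = 12 * B / sqrt r" by (simp add: add_divide_distrib[symmetric])
  finally have "sqrt r \<le> 24 * B" using r by (simp add: field_simps)
  then show ?thesis by (simp add: B_def)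
qed

text \<open>The fifth power of exp (u/5) >= u/5 wins with a cubic margin. The factor 30000 is taken
  so that 30000 (l / 32)^2 exceeds 24 l^2 in \<open>support_size_loglog\<close>.\<close>

lemma exp_gt_quadratic:
  fixes u :: real
  assumes "u \<ge> 1000" shows "30000 * u\<^sup>2 < exp u"
proof -
  have "30000 * u\<^sup>2 < (u / 5) ^ 5"
  proof -
    have "1000 ^ 3 \<le> u ^ 3" using assms by (intro power_mono) auto
    then have "(30000 :: real) < u ^ 3 / 3125" by simp
    then have "30000 * u\<^sup>2 < u ^ 3 / 3125 * u\<^sup>2" using assms by (intro mult_strict_right_mono) auto
    then show ?thesis by (simp add: power_divide power_add[symmetric])
  qed
  also have "\<dots> \<le> exp (u / 5) ^ 5"
    using assms exp_ge_add_one_self[of "u / 5"] by (intro power_mono) linarith+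
  also have "\<dots> = exp u" by (simp flip: exp_of_nat_mult)
  finally show ?thesis .
qed

text \<open>If the bound failed, exp (128 K^2 / n) would be at most (ln n / 37850)^2, whereas
  \<open>support_size_bound\<close> requires it to be of order at least n^(1/32).\<close>

lemma support_size_loglog:
  assumes n: "n \<ge> 1" and M: "cap_achieving n M" and fin: "finite (msupp M)" and K1: "1 \<le> card (msupp M)"
    and L: "37850 < ln (real n * pi / (2 * exp 1))"
  shows "(1/8) * sqrt (real n * ln (ln (real n * pi / (2 * exp 1)) / 37850)) \<le> real (card (msupp M))"
proof (rule ccontr)
  define K where "K = real (card (msupp M))"
  define L where "L = ln (real n * pi / (2 * exp 1))"
  define l where "l = ln (real n)"
  have L0: "37850 < L" using assms by (simp add: L_def)
  assume "\<not> ?thesis"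
  then have "8 * K < sqrt (real n * ln (L / 37850))" by (simp add: K_def L_def)
  then have "(8 * K)\<^sup>2 < (sqrt (real n * ln (L / 37850)))\<^sup>2"
    by (intro power_strict_mono) (auto simp: K_def)
  also have "\<dots> = real n * ln (L / 37850)" using L0 by (intro real_sqrt_pow2) auto
  finally have K2: "64 * K\<^sup>2 < real n * ln (L / 37850)" by (simp add: power_mult_distrib)
  have Ll: "L \<le> l"
  proof -
    have "pi / (2 * exp 1) \<le> 1"
      using pi_less_4 exp_ge_add_one_self[of 1] by (simp add: divide_le_eq)
    then have "real n * (pi / (2 * exp 1)) \<le> real n * 1" by (intro mult_left_mono) auto
    then show ?thesis unfolding L_def l_def using n by simp
  qed
  have l0: "l > 37850" using Ll L0 by simp
  have nl: "real n = exp l" using n by (simp add: l_def)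
  \<comment> \<open>That is n^(1/16): then 3 ln (2 r) is about (3/16) ln n, below
    \<open>capacity_main n\<close>, which is about (1/2) ln n; also r <= sqrt n, and sqrt r is still
    a power of n.\<close>
  define r where "r = exp (l / 16)"
  have r2: "r \<ge> 2" using exp_ge_add_one_self[of "l / 16"] l0 unfolding r_def by linarith
  have r_ln: "3 * ln (2 * r) \<le> capacity_main n"
  proof -
    have "ln (2 * r) = ln 2 + l / 16" by (simp add: r_def ln_mult)
    moreover have "ln (2::real) \<le> 1" using ln_le_minus_one[of 2] by simp
    ultimately show ?thesis using capacity_main_ge[OF n] l0 unfolding l_def[symmetric] by linarith
  qed
  have r_sqrt: "r \<le> sqrt (real n)"
  proof (rule real_le_rsqrt)
    have "r\<^sup>2 = exp (l / 8)" by (simp add: r_def power2_eq_square flip: exp_add)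
    also have "\<dots> \<le> real n" unfolding nl using l0 by simp
    finally show "r\<^sup>2 \<le> real n" .
  qed
  \<comment> \<open>The assumed failure itself makes K small: (16 K)^2 is at most 4 n ln n, which is
    below n^2.\<close>
  have K16: "16 * card (msupp M) \<le> n"
  proof -
    have "ln (L / 37850) \<le> L / 37850" using ln_le_minus_one[of "L / 37850"] L0 by simp
    also have "\<dots> \<le> l" using Ll L0 by simp
    finally have "real n * ln (L / 37850) \<le> real n * l" by (intro mult_left_mono) auto
    moreover have "(16 * K)\<^sup>2 = 256 * K\<^sup>2" by (simp add: power_mult_distrib)
    ultimately have "(16 * K)\<^sup>2 \<le> real n * (4 * l)" using K2 by linarith
    moreover have "4 * l \<le> real n"
    proof -
      have "4 * l \<le> 30000 * l\<^sup>2" using l0 by (simp add: power2_eq_square)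
      also have "\<dots> < exp l" using l0 by (intro exp_gt_quadratic) simp
      finally show ?thesis using nl by simp
    qed
    then have "real n * (4 * l) \<le> real n * real n" by (intro mult_left_mono) auto
    ultimately have "(16 * K)\<^sup>2 \<le> (real n)\<^sup>2" unfolding power2_eq_square[of "real n"] by linarith
    then have "16 * K \<le> real n" by (rule power2_le_imp_le) simp
    then show ?thesis by (simp add: K_def flip: of_nat_mult)
  qed
  have "128 * K\<^sup>2 / real n \<le> 2 * ln (L / 37850)"
    using K2 n by (simp add: divide_le_eq mult_ac)
  then have "exp (128 * K\<^sup>2 / real n) \<le> exp (2 * ln (L / 37850))" by simp
  also have "\<dots> = (L / 37850)\<^sup>2" unfolding exp_double using L0 by simp
  also have "\<dots> \<le> (l / 37850)\<^sup>2" using Ll L0 by (intro power_mono) auto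
  finally have e: "exp (128 * K\<^sup>2 / real n) \<le> (l / 37850)\<^sup>2" .
  have "sqrt r \<le> 24 * (300 * exp (128 * K\<^sup>2 / real n))"
    unfolding K_def by (rule support_size_bound[OF n M fin r2 r_ln r_sqrt K1 K16])
  also have "\<dots> \<le> 24 * (300 * (l / 37850)\<^sup>2)" using e by simp
  also have "\<dots> \<le> 24 * l\<^sup>2" by (simp add: power_divide)
  also have "\<dots> \<le> 30000 * (l / 32)\<^sup>2" by (simp add: power_divide)
  \<comment> \<open>Here l > 37850 gives l / 32 > 1000, as \<open>exp_gt_quadratic\<close>
    demands.\<close>
  also have "\<dots> < exp (l / 32)" using l0 by (intro exp_gt_quadratic) simp
  also have "\<dots> = sqrt r"
  proof -
    have "sqrt r = sqrt ((exp (l / 32))\<^sup>2)" by (simp add: r_def power2_eq_square flip: exp_add)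
    then show ?thesis by simp
  qed
  finally show False by simp
qed

theorem theorem4:
  fixes n :: nat and M :: "real measure"
  assumes "n \<ge> 1"
    and "cap_achieving n M"
  shows "infinite (msupp M) \<or>
         real (card (msupp M)) \<ge> max 2 (max (exp (capacity n))
            ((1/8) * sqrt (real n * logplus (ln (real n * pi / (2 * exp 1)) / 37850))))"
proof (cases "finite (msupp M)")
  case fin: True
  have Md: "M \<in> input_dists" and MI: "mutual_info n M = capacity n"
    using assms(2) by (auto simp: cap_achieving_def)
  note A = input_distsD(1,2)[OF Md] fin AE_msupp[OF input_distsD(1)[OF Md]]
  have "msupp M \<noteq> {}" using sum_atoms[OF A] by auto
  then have K1: "1 \<le> card (msupp M)" using fin by (simp add: Suc_le_eq card_gt_0_iff)
  have "capacity n \<le> ln (real (card (msupp M)))"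
    using mutual_info_le_ln_card[OF A msupp_subset[OF Md], of n] MI by simp
  then have "exp (capacity n) \<le> exp (ln (real (card (msupp M))))" by simp
  also have "\<dots> = real (card (msupp M))" using K1 by simp
  finally have eC: "exp (capacity n) \<le> real (card (msupp M))" .
  have "exp (ln 2) \<le> exp (capacity n)" using capacity_ge_ln2[OF assms(1)] by (simp only: exp_le_cancel_iff)
  moreover have "exp (ln 2) = (2::real)" by simp
  ultimately have two: "2 \<le> real (card (msupp M))" using eC by linarith
  have "(1/8) * sqrt (real n * logplus (ln (real n * pi / (2 * exp 1)) / 37850)) \<le> real (card (msupp M))"
  proof (cases "37850 < ln (real n * pi / (2 * exp 1))")
    case True
    then show ?thesis
      using support_size_loglog[OF assms fin K1] by (simp add: logplus_def)
  qed (simp add: logplus_def)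
  then show ?thesis using eC two by simp
qed simp

end
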